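(* Let $\Omega=\mathbb{T}$, let $N\in\mathbb{N}$, $T>0$, and suppose the potential $V$ is constant. Let $\mathbf{x}=(x_1,\dots,x_N):[0,T]\to\mathcal{K}^N$ be a solution of the $N$-particle variational problem described in the context, with $x_{i-1}(t)<x_i(t)$ for all $1\le i\le N$ and $t\in[0,T]$ (where $x_0=x_N-1$). Put $u_i=\dot x_i$ and $R_i=\dfrac{1/N}{x_i-x_{i-1}}$. Then, for each of the two choices $$E^i(u_i,R_i)=L'(u_i)R_i\qquad\text{and}\qquad E^i(u_i,R_i)=\big(L'(u_i)u_i-L(u_i)-G(R_i)\big)R_i,$$ one has $$\frac{d}{dt}\sum_{i=1}^N E^i(u_i,R_i)\,(x_i-x_{i-1})=0 .$$
   Context: Standing data. $g\in C^1([0,\infty))$ is real-valued and non-decreasing, with $r\mapsto r g'(r)$ locally integrable near $0$. $G:(0,\infty)\to\mathbb{R}$ is a $C^1$ function (determined up to a constant) with $G'(r)=\frac{1}{r^2}\int_0^r s g'(s)\,ds$; $G$ is assumed convex. $L:\mathbb{R}\to\mathbb{R}$ is of class $C^2$, bounded below and uniformly convex: there is $\theta>0$ with $L(\lambda u+(1-\lambda)v)\le \lambda L(u)+(1-\lambda)L(v)-\theta\lambda(1-\lambda)(u-v)^2$ for all $u,v\in\mathbb{R}$, $\lambda\in[0,1]$. $V:\mathbb{T}\times[0,T]\to\mathbb{R}$ is the potential, where $\mathbb{T}=\mathbb{R}/\mathbb{Z}$. Configuration space (periodic case). Particle positions on $\mathbb{T}$ are represented by ordered lifts in $\mathbb{R}$: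 $\mathcal{K}^N=\{(x_1,\dots,x_N)\in\mathbb{R}^N: x_1\le\dots\le x_N\le x_1+1\}$, with the convention $x_0=x_N-1$. The $N$-particle variational problem. Given $\mathbf{x}^0,\mathbf{x}^T\in\mathcal{K}^N$, minimize $$\widetilde{\mathcal J}(\mathbf{x},\dot{\mathbf{x}})=\frac1N\sum_{i=1}^N\int_0^T\Big[L(\dot x_i(s))+G\Big(\frac{1/N}{x_i(s)-x_{i-1}(s)}\Big)-V(x_i(s),s)\Big]ds$$ among absolutely continuous $\mathbf{x}:[0,T]\to\mathcal{K}^N$ with $\mathbf{x}(0)=\mathbf{x}^0$, $\mathbf{x}(T)=\mathbf{x}^T$. When $x_i(s)=x_{i-1}(s)$, the $G$-term is interpreted as $\lim_{r\to\infty}G(r)\in(-\infty,+\infty]$. A minimizer is called a solution. *)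

theory Defs
  imports "HOL-Analysis.Analysis"
begin

definition C1_deriv_on :: "(real \<Rightarrow> real) \<Rightarrow> (real \<Rightarrow> real) \<Rightarrow> real set \<Rightarrow> bool" where
  "C1_deriv_on f f' S \<longleftrightarrow>
     (\<forall>r\<in>S. (f has_real_derivative f' r) (at r within S)) \<and> continuous_on S f'"

definition uniformly_convex :: "(real \<Rightarrow> real) \<Rightarrow> bool" where
  "uniformly_convex L \<longleftrightarrow>
     (\<exists>\<theta>>0. \<forall>u v. \<forall>l\<in>{0..1}.
        L (l * u + (1 - l) * v) \<le> l * L u + (1 - l) * L v - \<theta> * l * (1 - l) * (u - v)\<^sup>2)"

definition abs_continuous_on :: "real \<Rightarrow> real \<Rightarrow> (real \<Rightarrow> real) \<Rightarrow> bool" where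
  "abs_continuous_on A B f \<longleftrightarrow>
     (\<forall>\<epsilon>>0. \<exists>\<delta>>0. \<forall>(n::nat) (a::nat \<Rightarrow> real) b.
        (\<forall>k<n. A \<le> a k \<and> a k \<le> b k \<and> b k \<le> B) \<and>
        disjoint_family_on (\<lambda>k. {a k<..<b k}) {..<n} \<and>
        (\<Sum>k<n. b k - a k) < \<delta> \<longrightarrow>
        (\<Sum>k<n. \<bar>f (b k) - f (a k)\<bar>) < \<epsilon>)"

(* A configuration is a function on nat of which only the entries 1, ..., N matter. *)

definition config_space :: "nat \<Rightarrow> (nat \<Rightarrow> real) set" where
  "config_space N = {p. (\<forall>i. 1 \<le> i \<and> i < N \<longrightarrow> p i \<le> p (Suc i)) \<and> p N \<le> p 1 + 1}"

(* pred_pos N p i is x_(i-1), with the convention x_0 = x_N - 1. *)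

definition pred_pos :: "nat \<Rightarrow> (nat \<Rightarrow> real) \<Rightarrow> nat \<Rightarrow> real" where
  "pred_pos N p i = (if i = 1 then p N - 1 else p (i - 1))"

definition gap :: "nat \<Rightarrow> (nat \<Rightarrow> real) \<Rightarrow> nat \<Rightarrow> real" where
  "gap N p i = p i - pred_pos N p i"

definition local_density :: "nat \<Rightarrow> (nat \<Rightarrow> real) \<Rightarrow> nat \<Rightarrow> real" where
  "local_density N p i = (1 / real N) / gap N p i"

definition G_term :: "(real \<Rightarrow> real) \<Rightarrow> nat \<Rightarrow> (nat \<Rightarrow> real) \<Rightarrow> nat \<Rightarrow> ereal" where
  "G_term G N p i =
     (if gap N p i = 0 then Lim at_top (\<lambda>r. ereal (G r)) else ereal (G (local_density N p i)))"

(* A path maps a time to a configuration. Only its values on [0,T] matter: the velocity is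
   one-sided at the end points, and meaningful only where the path is differentiable. *)

definition velocity :: "real \<Rightarrow> (real \<Rightarrow> nat \<Rightarrow> real) \<Rightarrow> nat \<Rightarrow> real \<Rightarrow> real" where
  "velocity T x i t = vector_derivative (\<lambda>s. x s i) (at t within {0..T})"

(* Lebesgue integral with values in [-\<infinity>,\<infinity>], as the difference of the integrals of the positive
   and negative parts; e2ennreal sends negative values to 0. *)

definition ext_integral :: "real set \<Rightarrow> (real \<Rightarrow> ereal) \<Rightarrow> ereal" where
  "ext_integral S f =
     enn2ereal (\<integral>\<^sup>+ s\<in>S. e2ennreal (f s) \<partial>lborel)
     - enn2ereal (\<integral>\<^sup>+ s\<in>S. e2ennreal (- f s) \<partial>lborel)"

definition action ::
  "(real \<Rightarrow> real) \<Rightarrow> (real \<Rightarrow> real) \<Rightarrow> (real \<Rightarrow> real \<Rightarrow> real) \<Rightarrow> nat \<Rightarrow> real \<Rightarrow>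
   (real \<Rightarrow> nat \<Rightarrow> real) \<Rightarrow> ereal" where
  "action L G V N T x =
     ereal (1 / real N) *
     (\<Sum>i=1..N. ext_integral {0..T}
        (\<lambda>s. ereal (L (velocity T x i s)) + G_term G N (x s) i - ereal (V (x s i) s)))"

definition admissible_path ::
  "nat \<Rightarrow> real \<Rightarrow> (nat \<Rightarrow> real) \<Rightarrow> (nat \<Rightarrow> real) \<Rightarrow> (real \<Rightarrow> nat \<Rightarrow> real) \<Rightarrow> bool" where
  "admissible_path N T p q x \<longleftrightarrow>
     (\<forall>i\<in>{1..N}. abs_continuous_on 0 T (\<lambda>s. x s i)) \<and>
     (\<forall>t\<in>{0..T}. x t \<in> config_space N) \<and>
     (\<forall>i\<in>{1..N}. x 0 i = p i \<and> x T i = q i)"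

definition is_solution ::
  "(real \<Rightarrow> real) \<Rightarrow> (real \<Rightarrow> real) \<Rightarrow> (real \<Rightarrow> real \<Rightarrow> real) \<Rightarrow> nat \<Rightarrow> real \<Rightarrow>
   (nat \<Rightarrow> real) \<Rightarrow> (nat \<Rightarrow> real) \<Rightarrow> (real \<Rightarrow> nat \<Rightarrow> real) \<Rightarrow> bool" where
  "is_solution L G V N T p q x \<longleftrightarrow>
     admissible_path N T p q x \<and>
     (\<forall>y. admissible_path N T p q y \<longrightarrow> action L G V N T x \<le> action L G V N T y)"

end

theory Submission
  imports Defs
begin

text \<open>
  Write \<open>H\<close> for \<open>G\<close> as a function of the gap and \<open>f\<^sub>i\<close> for the derivative of the interaction energy in
  \<open>x\<^sub>i\<close>, evaluated along the given minimizer \<open>x\<close>.  Since \<open>t \<mapsto> f\<^sub>i(t)\<close> is a known continuous function,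
  the problem \<open>d/dt L'(z\<^sub>i') = f\<^sub>i\<close> with the end points of \<open>x\<^sub>i\<close> is solved by quadratures and one
  application of the intermediate value theorem.  Convexity of \<open>L\<close> makes \<open>(1 - \<epsilon>) x + \<epsilon> z\<close> a competitor
  of finite action although \<open>L\<close> may grow arbitrarily fast, and \<open>\<epsilon> \<rightarrow> 0\<close> gives
  \<open>\<integral> \<Sum> L(x\<^sub>i') - L(z\<^sub>i') \<le> \<integral> \<Sum> f\<^sub>i (z\<^sub>i - x\<^sub>i)\<close>.  The right hand side is
  \<open>\<integral> \<Sum> L'(z\<^sub>i') (x\<^sub>i' - z\<^sub>i')\<close> after integration by parts, so strong convexity of \<open>L\<close> forces \<open>x' = z'\<close> almost
  everywhere, hence \<open>x = z\<close>.  Thus \<open>x\<close> is \<open>C\<^sup>1\<close> and solves the Euler-Lagrange equations, from which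
  both conservation laws follow by a cyclic summation by parts.

  That an absolutely continuous function is differentiable almost everywhere is derived from the
  Vitali covering theorem: where the lower derivative is below \<open>p\<close> and the upper one above \<open>q > p\<close>, on a
  set of measure \<open>m\<close>, one finite union of intervals that nearly equals this set has total
  increment about at least \<open>q m\<close> and about at most \<open>p m\<close>.
\<close>

section \<open>Absolutely continuous functions\<close>

text \<open>Along the minimizer \<open>L (velocity T x i s)\<close> is only known to be integrable;
  for a fast growing \<open>L\<close> neither \<open>L'\<close> of the velocity nor \<open>L\<close>
  of a slightly perturbed velocity need be. So no equation can be obtained by differentiating the
  action in an arbitrary direction. Moving towards a path with continuous velocity avoids this:
  convexity bounds the kinetic part by an interpolation of two integrable functions, which gives an
  integrable majorant of the difference quotient before any limit is taken. Only
  \<open>\<epsilon> > 0\<close> is available, and the resulting inequality suffices because the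
  target path is chosen so that, after integration by parts, the opposite one holds pointwise. The
  interaction part is harmless, since the gaps of \<open>x\<close> have a positive minimum on
  \<open>{0..T}\<close>. Differentiability almost everywhere enters because \<open>velocity\<close>
  is arbitrary where the path has no derivative; it is what ties the action to the increments of
  \<open>x\<close>. The momentum, not the velocity, is the primary unknown: both conserved sums are
  functions of momenta and gaps that can be differentiated directly.\<close>

lemma measure_split:
  assumes "S \<in> fmeasurable M" "X \<in> sets M"
  shows "measure M S = measure M (S \<inter> X) + measure M (S - X)"
  using assms by (metis Diff_Diff_Int Un_Diff_Int Un_Diff_cancel add.commute fmeasurable_Diff measure_Un2)

lemma lmeasurable_outer_open:
  fixes S :: "real set"
  assumes S: "S \<in> lmeasurable" and "0 < \<epsilon>"
  obtains U where "open U" "S \<subseteq> U" "U \<in> lmeasurable" "measure lebesgue U < measure lebesgue S + \<epsilon>"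
proof -
  obtain U where U: "open U" "S \<subseteq> U" "U - S \<in> lmeasurable" "emeasure lebesgue (U - S) < ennreal \<epsilon>"
    using sets_lebesgue_outer_open[OF fmeasurableD[OF S] \<open>0 < \<epsilon>\<close>] by metis
  have "U = (U - S) \<union> S" using U(2) by auto
  then have "U \<in> lmeasurable"
    using U(3) S by (metis fmeasurable.Un)
  moreover have "U \<inter> S = S" using U(2) by auto
  then have "measure lebesgue U = measure lebesgue S + measure lebesgue (U - S)"
    using measure_split[OF \<open>U \<in> lmeasurable\<close> fmeasurableD[OF S]] by simp
  moreover have "measure lebesgue (U - S) < \<epsilon>"
    using U(3,4) \<open>0 < \<epsilon>\<close> by (simp add: emeasure_eq_measure2 ennreal_less_iff)
  ultimately show thesis
    using that[of U] U(1,2) by simp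
qed

text \<open>The index type is free because families of intervals are later indexed by numbers, by
  sets, by tagged intervals and by pairs of sets. Degenerate intervals and shared end points are
  allowed.\<close>

definition nonoverlapping :: "real \<Rightarrow> real \<Rightarrow> ('i \<Rightarrow> real) \<Rightarrow> ('i \<Rightarrow> real) \<Rightarrow> 'i set \<Rightarrow> bool" where
  "nonoverlapping A B a b I \<longleftrightarrow>
     finite I \<and> (\<forall>k\<in>I. A \<le> a k \<and> a k \<le> b k \<and> b k \<le> B) \<and> disjoint_family_on (\<lambda>k. {a k<..<b k}) I"

lemma abs_continuous_on_finite_family:
  assumes "abs_continuous_on A B f" "0 < \<epsilon>"
  shows "\<exists>\<delta>>0. \<forall>(I :: 'i set) a b. nonoverlapping A B a b I \<longrightarrow> (\<Sum>k\<in>I. b k - a k) < \<delta> \<longrightarrow>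
           (\<Sum>k\<in>I. \<bar>f (b k) - f (a k)\<bar>) < \<epsilon>"
proof -
  from assms obtain \<delta> where "0 < \<delta>" and \<delta> [rule_format]:
    "\<forall>(n::nat) a b. (\<forall>k<n. A \<le> a k \<and> a k \<le> b k \<and> b k \<le> B) \<and>
        disjoint_family_on (\<lambda>k. {a k<..<b k}) {..<n} \<and> (\<Sum>k<n. b k - a k) < \<delta> \<longrightarrow>
        (\<Sum>k<n. \<bar>f (b k) - f (a k)\<bar>) < \<epsilon>"
    unfolding abs_continuous_on_def by blast
  show ?thesis
  proof (intro exI[of _ \<delta>] conjI allI impI)
    fix I :: "'i set" and a b
    assume no: "nonoverlapping A B a b I" and less: "(\<Sum>k\<in>I. b k - a k) < \<delta>"
    note ab = no[unfolded nonoverlapping_def]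
    \<comment> \<open>An enumeration of \<open>I\<close> carries the family over to the initial
      segments of the naturals in which absolute continuity is phrased.\<close>
    obtain h where h: "bij_betw h {..<card I} I"
      using ab ex_bij_betw_nat_finite atLeast0LessThan by metis
    have hI: "h k \<in> I" if "k < card I" for k
      using h that by (auto simp: bij_betw_def)
    have "(\<Sum>k<card I. \<bar>f (b (h k)) - f (a (h k))\<bar>) < \<epsilon>"
    proof (rule \<delta>, intro conjI)
      show "disjoint_family_on (\<lambda>k. {a (h k)<..<b (h k)}) {..<card I}"
        using ab h hI unfolding disjoint_family_on_def bij_betw_def inj_on_def by (metis lessThan_iff)
      show "(\<Sum>k<card I. b (h k) - a (h k)) < \<delta>"
        using sum.reindex_bij_betw[OF h, of "\<lambda>k. b k - a k"] less by simp
    qed (use ab hI in auto)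
    then show "(\<Sum>k\<in>I. \<bar>f (b k) - f (a k)\<bar>) < \<epsilon>"
      using sum.reindex_bij_betw[OF h, of "\<lambda>k. \<bar>f (b k) - f (a k)\<bar>"] by simp
  qed fact
qed

lemma abs_continuous_on_iff:
  "abs_continuous_on A B f \<longleftrightarrow>
    (\<forall>\<epsilon>>0. \<exists>\<delta>>0. \<forall>(I :: nat set) a b. nonoverlapping A B a b I \<longrightarrow> (\<Sum>k\<in>I. b k - a k) < \<delta> \<longrightarrow>
       (\<Sum>k\<in>I. \<bar>f (b k) - f (a k)\<bar>) < \<epsilon>)" (is "_ = ?R")
proof
  assume "abs_continuous_on A B f"
  then show ?R by (intro allI impI abs_continuous_on_finite_family)
next
  assume R: ?R
  show "abs_continuous_on A B f"
    unfolding abs_continuous_on_def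
  proof (intro allI impI)
    fix \<epsilon> :: real assume "0 < \<epsilon>"
    then obtain \<delta> where "0 < \<delta>" and \<delta> [rule_format]:
      "\<forall>(I :: nat set) a b. nonoverlapping A B a b I \<longrightarrow> (\<Sum>k\<in>I. b k - a k) < \<delta> \<longrightarrow>
         (\<Sum>k\<in>I. \<bar>f (b k) - f (a k)\<bar>) < \<epsilon>"
      using R by blast
    show "\<exists>\<delta>>0. \<forall>(n::nat) a b. (\<forall>k<n. A \<le> a k \<and> a k \<le> b k \<and> b k \<le> B) \<and>
        disjoint_family_on (\<lambda>k. {a k<..<b k}) {..<n} \<and> (\<Sum>k<n. b k - a k) < \<delta> \<longrightarrow>
        (\<Sum>k<n. \<bar>f (b k) - f (a k)\<bar>) < \<epsilon>"
      using \<open>0 < \<delta>\<close> \<delta> by (intro exI[of _ \<delta>] conjI allI impI) (auto simp: nonoverlapping_def)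
  qed
qed

lemma abs_continuous_on_imp_continuous_on:
  assumes "abs_continuous_on A B f"
  shows "continuous_on {A..B} f"
  unfolding continuous_on_iff
proof (intro ballI allI impI)
  fix t e :: real
  assume t: "t \<in> {A..B}" and "0 < e"
  \<comment> \<open>A family with one member suffices: the interval between \<open>s\<close> and
    \<open>t\<close>.\<close>
  obtain \<delta> where "0 < \<delta>" and \<delta> [rule_format]:
    "\<forall>(I :: unit set) a b. nonoverlapping A B a b I \<longrightarrow> (\<Sum>k\<in>I. b k - a k) < \<delta> \<longrightarrow>
       (\<Sum>k\<in>I. \<bar>f (b k) - f (a k)\<bar>) < e"
    using abs_continuous_on_finite_family[OF assms \<open>0 < e\<close>] by blast
  have "\<bar>f s - f t\<bar> < e" if s: "s \<in> {A..B}" "dist s t < \<delta>" for s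
  proof -
    have "(\<Sum>k\<in>(UNIV :: unit set). \<bar>f (max s t) - f (min s t)\<bar>) < e"
      using s t by (intro \<delta>) (auto simp: nonoverlapping_def disjoint_family_on_def dist_real_def)
    then show ?thesis
      by (simp add: max_def min_def abs_minus_commute split: if_splits)
  qed
  with \<open>0 < \<delta>\<close> show "\<exists>d>0. \<forall>s\<in>{A..B}. dist s t < d \<longrightarrow> dist (f s) (f t) < e"
    by (auto simp: dist_real_def)
qed

lemma continuous_on_Icc_bounded:
  fixes f :: "real \<Rightarrow> real"
  assumes "continuous_on {A..B} f"
  shows "\<exists>M. \<forall>t\<in>{A..B}. \<bar>f t\<bar> \<le> M"
proof -
  have "bounded (f ` {A..B})"
    using assms by (simp add: compact_continuous_image compact_imp_bounded)
  then show ?thesis by (simp add: bounded_iff)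
qed

section \<open>Closure properties of absolute continuity\<close>

lemma abs_continuous_on_subinterval:
  assumes "abs_continuous_on A B f" "A \<le> A'" "B' \<le> B"
  shows "abs_continuous_on A' B' f"
  unfolding abs_continuous_on_iff
proof (intro allI impI)
  fix \<epsilon> :: real assume "0 < \<epsilon>"
  then obtain \<delta> where "0 < \<delta>" and \<delta> [rule_format]:
    "\<forall>(I :: nat set) a b. nonoverlapping A B a b I \<longrightarrow> (\<Sum>k\<in>I. b k - a k) < \<delta> \<longrightarrow>
       (\<Sum>k\<in>I. \<bar>f (b k) - f (a k)\<bar>) < \<epsilon>"
    using abs_continuous_on_finite_family[OF assms(1)] by blast
  have "nonoverlapping A B a b I" if "nonoverlapping A' B' a b I" for a b and I :: "nat set"
    using that assms(2,3) unfolding nonoverlapping_def by force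
  with \<open>0 < \<delta>\<close> \<delta> show "\<exists>\<delta>>0. \<forall>(I :: nat set) a b. nonoverlapping A' B' a b I \<longrightarrow>
      (\<Sum>k\<in>I. b k - a k) < \<delta> \<longrightarrow> (\<Sum>k\<in>I. \<bar>f (b k) - f (a k)\<bar>) < \<epsilon>"
    by blast
qed

lemma abs_continuous_on_lipschitz:
  assumes "\<And>s t. \<lbrakk>s \<in> {A..B}; t \<in> {A..B}\<rbrakk> \<Longrightarrow> \<bar>f s - f t\<bar> \<le> C * \<bar>s - t\<bar>"
  shows "abs_continuous_on A B f"
  unfolding abs_continuous_on_iff
proof (intro allI impI)
  fix \<epsilon> :: real assume "0 < \<epsilon>"
  \<comment> \<open>The added 1 keeps the divisor positive; \<open>C\<close> itself may be zero or
    negative.\<close>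
  let ?C = "\<bar>C\<bar> + 1"
  have "(\<Sum>k\<in>I. \<bar>f (b k) - f (a k)\<bar>) < \<epsilon>"
    if *: "nonoverlapping A B a b I" "(\<Sum>k\<in>I. b k - a k) < \<epsilon> / ?C" for I :: "nat set" and a b
  proof -
    have "(\<Sum>k\<in>I. \<bar>f (b k) - f (a k)\<bar>) \<le> (\<Sum>k\<in>I. ?C * (b k - a k))"
    proof (rule sum_mono)
      fix k assume "k \<in> I"
      then have k: "A \<le> a k" "a k \<le> b k" "b k \<le> B"
        using * by (auto simp: nonoverlapping_def)
      then have "\<bar>f (b k) - f (a k)\<bar> \<le> C * \<bar>b k - a k\<bar>"
        by (intro assms) auto
      also have "\<dots> \<le> ?C * (b k - a k)"
        using k by (auto intro!: mult_right_mono)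
      finally show "\<bar>f (b k) - f (a k)\<bar> \<le> ?C * (b k - a k)" .
    qed
    also have "\<dots> = ?C * (\<Sum>k\<in>I. b k - a k)"
      by (simp add: sum_distrib_left)
    also have "\<dots> < \<epsilon>"
      using * by (simp add: pos_less_divide_eq mult.commute)
    finally show ?thesis .
  qed
  moreover have "\<epsilon> / ?C > 0" using \<open>0 < \<epsilon>\<close> by simp
  ultimately show "\<exists>\<delta>>0. \<forall>(I :: nat set) a b. nonoverlapping A B a b I \<longrightarrow> (\<Sum>k\<in>I. b k - a k) < \<delta> \<longrightarrow>
       (\<Sum>k\<in>I. \<bar>f (b k) - f (a k)\<bar>) < \<epsilon>"
    by blast
qed

lemma has_derivative_imp_abs_continuous_on:
  fixes f f' :: "real \<Rightarrow> real"
  assumes deriv: "\<And>t. t \<in> {A..B} \<Longrightarrow> (f has_real_derivative f' t) (at t within {A..B})"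
    and cont: "continuous_on {A..B} f'"
  shows "abs_continuous_on A B f"
proof -
  obtain C where C: "\<And>t. t \<in> {A..B} \<Longrightarrow> \<bar>f' t\<bar> \<le> C"
    using continuous_on_Icc_bounded[OF cont] by blast
  show ?thesis
  proof (rule abs_continuous_on_lipschitz)
    fix s t assume "s \<in> {A..B}" "t \<in> {A..B}"
    then have "norm (f s - f t) \<le> C * norm (s - t)"
      using deriv C by (intro field_differentiable_bound[of "{A..B}" f f' C s t]) auto
    then show "\<bar>f s - f t\<bar> \<le> C * \<bar>s - t\<bar>" by simp
  qed
qed

lemma abs_continuous_on_mult:
  assumes f: "abs_continuous_on A B f" and g: "abs_continuous_on A B g"
  shows "abs_continuous_on A B (\<lambda>t. f t * g t)"
  unfolding abs_continuous_on_iff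
proof (intro allI impI)
  fix \<epsilon> :: real assume "0 < \<epsilon>"
  obtain Mf Mg where "\<forall>t\<in>{A..B}. \<bar>f t\<bar> \<le> Mf" "\<forall>t\<in>{A..B}. \<bar>g t\<bar> \<le> Mg"
    using continuous_on_Icc_bounded[OF abs_continuous_on_imp_continuous_on[OF f]]
      continuous_on_Icc_bounded[OF abs_continuous_on_imp_continuous_on[OF g]] by blast
  then obtain M where "M > 0" and M: "\<And>t. t \<in> {A..B} \<Longrightarrow> \<bar>f t\<bar> \<le> M \<and> \<bar>g t\<bar> \<le> M"
    by (intro that[of "max 1 (max Mf Mg)"]) (auto simp: max.coboundedI1 max.coboundedI2)
  let ?e = "\<epsilon> / (2 * M)"
  have "?e > 0" using \<open>M > 0\<close> \<open>0 < \<epsilon>\<close> by simp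
  obtain d1 where "d1 > 0" and d1 [rule_format]:
    "\<forall>(I :: nat set) a b. nonoverlapping A B a b I \<longrightarrow> (\<Sum>k\<in>I. b k - a k) < d1 \<longrightarrow>
       (\<Sum>k\<in>I. \<bar>f (b k) - f (a k)\<bar>) < ?e"
    using abs_continuous_on_finite_family[OF f \<open>?e > 0\<close>] by blast
  obtain d2 where "d2 > 0" and d2 [rule_format]:
    "\<forall>(I :: nat set) a b. nonoverlapping A B a b I \<longrightarrow> (\<Sum>k\<in>I. b k - a k) < d2 \<longrightarrow>
       (\<Sum>k\<in>I. \<bar>g (b k) - g (a k)\<bar>) < ?e"
    using abs_continuous_on_finite_family[OF g \<open>?e > 0\<close>] by blast
  have "(\<Sum>k\<in>I. \<bar>f (b k) * g (b k) - f (a k) * g (a k)\<bar>) < \<epsilon>"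
    if *: "nonoverlapping A B a b I" "(\<Sum>k\<in>I. b k - a k) < min d1 d2" for I :: "nat set" and a b
  proof -
    have "(\<Sum>k\<in>I. \<bar>f (b k) * g (b k) - f (a k) * g (a k)\<bar>) \<le>
        (\<Sum>k\<in>I. M * \<bar>f (b k) - f (a k)\<bar> + M * \<bar>g (b k) - g (a k)\<bar>)"
    proof (rule sum_mono)
      fix k assume "k \<in> I"
      then have ab: "a k \<in> {A..B}" "b k \<in> {A..B}"
        using * by (force simp: nonoverlapping_def)+
      have "f (b k) * g (b k) - f (a k) * g (a k) =
          g (b k) * (f (b k) - f (a k)) + f (a k) * (g (b k) - g (a k))"
        by (simp add: algebra_simps)
      then have "\<bar>f (b k) * g (b k) - f (a k) * g (a k)\<bar> \<le>
          \<bar>g (b k)\<bar> * \<bar>f (b k) - f (a k)\<bar> + \<bar>f (a k)\<bar> * \<bar>g (b k) - g (a k)\<bar>"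
        by (metis abs_mult abs_triangle_ineq)
      also have "\<dots> \<le> M * \<bar>f (b k) - f (a k)\<bar> + M * \<bar>g (b k) - g (a k)\<bar>"
        using ab M by (intro add_mono mult_right_mono) auto
      finally show "\<bar>f (b k) * g (b k) - f (a k) * g (a k)\<bar> \<le>
          M * \<bar>f (b k) - f (a k)\<bar> + M * \<bar>g (b k) - g (a k)\<bar>" .
    qed
    also have "\<dots> = M * (\<Sum>k\<in>I. \<bar>f (b k) - f (a k)\<bar>) + M * (\<Sum>k\<in>I. \<bar>g (b k) - g (a k)\<bar>)"
      by (simp add: sum.distrib sum_distrib_left)
    also have "\<dots> < M * ?e + M * ?e"
      using * \<open>M > 0\<close> by (intro add_strict_mono mult_strict_left_mono d1 d2) auto
    also have "\<dots> = \<epsilon>"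
      using \<open>M > 0\<close> by simp
    finally show ?thesis .
  qed
  moreover have "min d1 d2 > 0" using \<open>d1 > 0\<close> \<open>d2 > 0\<close> by simp
  ultimately show "\<exists>\<delta>>0. \<forall>(I :: nat set) a b. nonoverlapping A B a b I \<longrightarrow> (\<Sum>k\<in>I. b k - a k) < \<delta> \<longrightarrow>
       (\<Sum>k\<in>I. \<bar>f (b k) * g (b k) - f (a k) * g (a k)\<bar>) < \<epsilon>"
    by blast
qed

lemma abs_continuous_on_add:
  assumes f: "abs_continuous_on A B f" and g: "abs_continuous_on A B g"
  shows "abs_continuous_on A B (\<lambda>t. f t + g t)"
  unfolding abs_continuous_on_iff
proof (intro allI impI)
  fix \<epsilon> :: real assume "0 < \<epsilon>"
  then have "\<epsilon> / 2 > 0" by simp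
  obtain d1 where "d1 > 0" and d1 [rule_format]:
    "\<forall>(I :: nat set) a b. nonoverlapping A B a b I \<longrightarrow> (\<Sum>k\<in>I. b k - a k) < d1 \<longrightarrow>
       (\<Sum>k\<in>I. \<bar>f (b k) - f (a k)\<bar>) < \<epsilon> / 2"
    using abs_continuous_on_finite_family[OF f \<open>\<epsilon> / 2 > 0\<close>] by blast
  obtain d2 where "d2 > 0" and d2 [rule_format]:
    "\<forall>(I :: nat set) a b. nonoverlapping A B a b I \<longrightarrow> (\<Sum>k\<in>I. b k - a k) < d2 \<longrightarrow>
       (\<Sum>k\<in>I. \<bar>g (b k) - g (a k)\<bar>) < \<epsilon> / 2"
    using abs_continuous_on_finite_family[OF g \<open>\<epsilon> / 2 > 0\<close>] by blast
  have "(\<Sum>k\<in>I. \<bar>f (b k) + g (b k) - (f (a k) + g (a k))\<bar>) < \<epsilon>"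
    if *: "nonoverlapping A B a b I" "(\<Sum>k\<in>I. b k - a k) < min d1 d2" for I :: "nat set" and a b
  proof -
    have "(\<Sum>k\<in>I. \<bar>f (b k) + g (b k) - (f (a k) + g (a k))\<bar>) \<le>
        (\<Sum>k\<in>I. \<bar>f (b k) - f (a k)\<bar> + \<bar>g (b k) - g (a k)\<bar>)"
      by (intro sum_mono) linarith
    also have "\<dots> = (\<Sum>k\<in>I. \<bar>f (b k) - f (a k)\<bar>) + (\<Sum>k\<in>I. \<bar>g (b k) - g (a k)\<bar>)"
      by (simp add: sum.distrib)
    also have "\<dots> < \<epsilon> / 2 + \<epsilon> / 2"
      using * by (intro add_strict_mono d1 d2) auto
    finally show ?thesis by simp
  qed
  moreover have "min d1 d2 > 0" using \<open>d1 > 0\<close> \<open>d2 > 0\<close> by simp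
  ultimately show "\<exists>\<delta>>0. \<forall>(I :: nat set) a b. nonoverlapping A B a b I \<longrightarrow> (\<Sum>k\<in>I. b k - a k) < \<delta> \<longrightarrow>
       (\<Sum>k\<in>I. \<bar>f (b k) + g (b k) - (f (a k) + g (a k))\<bar>) < \<epsilon>"
    by blast
qed

lemma abs_continuous_on_const: "abs_continuous_on A B (\<lambda>_. c)"
  by (rule abs_continuous_on_lipschitz[where C = 0]) simp

lemma abs_continuous_on_diff:
  assumes "abs_continuous_on A B f" "abs_continuous_on A B g"
  shows "abs_continuous_on A B (\<lambda>t. f t - g t)"
proof -
  have "abs_continuous_on A B (\<lambda>t. f t + (- 1) * g t)"
    by (intro abs_continuous_on_add abs_continuous_on_mult abs_continuous_on_const assms)
  then show ?thesis by simp
qed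

lemma abs_continuous_on_sum:
  "(\<And>i. i \<in> I \<Longrightarrow> abs_continuous_on A B (f i)) \<Longrightarrow> abs_continuous_on A B (\<lambda>t. \<Sum>i\<in>I. f i t)"
  by (induction I rule: infinite_finite_induct)
     (simp_all add: abs_continuous_on_add abs_continuous_on_const)

text \<open>
  A gauge that confines the intervals tagged in \<open>N\<close> to an open set of small measure; absolute
  continuity bounds their increments.
\<close>

lemma abs_continuous_on_has_integral:
  fixes f f' :: "real \<Rightarrow> real"
  assumes "A \<le> B" and ac: "abs_continuous_on A B f" and N: "negligible N"
    and deriv: "\<And>t. t \<in> {A..B} - N \<Longrightarrow> (f has_real_derivative f' t) (at t within {A..B})"
  shows "(f' has_integral (f B - f A)) {A..B}"
proof (rule has_integral_spike[OF N])
  \<comment> \<open>With the value 0 on \<open>N\<close>, a tag in \<open>N\<close> contributes only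
    the increment of \<open>f\<close> over its interval; the uncontrolled values of
    \<open>f'\<close> there cannot disturb the Riemann sum.\<close>
  let ?g = "\<lambda>t. if t \<in> N then 0 else f' t"
  show "f' t = ?g t" if "t \<in> {A..B} - N" for t
    using that by simp
  show "(?g has_integral (f B - f A)) {A..B}"
    unfolding has_integral_real
  proof (intro allI impI)
    fix e :: real assume "e > 0"
    \<comment> \<open>The added 1 covers the case \<open>A = B\<close>.\<close>
    define e1 where "e1 = e / (2 * (B - A + 1))"
    have "e1 > 0" using \<open>e > 0\<close> \<open>A \<le> B\<close> by (simp add: e1_def)
    have e1: "e1 * (B - A) \<le> e / 2"
      using \<open>e > 0\<close> \<open>A \<le> B\<close> by (simp add: e1_def field_simps)
    obtain \<delta> where "0 < \<delta>" and \<delta> [rule_format]: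
    "\<forall>(I :: (real \<times> real set) set) a b. nonoverlapping A B a b I \<longrightarrow> (\<Sum>k\<in>I. b k - a k) < \<delta> \<longrightarrow>
       (\<Sum>k\<in>I. \<bar>f (b k) - f (a k)\<bar>) < e / 2"
    using abs_continuous_on_finite_family[OF ac half_gt_zero[OF \<open>e > 0\<close>]] by blast
    obtain U where U: "open U" "N \<subseteq> U" "U \<in> lmeasurable" "measure lebesgue U < \<delta>"
      using lmeasurable_outer_open[OF negligible_imp_measurable[OF N] \<open>0 < \<delta>\<close>] negligible_imp_measure0[OF N]
      by auto
    have "\<forall>t\<in>{A..B} - N. \<exists>d. d > 0 \<and>
        (\<forall>y\<in>{A..B}. \<bar>y - t\<bar> < d \<longrightarrow> \<bar>f y - f t - f' t * (y - t)\<bar> \<le> e1 * \<bar>y - t\<bar>)"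
    proof
      fix t assume "t \<in> {A..B} - N"
      then have "(f has_derivative (*) (f' t)) (at t within {A..B})"
        using deriv by (simp add: has_field_derivative_def)
      then show "\<exists>d. d > 0 \<and> (\<forall>y\<in>{A..B}. \<bar>y - t\<bar> < d \<longrightarrow>
          \<bar>f y - f t - f' t * (y - t)\<bar> \<le> e1 * \<bar>y - t\<bar>)"
        using \<open>e1 > 0\<close> unfolding has_derivative_within_alt real_norm_def by blast
    qed
    from bchoice[OF this] obtain d where d: "\<And>t. t \<in> {A..B} - N \<Longrightarrow> d t > 0"
      "\<And>t y. \<lbrakk>t \<in> {A..B} - N; y \<in> {A..B}; \<bar>y - t\<bar> < d t\<rbrakk> \<Longrightarrow> \<bar>f y - f t - f' t * (y - t)\<bar> \<le> e1 * \<bar>y - t\<bar>"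
      by blast
    define \<gamma> where "\<gamma> t = (if t \<in> N then U else if t \<in> {A..B} then ball t (d t) else UNIV)" for t
    have gauge: "gauge \<gamma>"
      unfolding gauge_def \<gamma>_def using U d by auto
    have close: "norm ((\<Sum>(x,k)\<in>\<D>. measure lborel k *\<^sub>R ?g x) - (f B - f A)) < e"
      if \<D>: "\<D> tagged_division_of {A..B}" "\<gamma> fine \<D>" for \<D>
    proof -
      note D = tagged_division_ofD[OF \<D>(1)]
      have K: "\<exists>u v. K = {u..v} \<and> u \<le> x \<and> x \<le> v \<and> A \<le> u \<and> v \<le> B \<and> Inf K = u \<and> Sup K = v \<and> measure lborel K = v - u"
        if xK: "(x, K) \<in> \<D>" for x K
      proof -
        obtain u v where uv: "K = {u..v}"
          using D(4)[OF xK] by auto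
        then show ?thesis
          using D(2)[OF xK] D(3)[OF xK] by (intro exI[of _ u] exI[of _ v]) auto
      qed
      let ?\<Delta> = "\<lambda>K. f (Sup K) - f (Inf K)"
      have "(\<Sum>(x,k)\<in>\<D>. measure lborel k *\<^sub>R ?g x) - (f B - f A) = (\<Sum>(x,k)\<in>\<D>. measure lborel k *\<^sub>R ?g x - ?\<Delta> k)"
        using additive_tagged_division_1[OF \<open>A \<le> B\<close> \<D>(1), of f]
        by (simp add: sum_subtractf case_prod_unfold)
      also have "norm \<dots> \<le> (\<Sum>(x,k)\<in>\<D>. \<bar>measure lborel k * ?g x - ?\<Delta> k\<bar>)"
        by (rule order.trans[OF norm_sum]) (simp add: case_prod_unfold)
      also have "\<dots> = (\<Sum>(x,k)\<in>{p\<in>\<D>. fst p \<in> N}. \<bar>measure lborel k * ?g x - ?\<Delta> k\<bar>)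
                   + (\<Sum>(x,k)\<in>{p\<in>\<D>. fst p \<notin> N}. \<bar>measure lborel k * ?g x - ?\<Delta> k\<bar>)"
      proof -
        have "\<D> = {p\<in>\<D>. fst p \<in> N} \<union> {p\<in>\<D>. fst p \<notin> N}" by blast
        moreover have "{p\<in>\<D>. fst p \<in> N} \<inter> {p\<in>\<D>. fst p \<notin> N} = {}" by blast
        ultimately show ?thesis
          using sum.union_disjoint[of "{p\<in>\<D>. fst p \<in> N}" "{p\<in>\<D>. fst p \<notin> N}"] D(1)
          by (metis (no_types, lifting) finite_Un)
      qed
      also have "\<dots> < e / 2 + e / 2"
      proof (rule add_less_le_mono)
        let ?DN = "{p\<in>\<D>. fst p \<in> N}"
        have "(\<Sum>p\<in>?DN. \<bar>f (Sup (snd p)) - f (Inf (snd p))\<bar>) < e / 2"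
        proof (rule \<delta>, unfold nonoverlapping_def, intro conjI ballI)
          show "finite ?DN" using D(1) by simp
          show "A \<le> Inf (snd p)" "Inf (snd p) \<le> Sup (snd p)" "Sup (snd p) \<le> B" if "p \<in> ?DN" for p
            using K[of "fst p" "snd p"] that by auto
          show "disjoint_family_on (\<lambda>p. {Inf (snd p)<..<Sup (snd p)}) ?DN"
          proof (unfold disjoint_family_on_def, intro ballI impI)
            fix p p' assume *: "p \<in> ?DN" "p' \<in> ?DN" "p \<noteq> p'"
            have "interior (snd p) \<inter> interior (snd p') = {}"
              using D(5)[of "fst p" "snd p" "fst p'" "snd p'"] * by auto
            moreover have "interior (snd q) = {Inf (snd q)<..<Sup (snd q)}" if "q \<in> ?DN" for q
            proof -
              have "(fst q, snd q) \<in> \<D>"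
                using that by simp
              then show ?thesis
                using K by (metis interior_atLeastAtMost_real)
            qed
            ultimately show "{Inf (snd p)<..<Sup (snd p)} \<inter> {Inf (snd p')<..<Sup (snd p')} = {}"
              using * by blast
          qed
          have part: "?DN tagged_partial_division_of {A..B}"
            using \<D>(1) unfolding tagged_division_of_def
            by (auto intro: tagged_partial_division_subset)
          have "(\<Sum>p\<in>?DN. Sup (snd p) - Inf (snd p)) = (\<Sum>(x,K)\<in>?DN. measure lborel K)"
          proof (rule sum.cong[OF refl])
            fix p assume "p \<in> ?DN"
            then have "(fst p, snd p) \<in> \<D>" by simp
            from K[OF this] show "Sup (snd p) - Inf (snd p) = (case p of (x, K) \<Rightarrow> measure lborel K)"
              by (auto simp: case_prod_unfold)
          qed
          \<comment> \<open>Different tags can share an interval only if its interior is empty, so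
            passing to the set of intervals drops nothing but terms of measure zero.\<close>
          also have "\<dots> = sum (measure lborel) (snd ` ?DN)"
          proof (rule sum.over_tagged_division_lemma)
            show "?DN tagged_division_of \<Union>(snd ` ?DN)"
              unfolding tagged_division_of
            proof (intro conjI allI impI)
              show "finite ?DN" using D(1) by simp
              show "x \<in> k" "\<exists>u v. k = cbox u v" "k \<subseteq> \<Union>(snd ` ?DN)" if "(x, k) \<in> ?DN" for x k
                using that D(2,4)[of x k] by (auto intro: image_eqI[of _ _ "(x, k)"])
              show "interior k1 \<inter> interior k2 = {}"
                if "(x1, k1) \<in> ?DN \<and> (x2, k2) \<in> ?DN \<and> (x1, k1) \<noteq> (x2, k2)" for x1 k1 x2 k2
                using that D(5)[of x1 k1 x2 k2] by simp
              show "\<Union>{k. \<exists>x. (x, k) \<in> ?DN} = \<Union>(snd ` ?DN)"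
              proof -
                have "{k. \<exists>x. (x, k) \<in> ?DN} = snd ` ?DN" by force
                then show ?thesis by simp
              qed
            qed
          qed (simp add: content_eq_0_interior)
          also have "\<dots> = sum (measure lebesgue) (snd ` ?DN)"
          proof (rule sum.cong[OF refl])
            fix k assume "k \<in> snd ` ?DN"
            then obtain x where "(x, k) \<in> \<D>" by auto
            from K[OF this] obtain u v where "k = {u..v}" by blast
            then show "measure lborel k = measure lebesgue k" by simp
          qed
          also have "\<dots> = measure lebesgue (\<Union>(snd ` ?DN))"
            by (rule content_division) (rule partial_division_of_tagged_division[OF part])
          also have "\<dots> \<le> measure lebesgue U"
          proof (rule measure_mono_fmeasurable)
            show "\<Union>(snd ` ?DN) \<subseteq> U"
            proof clarify
              fix x k y assume "(x, k) \<in> \<D>" "fst (x, k) \<in> N" "y \<in> snd (x, k)"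
              moreover from this have "k \<subseteq> \<gamma> x"
                using \<D>(2) by (auto simp: fine_def)
              ultimately show "y \<in> U" by (auto simp: \<gamma>_def)
            qed
            show "\<Union>(snd ` ?DN) \<in> sets lebesgue"
              using lmeasurable_division[OF partial_division_of_tagged_division[OF part]]
              by (simp add: fmeasurableD)
          qed (use U in auto)
          also have "\<dots> < \<delta>" by fact
          finally show "(\<Sum>p\<in>?DN. Sup (snd p) - Inf (snd p)) < \<delta>" .
        qed
        also have "(\<Sum>p\<in>?DN. \<bar>f (Sup (snd p)) - f (Inf (snd p))\<bar>) = (\<Sum>(x,k)\<in>?DN. \<bar>measure lborel k * ?g x - ?\<Delta> k\<bar>)"
          by (rule sum.cong) (auto simp: abs_minus_commute)
        finally show "(\<Sum>(x,k)\<in>?DN. \<bar>measure lborel k * ?g x - ?\<Delta> k\<bar>) < e / 2" .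
        have "(\<Sum>(x,k)\<in>{p\<in>\<D>. fst p \<notin> N}. \<bar>measure lborel k * ?g x - ?\<Delta> k\<bar>)
            \<le> (\<Sum>(x,k)\<in>{p\<in>\<D>. fst p \<notin> N}. e1 * measure lborel k)"
        proof (rule sum_mono, clarify)
          fix x k assume xk: "(x, k) \<in> \<D>" "fst (x, k) \<notin> N"
          obtain u v where uv: "k = {u..v}" "u \<le> x" "x \<le> v" "A \<le> u" "v \<le> B" "Inf k = u" "Sup k = v" "measure lborel k = v - u"
            using K[OF xk(1)] by metis
          have x: "x \<in> {A..B} - N" using uv xk by auto
          have "k \<subseteq> \<gamma> x"
            using \<D>(2) xk by (auto simp: fine_def)
          then have "k \<subseteq> ball x (d x)"
            using x by (simp add: \<gamma>_def)
          moreover have "u \<in> k" "v \<in> k"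
            using uv(1,2,3) by auto
          ultimately have "u \<in> ball x (d x)" "v \<in> ball x (d x)"
            by blast+
          then have "\<bar>u - x\<bar> < d x" "\<bar>v - x\<bar> < d x"
            by (auto simp: dist_real_def)
          then have 1: "\<bar>f u - f x - f' x * (u - x)\<bar> \<le> e1 * \<bar>u - x\<bar>"
            and 2: "\<bar>f v - f x - f' x * (v - x)\<bar> \<le> e1 * \<bar>v - x\<bar>"
            using uv by (intro d(2)[OF x]; simp)+
          \<comment> \<open>The straddle estimate: the tag lies between the end points, so the two
            one-sided errors add up to a multiple of \<open>v - u\<close>.\<close>
          have "(v - u) * f' x - (f v - f u) =
              (f u - f x - f' x * (u - x)) - (f v - f x - f' x * (v - x))"
            by (simp add: algebra_simps)
          also have "\<bar>\<dots>\<bar> \<le> e1 * \<bar>u - x\<bar> + e1 * \<bar>v - x\<bar>"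
            using 1 2 by linarith
          also have "\<dots> = e1 * (v - u)"
            using uv by (simp add: algebra_simps)
          finally have "\<bar>(v - u) * f' x - (f v - f u)\<bar> \<le> e1 * (v - u)" .
          then show "\<bar>measure lborel k * ?g x - ?\<Delta> k\<bar> \<le> e1 * measure lborel k"
            using uv xk by simp
        qed
        also have "\<dots> \<le> (\<Sum>(x,k)\<in>\<D>. e1 * measure lborel k)"
          using D(1) \<open>e1 > 0\<close> by (intro sum_mono2) auto
        also have "\<dots> = e1 * (B - A)"
        proof -
          have "(\<Sum>(x,k)\<in>\<D>. e1 * measure lborel k) = e1 * (\<Sum>(x,k)\<in>\<D>. measure lborel k)"
            by (simp add: sum_distrib_left case_prod_unfold)
          then show ?thesis
            using additive_content_tagged_division[of \<D> A B] \<D>(1) \<open>A \<le> B\<close> by simp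
        qed
        also have "\<dots> \<le> e / 2" by fact
        finally show "(\<Sum>(x,k)\<in>{p\<in>\<D>. fst p \<notin> N}. \<bar>measure lborel k * ?g x - ?\<Delta> k\<bar>) \<le> e / 2" .
      qed
      finally show ?thesis by simp
    qed
    show "\<exists>\<gamma>. gauge \<gamma> \<and> (\<forall>\<D>. \<D> tagged_division_of {A..B} \<and> \<gamma> fine \<D> \<longrightarrow>
        norm ((\<Sum>(x,k)\<in>\<D>. measure lborel k *\<^sub>R ?g x) - (f B - f A)) < e)"
      using gauge close by (intro exI[of _ \<gamma>] conjI allI impI) auto
  qed
qed

section \<open>Differentiability almost everywhere\<close>

text \<open>The members of the cover become balls once midpoint and radius are recorded;
  \<open>t\<close> itself need not be the midpoint. The covering theorem selects countably many
  disjoint ones that exhaust \<open>S\<close> up to a null set, and a finite part of them misses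
  less than \<open>\<epsilon>\<close>.\<close>

lemma Vitali_finite_subfamily:
  fixes S :: "real set"
  assumes S: "S \<in> lmeasurable" and "0 < \<epsilon>"
    and fine: "\<And>t d. \<lbrakk>t \<in> S; 0 < d\<rbrakk> \<Longrightarrow> \<exists>c e. c < t \<and> t < e \<and> e - c < d \<and> P c e"
  obtains \<J> where "finite \<J>" "\<And>J. J \<in> \<J> \<Longrightarrow> \<exists>c e. c < e \<and> J = {c..e} \<and> P c e"
    "pairwise disjnt \<J>" "measure lebesgue (S - \<Union>\<J>) < \<epsilon>"
proof -
  let ?K = "{i :: real \<times> real. 0 < snd i \<and> P (fst i - snd i) (fst i + snd i)}"
  obtain C where C: "countable C" "C \<subseteq> ?K"
    and pw: "pairwise (\<lambda>i j. disjnt (cball (fst i) (snd i)) (cball (fst j) (snd j))) C"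
    and neg: "negligible (S - (\<Union>i\<in>C. cball (fst i) (snd i)))"
  proof (rule Vitali_covering_theorem_cballs[of ?K snd S fst])
    fix t d :: real assume "t \<in> S" "0 < d"
    then obtain c e where ce: "c < t" "t < e" "e - c < d" "P c e"
      using fine by blast
    have "(c + e) / 2 - (e - c) / 2 = c" "(c + e) / 2 + (e - c) / 2 = e"
      by (simp_all add: field_simps)
    then show "\<exists>i. i \<in> ?K \<and> t \<in> cball (fst i) (snd i) \<and> snd i < d"
      using ce by (intro exI[of _ "((c + e) / 2, (e - c) / 2)"])
        (auto simp: cball_eq_atLeastAtMost)
  qed auto
  let ?B = "\<lambda>i. cball (fst i) (snd i) :: real set"
  \<comment> \<open>Cutting the balls down to \<open>S\<close> bounds every finite union by the
    measure of \<open>S\<close>, whatever the total length of the balls.\<close>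
  let ?D = "(\<lambda>i. S \<inter> ?B i) ` C"
  have "measure lebesgue (\<Union>D') \<le> measure lebesgue S" if "D' \<subseteq> ?D" "finite D'" for D'
  proof (rule measure_mono_fmeasurable)
    show "\<Union>D' \<in> sets lebesgue"
    proof (rule sets.finite_Union)
      show "D' \<subseteq> sets lebesgue"
      proof
        fix X assume "X \<in> D'"
        then obtain i where "X = S \<inter> cball (fst i) (snd i)"
          using \<open>D' \<subseteq> ?D\<close> by blast
        then show "X \<in> sets lebesgue"
          using S by (simp add: fmeasurableD sets.Int)
      qed
    qed fact
  qed (use that S in auto)
  then obtain D' where D': "D' \<subseteq> ?D" "finite D'" "measure lebesgue (\<Union>?D) - \<epsilon> < measure lebesgue (\<Union>D')"
    using measure_countable_Union_approachable[of ?D \<epsilon> "measure lebesgue S"] C(1) \<open>0 < \<epsilon>\<close> S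
    by (metis (no_types, lifting) countable_image fmeasurable_Int_fmeasurable imageE lmeasurable_cball fmeasurableD)
  obtain C' where C': "C' \<subseteq> C" "finite C'" "D' = (\<lambda>i. S \<inter> ?B i) ` C'"
    using finite_subset_image[OF D'(2,1)] by blast
  show thesis
  proof
    show "finite (?B ` C')" using C' by simp
    show "\<exists>c e. c < e \<and> J = {c..e} \<and> P c e" if J: "J \<in> ?B ` C'" for J
    proof -
      obtain i where i: "i \<in> C'" "J = ?B i" using J by blast
      then have "i \<in> ?K" using C' C by blast
      then show ?thesis
        using i(2) by (intro exI[of _ "fst i - snd i"] exI[of _ "fst i + snd i"])
          (simp add: cball_eq_atLeastAtMost)
    qed
    show "pairwise disjnt (?B ` C')"
    proof (rule pairwiseI)
      fix X Y assume "X \<in> ?B ` C'" "Y \<in> ?B ` C'" "X \<noteq> Y"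
      then obtain i j where "i \<in> C'" "j \<in> C'" "i \<noteq> j" "X = ?B i" "Y = ?B j" by blast
      then show "disjnt X Y"
        using pairwiseD[OF pw, of i j] C'(1) by auto
    qed
    have UD: "\<Union>D' = S \<inter> \<Union>(?B ` C')" "\<Union>?D = S \<inter> (\<Union>i\<in>C. ?B i)"
      using C' by auto
    have bs: "\<Union>(?B ` C') \<in> sets lebesgue" "(\<Union>i\<in>C. ?B i) \<in> sets lebesgue"
      using C' C by (auto intro!: sets.finite_Union sets.countable_UN' intro: countable_finite)
    have "measure lebesgue S = measure lebesgue (S \<inter> (\<Union>i\<in>C. ?B i)) + measure lebesgue (S - (\<Union>i\<in>C. ?B i))"
      using S bs(2) by (rule measure_split)
    also have "measure lebesgue (S - (\<Union>i\<in>C. ?B i)) = 0"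
      using neg by (rule negligible_imp_measure0)
    finally have "measure lebesgue S - \<epsilon> < measure lebesgue (S \<inter> \<Union>(?B ` C'))"
      using D'(3) UD by simp
    moreover have "measure lebesgue S = measure lebesgue (S \<inter> \<Union>(?B ` C')) + measure lebesgue (S - \<Union>(?B ` C'))"
      using S bs(1) by (rule measure_split)
    ultimately show "measure lebesgue (S - \<Union>(?B ` C')) < \<epsilon>"
      by simp
  qed
qed


text \<open>The closed intervals are disjoint, not merely nonoverlapping, so that a nonempty set
  lies in at most one member. \<open>Inf\<close> and \<open>Sup\<close> recover the end points, so
  no end point functions have to be carried along.\<close>

definition interval_family :: "real \<Rightarrow> real \<Rightarrow> real set set \<Rightarrow> bool" where
  "interval_family A B \<D> \<longleftrightarrow>
     finite \<D> \<and> pairwise disjnt \<D> \<and> (\<forall>K\<in>\<D>. \<exists>a b. a < b \<and> K = {a..b} \<and> A \<le> a \<and> b \<le> B)"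

lemma interval_familyD:
  assumes "interval_family A B \<D>" "K \<in> \<D>"
  shows "K = {Inf K..Sup K}" "Inf K < Sup K" "A \<le> Inf K" "Sup K \<le> B"
  using assms by (auto simp: interval_family_def)

lemma interval_family_division:
  assumes "interval_family A B \<D>"
  shows "\<D> division_of \<Union>\<D>"
proof (rule division_ofI)
  show "interior K1 \<inter> interior K2 = {}" if "K1 \<in> \<D>" "K2 \<in> \<D>" "K1 \<noteq> K2" for K1 K2
    using assms that interior_subset unfolding interval_family_def pairwise_def disjnt_def by fast
  show "K \<noteq> {}" "\<exists>a b. K = cbox a b" if "K \<in> \<D>" for K
    using assms that by (force simp: interval_family_def)+
qed (use assms in \<open>auto simp: interval_family_def\<close>)

lemma measure_Union_interval_family:
  assumes "interval_family A B \<D>"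
  shows "\<Union>\<D> \<in> lmeasurable" "measure lebesgue (\<Union>\<D>) = (\<Sum>K\<in>\<D>. Sup K - Inf K)"
proof -
  show "\<Union>\<D> \<in> lmeasurable"
    using assms by (intro fmeasurable.finite_Union) (auto simp: interval_family_def)
  have "measure lebesgue (\<Union>\<D>) = sum (measure lebesgue) \<D>"
    by (rule content_division[symmetric]) (rule interval_family_division[OF assms])
  also have "\<dots> = (\<Sum>K\<in>\<D>. Sup K - Inf K)"
    using assms by (intro sum.cong) (auto simp: interval_family_def)
  finally show "measure lebesgue (\<Union>\<D>) = (\<Sum>K\<in>\<D>. Sup K - Inf K)" .
qed

lemma division_telescope:
  fixes \<phi> :: "real \<Rightarrow> real"
  assumes "a \<le> b" and q: "q division_of {a..b}"
  shows "(\<Sum>K\<in>q. \<phi> (Sup K) - \<phi> (Inf K)) = \<phi> b - \<phi> a"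
proof -
  note D = division_ofD[OF q]
  have K: "Inf K \<in> K" if K: "K \<in> q" for K
    using D(3,4)[OF K] by auto
  \<comment> \<open>Tagging each member with its left end point makes the telescoping of tagged
    divisions applicable.\<close>
  let ?p = "(\<lambda>K. (Inf K, K)) ` q"
  have "?p tagged_division_of {a..b}"
    unfolding tagged_division_of
  proof (intro conjI allI impI)
    show "\<Union>{K. \<exists>x. (x, K) \<in> ?p} = {a..b}"
      unfolding D(6)[symmetric] by auto
    show "interior K1 \<inter> interior K2 = {}"
      if *: "(x1, K1) \<in> ?p \<and> (x2, K2) \<in> ?p \<and> (x1, K1) \<noteq> (x2, K2)" for x1 K1 x2 K2
      using * by (intro D(5)) auto
    show "K \<subseteq> {a..b}" "x \<in> K" "\<exists>u v. K = cbox u v" if "(x, K) \<in> ?p" for x K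
      using that D(2)[of K] D(4)[of K] K by auto
  qed (use D(1) in simp)
  from additive_tagged_division_1[OF \<open>a \<le> b\<close> this, of \<phi>]
  show ?thesis
    by (simp add: sum.reindex inj_on_def)
qed

text \<open>The members of \<J> inside some \<open>K\<close> are completed to a division of
  \<open>K\<close>, and the added pieces form \<open>I\<close>. The identity is stated for all
  \<phi> at once because the same pieces are used twice: the identity function gives their lengths,
  \<open>f\<close> their increments.\<close>

lemma interval_family_complement:
  assumes \<D>: "interval_family A B \<D>" and \<J>: "interval_family A B \<J>"
    and sub: "\<And>J. J \<in> \<J> \<Longrightarrow> \<exists>K\<in>\<D>. J \<subseteq> K"
  shows "\<exists>(I :: (real set \<times> real set) set) a b. nonoverlapping A B a b I \<and>
    (\<forall>\<phi> :: real \<Rightarrow> real. (\<Sum>K\<in>\<D>. \<phi> (Sup K) - \<phi> (Inf K)) =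
       (\<Sum>J\<in>\<J>. \<phi> (Sup J) - \<phi> (Inf J)) + (\<Sum>k\<in>I. \<phi> (b k) - \<phi> (a k)))"
proof -
  define \<J>' where "\<J>' K = {J\<in>\<J>. J \<subseteq> K}" for K
  have "\<forall>K\<in>\<D>. \<exists>q. \<J>' K \<subseteq> q \<and> q division_of K"
  proof
    fix K assume K: "K \<in> \<D>"
    have "\<J>' K division_of \<Union>(\<J>' K)"
      by (rule division_of_subset[OF interval_family_division[OF \<J>]]) (auto simp: \<J>'_def)
    moreover have "\<Union>(\<J>' K) \<subseteq> cbox (Inf K) (Sup K)"
      using interval_familyD(1)[OF \<D> K] by (auto simp: \<J>'_def)
    ultimately show "\<exists>q. \<J>' K \<subseteq> q \<and> q division_of K"
      using partial_division_extend_interval interval_familyD(1)[OF \<D> K] by (metis box_real(2))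
  qed
  from bchoice[OF this] obtain q where q: "\<And>K. K \<in> \<D> \<Longrightarrow> \<J>' K \<subseteq> q K" "\<And>K. K \<in> \<D> \<Longrightarrow> q K division_of K"
    by blast
  define I where "I = Sigma \<D> (\<lambda>K. q K - \<J>' K)"
  have fin: "finite \<D>" "finite \<J>" using \<D> \<J> by (auto simp: interval_family_def)
  have finq: "finite (q K)" if "K \<in> \<D>" for K using q(2)[OF that] by auto
  have C: "C = {Inf C..Sup C}" "Inf C \<le> Sup C" "Inf K \<le> Inf C" "Sup C \<le> Sup K" "C \<subseteq> K"
    if KC: "(K, C) \<in> I" for K C
  proof -
    have KC': "K \<in> \<D>" "C \<in> q K" using KC by (auto simp: I_def)
    then obtain u v where uv: "C = {u..v}" "C \<subseteq> K" "C \<noteq> {}"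
      using division_ofD(2,3,4)[OF q(2)[OF KC'(1)] KC'(2)] by auto
    moreover have "{u..v} \<subseteq> {Inf K..Sup K}"
      using uv interval_familyD(1)[OF \<D> KC'(1)] by auto
    ultimately show "C = {Inf C..Sup C}" "Inf C \<le> Sup C" "Inf K \<le> Inf C" "Sup C \<le> Sup K" "C \<subseteq> K"
      by auto
  qed
  have "nonoverlapping A B (\<lambda>(K, C). Inf C) (\<lambda>(K, C). Sup C) I"
    unfolding nonoverlapping_def
  proof (intro conjI ballI)
    show "finite I" using fin finq by (auto simp: I_def)
  next
    fix k assume k: "k \<in> I"
    obtain K C where kc: "k = (K, C)" by force
    then have "A \<le> Inf K" "Sup K \<le> B"
      using k interval_familyD[OF \<D>, of K] by (auto simp: I_def)
    then show "A \<le> (case k of (K, C) \<Rightarrow> Inf C)" "(case k of (K, C) \<Rightarrow> Inf C) \<le> (case k of (K, C) \<Rightarrow> Sup C)"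
       "(case k of (K, C) \<Rightarrow> Sup C) \<le> B"
      using C[of K C] k kc by auto
  next
    show "disjoint_family_on (\<lambda>k. {case k of (K, C) \<Rightarrow> Inf C<..<case k of (K, C) \<Rightarrow> Sup C}) I"
      unfolding disjoint_family_on_def
    proof (intro ballI impI)
      fix k k' assume kk: "k \<in> I" "k' \<in> I" "k \<noteq> k'"
      obtain K C K' C' where kc: "k = (K, C)" "k' = (K', C')" by force
      have "interior C \<inter> interior C' = {}"
      proof (cases "K = K'")
        case True
        then show ?thesis
          using kk kc division_ofD(5)[OF q(2)[of K], of C C'] by (auto simp: I_def)
      next
        case False
        then have "K \<inter> K' = {}"
          using kk kc \<D> by (auto simp: I_def interval_family_def pairwise_def disjnt_def)
        then show ?thesis
          using C(5)[of K C] C(5)[of K' C'] kk kc interior_subset by blast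
      qed
      moreover have "interior C = {Inf C<..<Sup C}" "interior C' = {Inf C'<..<Sup C'}"
        using C(1)[of K C] C(1)[of K' C'] kk kc by (metis interior_atLeastAtMost_real)+
      ultimately show "{case k of (K, C) \<Rightarrow> Inf C<..<case k of (K, C) \<Rightarrow> Sup C} \<inter>
            {case k' of (K, C) \<Rightarrow> Inf C<..<case k' of (K, C) \<Rightarrow> Sup C} = {}"
        using kc by simp
    qed
  qed
  moreover have "(\<Sum>K\<in>\<D>. \<phi> (Sup K) - \<phi> (Inf K)) =
       (\<Sum>J\<in>\<J>. \<phi> (Sup J) - \<phi> (Inf J)) + (\<Sum>k\<in>I. \<phi> (case k of (K, C) \<Rightarrow> Sup C) - \<phi> (case k of (K, C) \<Rightarrow> Inf C))"
    for \<phi> :: "real \<Rightarrow> real"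
  proof -
    let ?D = "\<lambda>C. \<phi> (Sup C) - \<phi> (Inf C)"
    have "(\<Sum>K\<in>\<D>. ?D K) = (\<Sum>K\<in>\<D>. sum ?D (\<J>' K) + sum ?D (q K - \<J>' K))"
    proof (rule sum.cong[OF refl])
      fix K assume K: "K \<in> \<D>"
      have "sum ?D (q K) = ?D K"
        using interval_familyD[OF \<D> K] q(2)[OF K] by (intro division_telescope) auto
      then show "?D K = sum ?D (\<J>' K) + sum ?D (q K - \<J>' K)"
        using sum.subset_diff[OF q(1)[OF K] finq[OF K], of ?D] by simp
    qed
    also have "\<dots> = (\<Sum>K\<in>\<D>. sum ?D (\<J>' K)) + (\<Sum>K\<in>\<D>. sum ?D (q K - \<J>' K))"
      by (rule sum.distrib)
    also have "(\<Sum>K\<in>\<D>. sum ?D (\<J>' K)) = sum ?D (\<Union>K\<in>\<D>. \<J>' K)"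
    proof (rule sum.UNION_disjoint[symmetric])
      show "\<forall>K\<in>\<D>. \<forall>K'\<in>\<D>. K \<noteq> K' \<longrightarrow> \<J>' K \<inter> \<J>' K' = {}"
      proof (intro ballI impI)
        fix K K' assume "K \<in> \<D>" "K' \<in> \<D>" "K \<noteq> K'"
        then have "K \<inter> K' = {}"
          using \<D> by (auto simp: interval_family_def pairwise_def disjnt_def)
        moreover have "J \<noteq> {}" if "J \<in> \<J>" for J
          using interval_familyD[OF \<J> that] by force
        ultimately show "\<J>' K \<inter> \<J>' K' = {}"
          unfolding \<J>'_def by blast
      qed
    qed (use fin in \<open>auto simp: \<J>'_def\<close>)
    also have "(\<Union>K\<in>\<D>. \<J>' K) = \<J>"
      using sub by (auto simp: \<J>'_def)
    also have "(\<Sum>K\<in>\<D>. sum ?D (q K - \<J>' K)) = (\<Sum>(K, C)\<in>I. ?D C)"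
      unfolding I_def using fin finq by (intro sum.Sigma) auto
    finally show ?thesis
      by (simp add: case_prod_unfold)
  qed
  ultimately show ?thesis by blast
qed

text \<open>
  A second Vitali cover, inside the given intervals, consists of steep intervals; what remains of
  the given intervals is so short that absolute continuity makes its increment negligible.
\<close>

lemma abs_continuous_on_increment_ge:
  assumes ac: "abs_continuous_on A B f" and E: "E \<in> lmeasurable" and "0 < \<epsilon>"
    and fine: "\<And>t d. \<lbrakk>t \<in> E; 0 < d\<rbrakk> \<Longrightarrow> \<exists>c e. c < t \<and> t < e \<and> e - c < d \<and> q * (e - c) \<le> f e - f c"
  shows "\<exists>\<delta>>0. \<forall>\<D>. interval_family A B \<D> \<longrightarrow> measure lebesgue (E - \<Union>\<D>) < \<delta> \<longrightarrow>
     (\<Sum>K\<in>\<D>. Sup K - Inf K) < measure lebesgue E + \<delta> \<longrightarrow>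
     q * measure lebesgue E - \<epsilon> \<le> (\<Sum>K\<in>\<D>. f (Sup K) - f (Inf K))"
proof -
  obtain \<delta>0 where "0 < \<delta>0" and \<delta>0 [rule_format]:
    "\<forall>(I :: (real set \<times> real set) set) a b. nonoverlapping A B a b I \<longrightarrow> (\<Sum>k\<in>I. b k - a k) < \<delta>0 \<longrightarrow>
       (\<Sum>k\<in>I. \<bar>f (b k) - f (a k)\<bar>) < \<epsilon> / 2"
    using abs_continuous_on_finite_family[OF ac half_gt_zero[OF \<open>0 < \<epsilon>\<close>]] by blast
  \<comment> \<open>The pieces left over will have total length below \<open>3 * \<delta>\<close>,
    and the length of the steep intervals will differ from the measure of \<open>E\<close> by at
    most \<open>2 * \<delta>\<close>. The first must stay within \<open>\<delta>0\<close>, the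
    second times \<open>\<bar>q\<bar>\<close> within \<open>\<epsilon> / 2\<close>.\<close>
  define \<delta> where "\<delta> = min (\<delta>0 / 3) (\<epsilon> / (4 * (\<bar>q\<bar> + 1)))"
  have "\<delta> > 0" using \<open>0 < \<delta>0\<close> \<open>0 < \<epsilon>\<close> by (simp add: \<delta>_def)
  have "\<delta> \<le> \<delta>0 / 3" unfolding \<delta>_def by (rule min.cobounded1)
  have "\<bar>q\<bar> * (2 * \<delta>) \<le> (\<bar>q\<bar> + 1) * (2 * (\<epsilon> / (4 * (\<bar>q\<bar> + 1))))"
    using \<open>\<delta> > 0\<close> by (intro mult_mono) (auto simp: \<delta>_def)
  also have "\<dots> = \<epsilon> / 2" by (simp add: field_simps)
  finally have q\<delta>: "\<bar>q\<bar> * (2 * \<delta>) \<le> \<epsilon> / 2" .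
  have "q * measure lebesgue E - \<epsilon> \<le> (\<Sum>K\<in>\<D>. f (Sup K) - f (Inf K))"
    if \<D>: "interval_family A B \<D>" and E\<D>: "measure lebesgue (E - \<Union>\<D>) < \<delta>"
      and sum\<D>: "(\<Sum>K\<in>\<D>. Sup K - Inf K) < measure lebesgue E + \<delta>" for \<D>
  proof -
    \<comment> \<open>At an interior point of a member, all sufficiently short straddling intervals
      fit inside it. The end points form a finite set, which is accounted for below as
      \<open>?Z\<close>.\<close>
    let ?U = "\<Union>(interior ` \<D>)"
    have "open ?U" by auto
    have S: "E \<inter> ?U \<in> lmeasurable"
      using E borel_open[OF \<open>open ?U\<close>] by (intro fmeasurable_Int_fmeasurable) simp_all
    obtain \<J> where \<J>: "finite \<J>" "pairwise disjnt \<J>" "measure lebesgue (E \<inter> ?U - \<Union>\<J>) < \<delta>"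
      "\<And>J. J \<in> \<J> \<Longrightarrow> \<exists>c e. c < e \<and> J = {c..e} \<and> (q * (e - c) \<le> f e - f c \<and> (\<exists>K\<in>\<D>. {c..e} \<subseteq> K))"
    proof (rule Vitali_finite_subfamily[OF S \<open>0 < \<delta>\<close>,
          where P = "\<lambda>c e. q * (e - c) \<le> f e - f c \<and> (\<exists>K\<in>\<D>. {c..e} \<subseteq> K)"])
      fix t d :: real assume t: "t \<in> E \<inter> ?U" and "0 < d"
      then obtain K where K: "K \<in> \<D>" "t \<in> interior K" by auto
      then obtain r where r: "r > 0" "ball t r \<subseteq> K"
        by (meson mem_interior)
      then obtain c e where ce: "c < t" "t < e" "e - c < min d r" "q * (e - c) \<le> f e - f c"
        using fine[of t "min d r"] t \<open>0 < d\<close> by auto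
      then have "{c..e} \<subseteq> ball t r" by (auto simp: dist_real_def)
      then show "\<exists>c e. c < t \<and> t < e \<and> e - c < d \<and> q * (e - c) \<le> f e - f c \<and> (\<exists>K\<in>\<D>. {c..e} \<subseteq> K)"
        using ce K r by (intro exI[of _ c] exI[of _ e]) auto
    qed (rule that)
    have fam\<J>: "interval_family A B \<J>"
      unfolding interval_family_def
    proof (intro conjI ballI)
      fix J assume "J \<in> \<J>"
      then obtain c e K where ceK: "c < e" "J = {c..e}" "K \<in> \<D>" "{c..e} \<subseteq> K"
        using \<J>(4) by blast
      have "{c..e} \<subseteq> {Inf K..Sup K}"
        using ceK(4) interval_familyD(1)[OF \<D> \<open>K \<in> \<D>\<close>] by metis
      then have "{c..e} \<subseteq> {A..B}"
        using interval_familyD(3,4)[OF \<D> \<open>K \<in> \<D>\<close>] ceK(1) by auto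
      then show "\<exists>a b. a < b \<and> J = {a..b} \<and> A \<le> a \<and> b \<le> B"
        using ceK by auto
    qed (use \<J> in auto)
    have sub\<J>: "\<exists>K\<in>\<D>. J \<subseteq> K" if "J \<in> \<J>" for J
      using \<J>(4)[OF that] by auto
    obtain I :: "(real set \<times> real set) set" and a b where I: "nonoverlapping A B a b I"
      and split: "\<And>\<phi> :: real \<Rightarrow> real. (\<Sum>K\<in>\<D>. \<phi> (Sup K) - \<phi> (Inf K)) =
       (\<Sum>J\<in>\<J>. \<phi> (Sup J) - \<phi> (Inf J)) + (\<Sum>k\<in>I. \<phi> (b k) - \<phi> (a k))"
      using interval_family_complement[OF \<D> fam\<J> sub\<J>] by blast
    let ?m = "\<Sum>J\<in>\<J>. Sup J - Inf J"
    have len: "(\<Sum>K\<in>\<D>. Sup K - Inf K) = ?m + (\<Sum>k\<in>I. b k - a k)"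
      using split[of "\<lambda>x. x"] by simp
    have nonneg: "(\<Sum>k\<in>I. b k - a k) \<ge> 0"
      using I by (intro sum_nonneg) (auto simp: nonoverlapping_def)
    have "measure lebesgue E \<le> ?m + 2 * \<delta>"
    proof -
      let ?Z = "Inf ` \<D> \<union> Sup ` \<D>"
      have Z: "negligible ?Z"
        using \<D> by (intro negligible_finite) (auto simp: interval_family_def)
      have m1: "E - \<Union>\<D> \<in> lmeasurable" "E \<inter> ?U - \<Union>\<J> \<in> lmeasurable" "\<Union>\<J> \<in> lmeasurable" "?Z \<in> lmeasurable"
        using E S measure_Union_interval_family(1)[OF \<D>] measure_Union_interval_family(1)[OF fam\<J>] Z
        by (auto intro: fmeasurable.Diff simp: negligible_imp_measurable)
      have "x \<in> \<Union>\<J> \<union> (E - \<Union>\<D>) \<union> (E \<inter> ?U - \<Union>\<J>) \<union> ?Z" if "x \<in> E" for x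
      proof (cases "x \<in> \<Union>\<D>")
        case True
        then obtain K where K: "K \<in> \<D>" "x \<in> K" by auto
        then have "x \<in> interior K \<or> x = Inf K \<or> x = Sup K"
          using interval_familyD(1)[OF \<D> K(1)] interior_atLeastAtMost_real[of "Inf K" "Sup K"] by force
        then show ?thesis using K that by blast
      qed (use that in blast)
      then have "E \<subseteq> \<Union>\<J> \<union> (E - \<Union>\<D>) \<union> (E \<inter> ?U - \<Union>\<J>) \<union> ?Z" by blast
      then have "measure lebesgue E \<le> measure lebesgue (\<Union>\<J> \<union> (E - \<Union>\<D>) \<union> (E \<inter> ?U - \<Union>\<J>) \<union> ?Z)"
        using E m1 by (intro measure_mono_fmeasurable) (auto intro!: fmeasurable.Un)
      also have "\<dots> \<le> measure lebesgue (\<Union>\<J>) + measure lebesgue (E - \<Union>\<D>) + measure lebesgue (E \<inter> ?U - \<Union>\<J>) + measure lebesgue ?Z"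
        using m1 by (intro order.trans[OF measure_Un_le] add_mono order.refl) (auto simp: fmeasurableD)
      also have "\<dots> \<le> ?m + \<delta> + \<delta> + 0"
        using E\<D> \<J>(3) Z measure_Union_interval_family(2)[OF fam\<J>]
        by (intro add_mono) (auto simp: negligible_imp_measure0)
      finally show ?thesis by simp
    qed
    with len sum\<D> nonneg have m: "\<bar>?m - measure lebesgue E\<bar> \<le> 2 * \<delta>" "(\<Sum>k\<in>I. b k - a k) < \<delta>0"
      using \<open>\<delta> \<le> \<delta>0 / 3\<close> \<open>0 < \<delta>\<close> by auto
    have "\<bar>q * ?m - q * measure lebesgue E\<bar> = \<bar>q\<bar> * \<bar>?m - measure lebesgue E\<bar>"
      by (simp add: abs_mult flip: right_diff_distrib)
    also have "\<dots> \<le> \<bar>q\<bar> * (2 * \<delta>)"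
      using m(1) by (rule mult_left_mono) simp
    finally have 1: "q * measure lebesgue E - \<epsilon> / 2 \<le> q * ?m"
      using q\<delta> by linarith
    have "(\<Sum>k\<in>I. \<bar>f (b k) - f (a k)\<bar>) < \<epsilon> / 2"
      using \<delta>0[OF I m(2)] .
    then have 2: "- (\<epsilon> / 2) \<le> (\<Sum>k\<in>I. f (b k) - f (a k))"
      using sum_abs[of "\<lambda>k. f (b k) - f (a k)" I] by linarith
    have 3: "q * ?m \<le> (\<Sum>J\<in>\<J>. f (Sup J) - f (Inf J))"
      unfolding sum_distrib_left
    proof (rule sum_mono)
      fix J assume "J \<in> \<J>"
      then obtain c e where "c < e" "J = {c..e}" "q * (e - c) \<le> f e - f c"
        using \<J>(4) by blast
      then show "q * (Sup J - Inf J) \<le> f (Sup J) - f (Inf J)" by simp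
    qed
    show ?thesis
      using 1 2 3 split[of f] by linarith
  qed
  then show ?thesis
    using \<open>0 < \<delta>\<close> by blast
qed

lemma interval_family_nonoverlapping:
  assumes "interval_family A B \<J>"
  shows "nonoverlapping A B Inf Sup \<J>"
  unfolding nonoverlapping_def
proof (intro conjI ballI)
  show "disjoint_family_on (\<lambda>K. {Inf K<..<Sup K}) \<J>"
    unfolding disjoint_family_on_def
  proof (intro ballI impI)
    fix K K' assume *: "K \<in> \<J>" "K' \<in> \<J>" "K \<noteq> K'"
    then have "K \<inter> K' = {}"
      using assms by (auto simp: interval_family_def pairwise_def disjnt_def)
    moreover have "{Inf K<..<Sup K} \<subseteq> {Inf K..Sup K}" "{Inf K'<..<Sup K'} \<subseteq> {Inf K'..Sup K'}"
      by auto
    ultimately show "{Inf K<..<Sup K} \<inter> {Inf K'<..<Sup K'} = {}"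
      using interval_familyD(1)[OF assms *(1)] interval_familyD(1)[OF assms *(2)] by blast
  qed
qed (use assms interval_familyD[OF assms] in \<open>auto simp: interval_family_def\<close>)

text \<open>Roughly: the upper derivative at \<open>t\<close> is at least \<open>q\<close>. Bounds
  on the lower derivative are expressed through \<open>- f\<close> and \<open>- p\<close>. Intervals
  around \<open>t\<close>, instead of difference quotients at \<open>t\<close>, make the set of all
  such \<open>t\<close> a countable intersection of open sets, so that its measurability is
  immediate.\<close>

definition steep :: "(real \<Rightarrow> real) \<Rightarrow> real \<Rightarrow> real \<Rightarrow> bool" where
  "steep f q t \<longleftrightarrow> (\<forall>d>0. \<exists>c e. c < t \<and> t < e \<and> e - c < d \<and> q * (e - c) < f e - f c)"

lemma steep_antimono:
  assumes "steep f q t" "q' \<le> q"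
  shows "steep f q' t"
  unfolding steep_def
proof (intro allI impI)
  fix d :: real assume "d > 0"
  then obtain c e where ce: "c < t" "t < e" "e - c < d" "q * (e - c) < f e - f c"
    using assms(1) unfolding steep_def by blast
  moreover have "q' * (e - c) \<le> q * (e - c)"
    using ce assms(2) by (intro mult_right_mono) auto
  ultimately show "\<exists>c e. c < t \<and> t < e \<and> e - c < d \<and> q' * (e - c) < f e - f c"
    by (intro exI[of _ c] exI[of _ e] conjI) linarith+
qed

lemma borel_steep: "{t. steep f q t} \<in> sets borel"
proof -
  let ?O = "\<lambda>n::nat. \<Union>{{c<..<e} | c e. e - c < 1 / real (Suc n) \<and> q * (e - c) < f e - f c}"
  have iff: "steep f q t \<longleftrightarrow> (\<forall>n. t \<in> ?O n)" for t
  proof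
    assume st: "steep f q t"
    show "\<forall>n. t \<in> ?O n"
    proof
      fix n
      have "0 < 1 / real (Suc n)" by simp
      then obtain c e where "c < t" "t < e" "e - c < 1 / real (Suc n)" "q * (e - c) < f e - f c"
        using st unfolding steep_def by blast
      then show "t \<in> ?O n" by (intro UnionI[of "{c<..<e}"]) auto
    qed
  next
    assume *: "\<forall>n. t \<in> ?O n"
    show "steep f q t"
      unfolding steep_def
    proof (intro allI impI)
      fix d :: real assume "d > 0"
      then obtain n where n: "1 / real (Suc n) < d"
        using nat_approx_posE by metis
      from * obtain c e where "t \<in> {c<..<e}" "e - c < 1 / real (Suc n)" "q * (e - c) < f e - f c"
        by blast
      then show "\<exists>c e. c < t \<and> t < e \<and> e - c < d \<and> q * (e - c) < f e - f c"
        using n by (intro exI[of _ c] exI[of _ e]) auto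
    qed
  qed
  have "{t. steep f q t} = (\<Inter>n. ?O n)"
    by (rule set_eqI) (simp only: iff mem_Collect_eq INT_iff UNIV_I ball_UNIV)
  moreover have "open (?O n)" for n
    by (rule open_Union) auto
  ultimately show ?thesis
    by (auto intro!: sets.countable_INT)
qed

lemma lmeasurable_Ioo_Int_borel:
  fixes X :: "real set"
  assumes "X \<in> sets borel"
  shows "{A<..<B} \<inter> X \<in> lmeasurable"
  using assms lmeasurable_box[of A B] by (intro fmeasurable_Int_fmeasurable) (simp_all add: box_real)

lemma negligible_slope_gap:
  assumes ac: "abs_continuous_on A B f" and "p < q"
  shows "negligible ({A<..<B} \<inter> {t. steep f q t} \<inter> {t. steep (\<lambda>t. - f t) (- p) t})"
    (is "negligible ?E")
proof -
  have E: "?E \<in> lmeasurable"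
    unfolding Int_assoc by (intro lmeasurable_Ioo_Int_borel sets.Int borel_steep)
  let ?m = "measure lebesgue ?E"
  have ac': "abs_continuous_on A B (\<lambda>t. - f t)"
    using abs_continuous_on_diff[OF abs_continuous_on_const[of A B 0] ac] by simp
  have "q * ?m \<le> p * ?m + \<epsilon>" if "\<epsilon> > 0" for \<epsilon>
  proof -
    have "\<epsilon> / 2 > 0" using that by simp
    have fine1: "\<exists>c e. c < t \<and> t < e \<and> e - c < d \<and> q * (e - c) \<le> f e - f c" if "t \<in> ?E" "0 < d" for t d
      using that unfolding steep_def by (blast intro: less_imp_le)
    have fine2: "\<exists>c e. c < t \<and> t < e \<and> e - c < d \<and> - p * (e - c) \<le> - f e - - f c" if "t \<in> ?E" "0 < d" for t d
      using that unfolding steep_def by (blast intro: less_imp_le)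
    obtain \<delta>1 where "\<delta>1 > 0" and \<delta>1 [rule_format]: "\<forall>\<D>. interval_family A B \<D> \<longrightarrow>
       measure lebesgue (?E - \<Union>\<D>) < \<delta>1 \<longrightarrow> (\<Sum>K\<in>\<D>. Sup K - Inf K) < ?m + \<delta>1 \<longrightarrow>
       q * ?m - \<epsilon> / 2 \<le> (\<Sum>K\<in>\<D>. f (Sup K) - f (Inf K))"
      using abs_continuous_on_increment_ge[OF ac E \<open>\<epsilon> / 2 > 0\<close> fine1] by blast
    obtain \<delta>2 where "\<delta>2 > 0" and \<delta>2 [rule_format]: "\<forall>\<D>. interval_family A B \<D> \<longrightarrow>
       measure lebesgue (?E - \<Union>\<D>) < \<delta>2 \<longrightarrow> (\<Sum>K\<in>\<D>. Sup K - Inf K) < ?m + \<delta>2 \<longrightarrow>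
       - p * ?m - \<epsilon> / 2 \<le> (\<Sum>K\<in>\<D>. - f (Sup K) - - f (Inf K))"
      using abs_continuous_on_increment_ge[OF ac' E \<open>\<epsilon> / 2 > 0\<close> fine2] by blast
    \<comment> \<open>Both estimates hold for every interval family close enough to
      \<open>?E\<close>, so one family can be fed to both, and its increments under \<open>f\<close>
      and \<open>- f\<close> are opposite.\<close>
    define \<delta> where "\<delta> = min \<delta>1 \<delta>2"
    have "\<delta> > 0" using \<open>\<delta>1 > 0\<close> \<open>\<delta>2 > 0\<close> by (simp add: \<delta>_def)
    obtain U where U: "open U" "?E \<subseteq> U" "U \<in> lmeasurable" "measure lebesgue U < ?m + \<delta>"
      using lmeasurable_outer_open[OF E \<open>\<delta> > 0\<close>] by blast
    \<comment> \<open>\<open>U\<close> keeps the total length of the covering intervals close to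
      \<open>?m\<close>; the open interval keeps them inside \<open>{A..B}\<close>.\<close>
    let ?U = "U \<inter> {A<..<B}"
    have "open ?U" using U(1) by auto
    obtain \<D> where \<D>: "finite \<D>" "\<And>K. K \<in> \<D> \<Longrightarrow> \<exists>c e. c < e \<and> K = {c..e} \<and> {c..e} \<subseteq> ?U"
      "pairwise disjnt \<D>" "measure lebesgue (?E - \<Union>\<D>) < \<delta>"
    proof (rule Vitali_finite_subfamily[OF E \<open>\<delta> > 0\<close>, where P = "\<lambda>c e. {c..e} \<subseteq> ?U"])
      fix t d :: real assume t: "t \<in> ?E" and "0 < d"
      then have "t \<in> ?U" using U by auto
      then obtain r where r: "r > 0" "cball t r \<subseteq> ?U"
        using \<open>open ?U\<close> by (meson open_contains_cball)
      define s where "s = min r (d / 3)"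
      have "s > 0" "s \<le> r" "2 * s < d" using r \<open>0 < d\<close> by (auto simp: s_def min_def)
      then have "{t - s..t + s} \<subseteq> cball t r" by (auto simp: cball_eq_atLeastAtMost)
      then show "\<exists>c e. c < t \<and> t < e \<and> e - c < d \<and> {c..e} \<subseteq> ?U"
        using r \<open>s > 0\<close> \<open>2 * s < d\<close> by (intro exI[of _ "t - s"] exI[of _ "t + s"]) auto
    qed (rule that)
    have fam: "interval_family A B \<D>"
      unfolding interval_family_def
    proof (intro conjI ballI)
      fix K assume "K \<in> \<D>"
      then obtain c e where ce: "c < e" "K = {c..e}" "{c..e} \<subseteq> ?U"
        using \<D>(2) by blast
      moreover have "c \<in> {c..e}" "e \<in> {c..e}" using ce(1) by auto
      ultimately have "c \<in> ?U" "e \<in> ?U" by blast+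
      then show "\<exists>a b. a < b \<and> K = {a..b} \<and> A \<le> a \<and> b \<le> B"
        using ce by (intro exI[of _ c] exI[of _ e]) auto
    qed (use \<D> in auto)
    have "(\<Sum>K\<in>\<D>. Sup K - Inf K) = measure lebesgue (\<Union>\<D>)"
      using measure_Union_interval_family(2)[OF fam] by simp
    also have "\<dots> \<le> measure lebesgue U"
      using \<D>(2) U(3) measure_Union_interval_family(1)[OF fam]
      by (intro measure_mono_fmeasurable) (fastforce simp: fmeasurableD)+
    finally have len: "(\<Sum>K\<in>\<D>. Sup K - Inf K) < ?m + \<delta>"
      using U(4) by simp
    have "q * ?m - \<epsilon> / 2 \<le> (\<Sum>K\<in>\<D>. f (Sup K) - f (Inf K))"
      using fam \<D>(4) len by (intro \<delta>1) (auto simp: \<delta>_def)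
    moreover have "- p * ?m - \<epsilon> / 2 \<le> (\<Sum>K\<in>\<D>. - f (Sup K) - - f (Inf K))"
      using fam \<D>(4) len by (intro \<delta>2) (auto simp: \<delta>_def)
    moreover have "(\<Sum>K\<in>\<D>. - f (Sup K) - - f (Inf K)) = - (\<Sum>K\<in>\<D>. f (Sup K) - f (Inf K))"
      by (simp add: sum_subtractf sum_negf)
    ultimately show ?thesis by simp
  qed
  then have "q * ?m \<le> p * ?m"
    by (rule field_le_epsilon)
  then have "(q - p) * ?m \<le> 0"
    by (simp add: algebra_simps)
  then have "?m = 0"
    using \<open>p < q\<close> measure_nonneg[of lebesgue ?E] mult_pos_pos[of "q - p" ?m] by linarith
  then show ?thesis
    using E by (simp add: negligible_iff_measure)
qed

text \<open>Absolute continuity limits increments only over families shorter than some \<delta>,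
  hence the localization to windows of length below \<delta>. There all increments stay below 1. If
  the set had positive measure \<open>?m\<close> in a window, disjoint intervals of slope at least
  \<open>n\<close> would cover half of it and rise by at least \<open>n * ?m / 2\<close>, which
  exceeds 1 for large \<open>n\<close>.\<close>

lemma negligible_slope_infinite:
  assumes ac: "abs_continuous_on A B f"
  shows "negligible ({A<..<B} \<inter> (\<Inter>n::nat. {t. steep f (real n) t}))" (is "negligible ?E")
  unfolding locally_negligible_alt[of ?E]
proof
  fix x assume x: "x \<in> ?E"
  obtain \<delta> where "0 < \<delta>" and \<delta> [rule_format]:
    "\<forall>(I :: real set set) a b. nonoverlapping A B a b I \<longrightarrow> (\<Sum>k\<in>I. b k - a k) < \<delta> \<longrightarrow>
       (\<Sum>k\<in>I. \<bar>f (b k) - f (a k)\<bar>) < 1"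
    using abs_continuous_on_finite_family[OF ac zero_less_one] by blast
  let ?W = "{max A (x - \<delta> / 3)<..<min B (x + \<delta> / 3)}"
  let ?S = "?W \<inter> (\<Inter>n::nat. {t. steep f (real n) t})"
  have S: "?S \<in> lmeasurable"
    by (intro lmeasurable_Ioo_Int_borel sets.countable_INT borel_steep) (auto intro: borel_steep)
  let ?m = "measure lebesgue ?S"
  have "?m = 0"
  proof (rule ccontr)
    assume "?m \<noteq> 0"
    then have "?m > 0" using measure_nonneg[of lebesgue ?S] by linarith
    then have "?m / 2 > 0" by simp
    obtain n :: nat where n: "2 / ?m < real n" using reals_Archimedean2 by blast
    obtain \<J> where \<J>: "finite \<J>"
      "\<And>J. J \<in> \<J> \<Longrightarrow> \<exists>c e. c < e \<and> J = {c..e} \<and> (real n * (e - c) \<le> f e - f c \<and> {c..e} \<subseteq> ?W)"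
      "pairwise disjnt \<J>" "measure lebesgue (?S - \<Union>\<J>) < ?m / 2"
    proof (rule Vitali_finite_subfamily[OF S \<open>?m / 2 > 0\<close>,
          where P = "\<lambda>c e. real n * (e - c) \<le> f e - f c \<and> {c..e} \<subseteq> ?W"])
      fix t d :: real assume t: "t \<in> ?S" and "0 < d"
      then obtain r where r: "r > 0" "ball t r \<subseteq> ?W"
        by (metis Int_iff open_contains_ball open_greaterThanLessThan)
      have "min d r > 0" "steep f (real n) t" using r \<open>0 < d\<close> t by auto
      then obtain c e where ce: "c < t" "t < e" "e - c < min d r" "real n * (e - c) < f e - f c"
        unfolding steep_def by blast
      then have "{c..e} \<subseteq> ball t r" by (auto simp: dist_real_def)
      then show "\<exists>c e. c < t \<and> t < e \<and> e - c < d \<and> real n * (e - c) \<le> f e - f c \<and> {c..e} \<subseteq> ?W"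
        using ce r by (intro exI[of _ c] exI[of _ e] conjI) auto
    qed (rule that)
    have fam: "interval_family A B \<J>"
      unfolding interval_family_def
    proof (intro conjI ballI)
      fix K assume "K \<in> \<J>"
      then obtain c e where ce: "c < e" "K = {c..e}" "{c..e} \<subseteq> ?W"
        using \<J>(2) by blast
      moreover have "c \<in> {c..e}" "e \<in> {c..e}" using ce(1) by auto
      ultimately have "c \<in> ?W" "e \<in> ?W" by blast+
      then show "\<exists>a b. a < b \<and> K = {a..b} \<and> A \<le> a \<and> b \<le> B"
        using ce by (intro exI[of _ c] exI[of _ e]) auto
    qed (use \<J> in auto)
    have mJ: "measure lebesgue (\<Union>\<J>) = (\<Sum>K\<in>\<J>. Sup K - Inf K)" "\<Union>\<J> \<in> lmeasurable"
      using measure_Union_interval_family[OF fam] by auto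
    have "\<Union>\<J> \<subseteq> ?W" using \<J>(2) by blast
    then have "\<Union>\<J> \<subseteq> {x - \<delta> / 3..x + \<delta> / 3}" by fastforce
    then have "measure lebesgue (\<Union>\<J>) \<le> measure lebesgue {x - \<delta> / 3..x + \<delta> / 3}"
      using mJ by (intro measure_mono_fmeasurable) (simp_all add: fmeasurableD)
    also have "\<dots> < \<delta>"
      using \<open>0 < \<delta>\<close> by simp
    finally have "(\<Sum>K\<in>\<J>. \<bar>f (Sup K) - f (Inf K)\<bar>) < 1"
      using mJ by (intro \<delta> interval_family_nonoverlapping[OF fam]) simp
    moreover have "1 < real n * (?m / 2)"
      using n \<open>?m > 0\<close> by (simp add: field_simps)
    moreover have "?m / 2 \<le> measure lebesgue (\<Union>\<J>)"
    proof -
      have "?m = measure lebesgue (?S \<inter> \<Union>\<J>) + measure lebesgue (?S - \<Union>\<J>)"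
        using S mJ by (intro measure_split) (auto simp: fmeasurableD)
      moreover have "measure lebesgue (?S \<inter> \<Union>\<J>) \<le> measure lebesgue (\<Union>\<J>)"
        using S mJ by (intro measure_mono_fmeasurable) (auto simp: fmeasurableD intro!: sets.Int)
      ultimately show ?thesis using \<J>(4) by linarith
    qed
    then have "real n * (?m / 2) \<le> real n * (\<Sum>K\<in>\<J>. Sup K - Inf K)"
      unfolding mJ by (rule mult_left_mono) simp
    moreover have "real n * (\<Sum>K\<in>\<J>. Sup K - Inf K) \<le> (\<Sum>K\<in>\<J>. \<bar>f (Sup K) - f (Inf K)\<bar>)"
      unfolding sum_distrib_left
    proof (rule sum_mono)
      fix K assume "K \<in> \<J>"
      then obtain c e where "c < e" "K = {c..e}" "real n * (e - c) \<le> f e - f c"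
        using \<J>(2) by blast
      then show "real n * (Sup K - Inf K) \<le> \<bar>f (Sup K) - f (Inf K)\<bar>" by simp
    qed
    ultimately show False by linarith
  qed
  then have neg: "negligible ?S"
    using S by (simp add: negligible_iff_measure)
  have "openin (top_of_set ?E) (?E \<inter> {x - \<delta> / 3<..<x + \<delta> / 3})"
    by (intro openin_open_Int) auto
  moreover have "?E \<inter> {x - \<delta> / 3<..<x + \<delta> / 3} \<subseteq> ?S"
    by auto
  ultimately show "\<exists>U. openin (top_of_set ?E) U \<and> x \<in> U \<and> negligible U"
    using x \<open>0 < \<delta>\<close> negligible_subset[OF neg]
    by (intro exI[of _ "?E \<inter> {x - \<delta> / 3<..<x + \<delta> / 3}"]) auto
qed

text \<open>One end of a straddling interval is sent to \<open>t\<close>; continuity at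
  \<open>t\<close> carries the slope bound over to the difference quotient.\<close>

lemma not_steep_bound:
  assumes "\<not> steep f q t" "isCont f t"
  shows "\<exists>d>0. \<forall>y. \<bar>y - t\<bar> < d \<longrightarrow> y \<noteq> t \<longrightarrow> (f y - f t) / (y - t) \<le> q"
proof -
  obtain d where "d > 0" and d: "\<And>c e. \<lbrakk>c < t; t < e; e - c < d\<rbrakk> \<Longrightarrow> f e - f c \<le> q * (e - c)"
    using assms(1) unfolding steep_def by (meson not_le)
  have left: "((\<lambda>s. q * s - f s) \<longlongrightarrow> q * t - f t) (at_left t)"
    and right: "((\<lambda>s. q * s - f s) \<longlongrightarrow> q * t - f t) (at_right t)"
    using assms(2) by (auto intro!: tendsto_intros simp: isCont_def filterlim_at_split)
  have "(f y - f t) / (y - t) \<le> q" if y: "\<bar>y - t\<bar> < d" "y \<noteq> t" for y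
  proof (cases "t < y")
    case True
    have "eventually (\<lambda>c. q * c - f c \<le> q * y - f y) (at_left t)"
    proof (rule eventually_at_leftI[of "y - d"])
      show "q * c - f c \<le> q * y - f y" if "c \<in> {y - d<..<t}" for c
        using d[of c y] that True by (simp add: algebra_simps)
    qed (use y True in auto)
    then have "q * t - f t \<le> q * y - f y"
      using left by (intro tendsto_upperbound[OF left]) auto
    then show ?thesis
      using True by (simp add: pos_divide_le_eq algebra_simps)
  next
    case False
    with y have "y < t" by auto
    have "eventually (\<lambda>c. q * y - f y \<le> q * c - f c) (at_right t)"
    proof (rule eventually_at_rightI[of _ "y + d"])
      show "q * y - f y \<le> q * c - f c" if "c \<in> {t<..<y + d}" for c
        using d[of y c] that \<open>y < t\<close> by (simp add: algebra_simps)
    qed (use y \<open>y < t\<close> in auto)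
    then have "q * y - f y \<le> q * t - f t"
      using right by (intro tendsto_lowerbound[OF right]) auto
    then show ?thesis
      using \<open>y < t\<close> by (simp add: neg_divide_le_eq algebra_simps)
  qed
  then show ?thesis using \<open>d > 0\<close> by blast
qed

text \<open>The derivative is the supremum of the slopes with which \<open>f\<close> is steep:
  \<open>above\<close> bounds this set, \<open>below\<close> makes it nonempty, and
  \<open>nogap\<close> prevents the lower derivative from staying below the supremum. The last
  condition speaks of rational pairs, which keeps the exceptional set a countable union.\<close>

lemma steep_imp_has_derivative:
  assumes cont: "isCont f t"
    and above: "\<not> steep f a t" and below: "\<not> steep (\<lambda>t. - f t) b t"
    and nogap: "\<And>p q. \<lbrakk>p \<in> \<rat>; q \<in> \<rat>; p < q; steep f q t\<rbrakk> \<Longrightarrow> \<not> steep (\<lambda>t. - f t) (- p) t"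
  shows "\<exists>D. (f has_real_derivative D) (at t)"
proof -
  let ?S = "{q. steep f q t}"
  have cont': "isCont (\<lambda>t. - f t) t"
    using cont by (intro continuous_intros)
  have bdd: "bdd_above ?S"
    using above steep_antimono by (intro bdd_aboveI[of _ a]) (metis le_cases mem_Collect_eq)
  \<comment> \<open>Short straddling intervals have slope at least \<open>- b\<close>; subtracting 1
    yields the strict inequality.\<close>
  have "steep f (- b - 1) t"
    unfolding steep_def
  proof (intro allI impI)
    fix d :: real assume "d > 0"
    obtain d' where "d' > 0" and d': "\<And>c e. \<lbrakk>c < t; t < e; e - c < d'\<rbrakk> \<Longrightarrow> - f e - - f c \<le> b * (e - c)"
      using below unfolding steep_def by (meson not_le)
    define s where "s = min d d' / 3"
    have s: "s > 0" "2 * s < d" "2 * s < d'"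
      using \<open>d > 0\<close> \<open>d' > 0\<close> by (auto simp: s_def min_def)
    have "- f (t + s) - - f (t - s) \<le> b * (t + s - (t - s))"
      using s by (intro d') auto
    then have "(- b - 1) * (t + s - (t - s)) < f (t + s) - f (t - s)"
      using s(1) by (simp add: algebra_simps)
    then show "\<exists>c e. c < t \<and> t < e \<and> e - c < d \<and> (- b - 1) * (e - c) < f e - f c"
      using s by (intro exI[of _ "t - s"] exI[of _ "t + s"]) auto
  qed
  then have "?S \<noteq> {}" by blast
  define D where "D = Sup ?S"
  have up: "\<not> steep f (D + \<eta>) t" if "\<eta> > 0" for \<eta>
    using cSup_upper[OF _ bdd, of "D + \<eta>"] that by (auto simp: D_def)
  have low: "\<not> steep (\<lambda>t. - f t) (- (D - \<eta>)) t" if \<eta>: "\<eta> > 0" for \<eta>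
  proof -
    obtain q where q: "steep f q t" "D - \<eta> < q"
      using less_cSupD[OF \<open>?S \<noteq> {}\<close>, of "D - \<eta>"] \<eta> by (auto simp: D_def)
    obtain q' where q': "q' \<in> \<rat>" "D - \<eta> < q'" "q' < q"
      using Rats_dense_in_real[OF q(2)] by blast
    obtain p where p: "p \<in> \<rat>" "D - \<eta> < p" "p < q'"
      using Rats_dense_in_real[OF q'(2)] by blast
    have "steep f q' t"
      using steep_antimono[OF q(1)] q'(3) by simp
    from nogap[OF p(1) q'(1) p(3) this] show ?thesis
      using steep_antimono[of "\<lambda>t. - f t" "- (D - \<eta>)" t "- p"] p(2) by auto
  qed
  have "((\<lambda>y. (f y - f t) / (y - t)) \<longlongrightarrow> D) (at t)"
  proof (rule tendstoI)
    fix \<eta> :: real assume "\<eta> > 0"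
    then have "\<eta> / 2 > 0" by simp
    obtain d1 where "d1 > 0" and d1: "\<And>y. \<lbrakk>\<bar>y - t\<bar> < d1; y \<noteq> t\<rbrakk> \<Longrightarrow> (f y - f t) / (y - t) \<le> D + \<eta> / 2"
      using not_steep_bound[OF up[OF \<open>\<eta> / 2 > 0\<close>] cont] by blast
    obtain d2 where "d2 > 0" and d2: "\<And>y. \<lbrakk>\<bar>y - t\<bar> < d2; y \<noteq> t\<rbrakk> \<Longrightarrow> (- f y - - f t) / (y - t) \<le> - (D - \<eta> / 2)"
      using not_steep_bound[OF low[OF \<open>\<eta> / 2 > 0\<close>] cont'] by blast
    have "dist ((f y - f t) / (y - t)) D < \<eta>" if "y \<noteq> t" "dist y t < min d1 d2" for y
    proof -
      have "(- f y - - f t) / (y - t) = - ((f y - f t) / (y - t))"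
        by (simp add: minus_divide_left)
      moreover have "(f y - f t) / (y - t) \<le> D + \<eta> / 2" "(- f y - - f t) / (y - t) \<le> - (D - \<eta> / 2)"
        using that by (auto intro!: d1 d2 simp only: dist_real_def min_less_iff_conj)
      ultimately have "\<bar>(f y - f t) / (y - t) - D\<bar> \<le> \<eta> / 2"
        by linarith
      then show ?thesis
        using \<open>\<eta> > 0\<close> by (simp add: dist_real_def)
    qed
    then show "eventually (\<lambda>y. dist ((f y - f t) / (y - t)) D < \<eta>) (at t)"
      using \<open>d1 > 0\<close> \<open>d2 > 0\<close> unfolding eventually_at
      by (intro exI[of _ "min d1 d2"]) auto
  qed
  then show ?thesis
    by (auto simp: has_field_derivative_iff)
qed

theorem abs_continuous_on_differentiable_ae:
  assumes ac: "abs_continuous_on A B f"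
  obtains N where "negligible N" "\<And>t. t \<in> {A..B} - N \<Longrightarrow> f differentiable (at t)"
proof -
  let ?g = "\<lambda>t. - f t"
  have ac': "abs_continuous_on A B ?g"
    using abs_continuous_on_diff[OF abs_continuous_on_const[of A B 0] ac] by simp
  let ?E = "\<lambda>(p, q). {A<..<B} \<inter> {t. steep f q t} \<inter> {t. steep ?g (- p) t}"
  let ?R = "{(p, q). p \<in> \<rat> \<and> q \<in> \<rat> \<and> p < q} :: (real \<times> real) set"
  let ?I = "\<lambda>f. {A<..<B} \<inter> (\<Inter>n::nat. {t. steep f (real n) t})"
  \<comment> \<open>The end points are included so that \<open>t\<close> is interior and the
    derivative two-sided.\<close>
  let ?N = "{A, B} \<union> ?I f \<union> ?I ?g \<union> \<Union>(?E ` ?R)"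
  have "countable ?R"
    by (rule countable_subset[of _ "\<rat> \<times> \<rat>"]) (auto simp: countable_rat)
  then have "negligible (\<Union>(?E ` ?R))"
    using negligible_slope_gap[OF ac] by (intro negligible_countable_Union) auto
  then have "negligible ?N"
    using negligible_slope_infinite[OF ac] negligible_slope_infinite[OF ac']
    by (intro negligible_Un) auto
  moreover have "f differentiable (at t)" if t: "t \<in> {A..B} - ?N" for t
  proof -
    have tAB: "t \<in> {A<..<B}" using t by auto
    have "isCont f t"
      using abs_continuous_on_imp_continuous_on[OF ac] tAB
      by (intro continuous_on_interior) auto
    moreover obtain n :: nat where "\<not> steep f (real n) t" using t tAB by blast
    moreover obtain m :: nat where "\<not> steep ?g (real m) t" using t tAB by blast
    moreover have "\<not> steep ?g (- p) t" if "p \<in> \<rat>" "q \<in> \<rat>" "p < q" "steep f q t" for p q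
      using t tAB that by blast
    ultimately have "\<exists>D. (f has_real_derivative D) (at t)"
      by (rule steep_imp_has_derivative)
    then show ?thesis
      using real_differentiable_def by blast
  qed
  ultimately show thesis by (rule that)
qed

section \<open>Extended integrals\<close>

text \<open>The exceptional set is Lebesgue null and may fail to be Borel, hence the passage to the
  completion, which changes no nonnegative integral. These integrals are monotone for arbitrary
  functions, so integrands of unknown measurability are covered.\<close>

lemma ext_integral_mono_ae:
  assumes N: "negligible N" and le: "\<And>s. s \<in> S - N \<Longrightarrow> f s \<le> g s"
  shows "ext_integral S f \<le> ext_integral S g"
proof -
  have ae: "AE s in lebesgue. s \<notin> N"
    using N by (intro AE_not_in) (simp add: negligible_iff_null_sets)
  have "(\<integral>\<^sup>+ s\<in>S. e2ennreal (f s) \<partial>lebesgue) \<le> (\<integral>\<^sup>+ s\<in>S. e2ennreal (g s) \<partial>lebesgue)"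
  proof (rule nn_integral_mono_AE, rule AE_mp[OF ae], rule AE_I2, rule impI)
    fix s assume "s \<notin> N"
    then show "e2ennreal (f s) * indicator S s \<le> e2ennreal (g s) * indicator S s"
      using le[of s] by (auto simp: indicator_def intro: e2ennreal_mono)
  qed
  moreover have "(\<integral>\<^sup>+ s\<in>S. e2ennreal (- g s) \<partial>lebesgue) \<le> (\<integral>\<^sup>+ s\<in>S. e2ennreal (- f s) \<partial>lebesgue)"
  proof (rule nn_integral_mono_AE, rule AE_mp[OF ae], rule AE_I2, rule impI)
    fix s assume "s \<notin> N"
    then show "e2ennreal (- g s) * indicator S s \<le> e2ennreal (- f s) * indicator S s"
      using le[of s] by (auto simp: indicator_def intro: e2ennreal_mono)
  qed
  ultimately show ?thesis
    unfolding ext_integral_def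
    by (intro ereal_minus_mono) (simp_all add: nn_integral_completion less_eq_ennreal.rep_eq)
qed

lemma set_nn_integral_ereal:
  assumes "\<And>s. s \<in> S \<Longrightarrow> f s = ereal (\<phi> s)"
  shows "(\<integral>\<^sup>+ s\<in>S. e2ennreal (f s) \<partial>lborel) = (\<integral>\<^sup>+ s. ennreal (indicator S s * \<phi> s) \<partial>lebesgue)"
proof -
  have "e2ennreal (f s) * indicator S s = ennreal (indicator S s * \<phi> s)" for s
    using assms[of s] by (simp add: indicator_def)
  then show ?thesis
    by (simp add: nn_integral_completion)
qed

lemma ext_integral_ereal:
  assumes eq: "\<And>s. s \<in> S \<Longrightarrow> f s = ereal (\<phi> s)"
  shows "ext_integral S f = enn2ereal (\<integral>\<^sup>+ s. ennreal (indicator S s * \<phi> s) \<partial>lebesgue)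
           - enn2ereal (\<integral>\<^sup>+ s. ennreal (- (indicator S s * \<phi> s)) \<partial>lebesgue)"
  unfolding ext_integral_def
  using set_nn_integral_ereal[of S f \<phi>] set_nn_integral_ereal[of S "\<lambda>s. - f s" "\<lambda>s. - \<phi> s"] eq
  by simp

lemma enn2ereal_eq_ereal_enn2real: "a \<noteq> top \<Longrightarrow> enn2ereal a = ereal (enn2real a)"
  by (cases a) (auto simp: top_ennreal.rep_eq)

lemma ext_integral_absolutely_integrable:
  assumes \<phi>: "\<phi> absolutely_integrable_on S" and eq: "\<And>s. s \<in> S \<Longrightarrow> f s = ereal (\<phi> s)"
  shows "ext_integral S f = ereal (integral S \<phi>)"
proof -
  let ?\<psi> = "\<lambda>s. indicator S s * \<phi> s"
  have int: "integrable lebesgue ?\<psi>"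
    using \<phi> by (simp add: set_integrable_def)
  have "integral S \<phi> = integral\<^sup>L lebesgue ?\<psi>"
    using set_lebesgue_integral_eq_integral(2)[OF \<phi>] by (simp add: set_lebesgue_integral_def)
  also have "\<dots> = enn2real (\<integral>\<^sup>+ s. ennreal (?\<psi> s) \<partial>lebesgue) - enn2real (\<integral>\<^sup>+ s. ennreal (- ?\<psi> s) \<partial>lebesgue)"
    by (rule real_lebesgue_integral_def[OF int])
  finally show ?thesis
    using int by (simp add: ext_integral_ereal[OF eq] real_integrable_def enn2ereal_eq_ereal_enn2real)
qed

text \<open>A lower bound on a set of finite measure makes the integral of the negative part finite,
  so a value other than \<infinity> can only come from a finite positive part.\<close>

lemma ext_integral_finite_imp_integrable:
  assumes S: "S \<in> lmeasurable" and meas: "\<phi> \<in> borel_measurable (lebesgue_on S)"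
    and bound: "\<And>s. s \<in> S \<Longrightarrow> c \<le> \<phi> s" and eq: "\<And>s. s \<in> S \<Longrightarrow> f s = ereal (\<phi> s)"
    and fin: "ext_integral S f \<noteq> \<infinity>"
  shows "\<phi> absolutely_integrable_on S"
proof -
  let ?\<psi> = "\<lambda>s. indicator S s * \<phi> s"
  have "?\<psi> \<in> borel_measurable lebesgue"
    using meas S borel_measurable_restrict_space_iff[of S lebesgue \<phi>] by (simp add: fmeasurableD)
  moreover have neg: "(\<integral>\<^sup>+ s. ennreal (- ?\<psi> s) \<partial>lebesgue) \<noteq> \<infinity>"
  proof -
    have "(\<integral>\<^sup>+ s. ennreal (- ?\<psi> s) \<partial>lebesgue) \<le> (\<integral>\<^sup>+ s. ennreal \<bar>c\<bar> * indicator S s \<partial>lebesgue)"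
    proof (rule nn_integral_mono)
      fix s
      show "ennreal (- ?\<psi> s) \<le> ennreal \<bar>c\<bar> * indicator S s"
        using bound[of s] by (auto simp: indicator_def intro!: ennreal_leI)
    qed
    also have "\<dots> = ennreal \<bar>c\<bar> * emeasure lebesgue S"
      using S by (intro nn_integral_cmult_indicator) (simp add: fmeasurableD)
    also have "\<dots> < \<infinity>"
      using S unfolding fmeasurable_def mem_Collect_eq
      by (simp add: ennreal_mult_less_top del: emeasure_completion)
    finally show ?thesis by simp
  qed
  moreover have "(\<integral>\<^sup>+ s. ennreal (?\<psi> s) \<partial>lebesgue) \<noteq> \<infinity>"
  proof
    assume "(\<integral>\<^sup>+ s. ennreal (?\<psi> s) \<partial>lebesgue) = \<infinity>"
    then have "ext_integral S f = \<infinity>"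
      using neg by (simp add: ext_integral_ereal[OF eq] top_ennreal.rep_eq)
    with fin show False by simp
  qed
  ultimately show ?thesis
    by (simp add: set_integrable_def real_integrable_def)
qed

text \<open>A nonnegative gauge integrable function is Lebesgue integrable, and a vanishing Lebesgue
  integral forces it to be zero almost everywhere. Resetting the values on \<open>N\<close> to 0
  makes nonnegativity hold throughout \<open>S\<close>.\<close>

lemma nonpos_integral_imp_ae_zero:
  fixes \<phi> :: "real \<Rightarrow> real"
  assumes int: "(\<phi> has_integral d) S" and "d \<le> 0" and N: "negligible N"
    and nonneg: "\<And>s. s \<in> S - N \<Longrightarrow> 0 \<le> \<phi> s"
  shows "negligible {s \<in> S. \<phi> s \<noteq> 0}"
proof -
  let ?\<psi> = "\<lambda>s. if s \<in> N then 0 else \<phi> s"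
  have int': "(?\<psi> has_integral d) S"
    by (rule has_integral_spike[OF N _ int]) auto
  have pos: "\<And>s. s \<in> S \<Longrightarrow> 0 \<le> ?\<psi> s" using nonneg by auto
  have ai: "?\<psi> absolutely_integrable_on S"
    using int' pos by (intro nonnegative_absolutely_integrable_1) auto
  have "integral S ?\<psi> \<le> 0"
    using int' \<open>d \<le> 0\<close> by (simp add: integral_unique)
  moreover have "integral S ?\<psi> \<ge> 0"
    using int' pos by (intro integral_nonneg) auto
  ultimately have zero: "integral\<^sup>L lebesgue (\<lambda>s. indicator S s * ?\<psi> s) = 0"
    using set_lebesgue_integral_eq_integral(2)[OF ai] by (simp add: set_lebesgue_integral_def)
  have "AE s in lebesgue. indicator S s * ?\<psi> s = 0"
  proof (subst integral_nonneg_eq_0_iff_AE[symmetric])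
    show "integrable lebesgue (\<lambda>s. indicator S s * ?\<psi> s)"
      using ai by (simp add: set_integrable_def)
    show "AE s in lebesgue. 0 \<le> indicator S s * ?\<psi> s"
      by (rule AE_I2) (use nonneg in \<open>auto simp: indicator_def\<close>)
  qed (rule zero)
  then obtain N' where N': "negligible N'" "{s. indicator S s * ?\<psi> s \<noteq> 0} \<subseteq> N'"
    unfolding eventually_ae_filter_negligible by blast
  have "{s \<in> S. ?\<psi> s \<noteq> 0} \<subseteq> N'"
    using N'(2) by (auto simp: indicator_def)
  then have "negligible {s \<in> S. ?\<psi> s \<noteq> 0}"
    using N'(1) negligible_subset by blast
  then have "negligible ({s \<in> S. ?\<psi> s \<noteq> 0} \<union> N)"
    using N by (rule negligible_Un)
  then show ?thesis
    by (rule negligible_subset) auto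
qed

text \<open>The mean value theorem gives \<open>\<epsilon> * \<eta> s * h \<xi>\<close> with
  \<open>\<xi>\<close> close to \<open>\<gamma> s\<close>; uniform continuity of \<open>h\<close> on
  a compact range away from 0 replaces \<open>\<xi>\<close> by \<open>\<gamma> s\<close> at the
  price of \<open>\<rho>\<close>, uniformly in \<open>s\<close>. In the application
  \<open>\<gamma>\<close> is a gap of the minimizer.\<close>

lemma uniform_increment_le:
  fixes \<gamma> \<eta> H h :: "real \<Rightarrow> real"
  assumes \<gamma>: "continuous_on {A..B} \<gamma>" and \<eta>: "continuous_on {A..B} \<eta>"
    and pos: "\<And>s. s \<in> {A..B} \<Longrightarrow> 0 < \<gamma> s" and "A \<le> B"
    and H: "\<And>y. 0 < y \<Longrightarrow> (H has_real_derivative h y) (at y)"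
    and h: "continuous_on {0<..} h" and "\<rho> > 0"
  shows "\<exists>\<epsilon>0>0. \<forall>\<epsilon>\<in>{0<..\<epsilon>0}. \<forall>s\<in>{A..B}. 0 < \<gamma> s + \<epsilon> * \<eta> s \<and>
           H (\<gamma> s + \<epsilon> * \<eta> s) - H (\<gamma> s) \<le> \<epsilon> * (h (\<gamma> s) * \<eta> s + \<rho>)"
proof -
  have ne: "{A..B} \<noteq> {}" using \<open>A \<le> B\<close> by simp
  obtain s0 where s0: "s0 \<in> {A..B}" "\<forall>s\<in>{A..B}. \<gamma> s0 \<le> \<gamma> s"
    using continuous_attains_inf[OF compact_Icc ne \<gamma>] by blast
  define \<delta> where "\<delta> = \<gamma> s0"
  have "\<delta> > 0" using pos s0 by (simp add: \<delta>_def)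
  obtain s1 where s1: "\<forall>s\<in>{A..B}. \<gamma> s \<le> \<gamma> s1"
    using continuous_attains_sup[OF compact_Icc ne \<gamma>] by blast
  have "bounded (\<eta> ` {A..B})"
    using \<eta> by (simp add: compact_continuous_image compact_imp_bounded)
  then obtain M where "M > 0" and M: "\<And>s. s \<in> {A..B} \<Longrightarrow> \<bar>\<eta> s\<bar> \<le> M"
    by (metis bounded_pos imageI real_norm_def)
  \<comment> \<open>Perturbations of size at most \<open>\<delta> / 2\<close> keep all arguments of
    \<open>h\<close> in this interval.\<close>
  let ?K = "{\<delta> / 2..\<gamma> s1 + \<delta>}"
  have "uniformly_continuous_on ?K h"
    using \<open>\<delta> > 0\<close> by (intro compact_uniformly_continuous continuous_on_subset[OF h]) auto
  moreover have "\<rho> / M > 0" using \<open>M > 0\<close> \<open>\<rho> > 0\<close> by simp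
  ultimately obtain \<kappa> where "\<kappa> > 0" and \<kappa>: "\<And>y y'. \<lbrakk>y \<in> ?K; y' \<in> ?K; dist y' y < \<kappa>\<rbrakk> \<Longrightarrow> dist (h y') (h y) < \<rho> / M"
    unfolding uniformly_continuous_on_def by blast
  \<comment> \<open>This makes \<open>\<bar>\<epsilon> * \<eta> s\<bar>\<close> at most half of
    \<kappa> and of \<delta>: within the modulus of continuity and within the margin of
    \<open>?K\<close>.\<close>
  define \<epsilon>0 where "\<epsilon>0 = min \<kappa> \<delta> / (2 * M)"
  have "\<epsilon>0 > 0" using \<open>\<kappa> > 0\<close> \<open>\<delta> > 0\<close> \<open>M > 0\<close> by (simp add: \<epsilon>0_def)
  moreover have "0 < \<gamma> s + \<epsilon> * \<eta> s \<and> H (\<gamma> s + \<epsilon> * \<eta> s) - H (\<gamma> s) \<le> \<epsilon> * (h (\<gamma> s) * \<eta> s + \<rho>)"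
    if \<epsilon>: "\<epsilon> \<in> {0<..\<epsilon>0}" and s: "s \<in> {A..B}" for \<epsilon> s
  proof -
    have "\<epsilon> * \<bar>\<eta> s\<bar> \<le> \<epsilon>0 * M"
      using \<epsilon> M[OF s] \<open>M > 0\<close> by (intro mult_mono) auto
    also have "\<dots> = min \<kappa> \<delta> / 2"
      using \<open>M > 0\<close> by (simp add: \<epsilon>0_def)
    finally have "\<bar>\<epsilon> * \<eta> s\<bar> \<le> min \<kappa> \<delta> / 2"
      using \<epsilon> by (simp add: abs_mult)
    then have small: "\<bar>\<epsilon> * \<eta> s\<bar> < \<kappa>" "\<bar>\<epsilon> * \<eta> s\<bar> \<le> \<delta> / 2"
      using \<open>\<kappa> > 0\<close> by auto
    have \<gamma>s: "\<delta> \<le> \<gamma> s" "\<gamma> s \<le> \<gamma> s1"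
      using s0 s1 s by (auto simp: \<delta>_def)
    have "\<exists>\<xi>. \<bar>\<xi> - \<gamma> s\<bar> \<le> \<bar>\<epsilon> * \<eta> s\<bar> \<and> H (\<gamma> s + \<epsilon> * \<eta> s) - H (\<gamma> s) = \<epsilon> * \<eta> s * h \<xi>"
    proof -
      consider "\<epsilon> * \<eta> s = 0" | "\<epsilon> * \<eta> s > 0" | "\<epsilon> * \<eta> s < 0" by linarith
      then show ?thesis
      proof cases
        case 1
        then show ?thesis by (intro exI[of _ "\<gamma> s"]) auto
      next
        case 2
        have "\<exists>\<xi>. \<gamma> s < \<xi> \<and> \<xi> < \<gamma> s + \<epsilon> * \<eta> s \<and>
          H (\<gamma> s + \<epsilon> * \<eta> s) - H (\<gamma> s) = (\<gamma> s + \<epsilon> * \<eta> s - \<gamma> s) * h \<xi>"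
        proof (rule MVT2)
          show "(H has_real_derivative h y) (at y)" if "\<gamma> s \<le> y" for y
            using that \<gamma>s \<open>\<delta> > 0\<close> by (intro H) linarith
        qed (use 2 in simp)
        then obtain \<xi> where "\<gamma> s < \<xi>" "\<xi> < \<gamma> s + \<epsilon> * \<eta> s"
          "H (\<gamma> s + \<epsilon> * \<eta> s) - H (\<gamma> s) = (\<gamma> s + \<epsilon> * \<eta> s - \<gamma> s) * h \<xi>"
          by blast
        then show ?thesis by (intro exI[of _ \<xi>]) simp
      next
        case 3
        have "\<exists>\<xi>. \<gamma> s + \<epsilon> * \<eta> s < \<xi> \<and> \<xi> < \<gamma> s \<and>
          H (\<gamma> s) - H (\<gamma> s + \<epsilon> * \<eta> s) = (\<gamma> s - (\<gamma> s + \<epsilon> * \<eta> s)) * h \<xi>"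
        proof (rule MVT2)
          show "(H has_real_derivative h y) (at y)" if "\<gamma> s + \<epsilon> * \<eta> s \<le> y" for y
            using that \<gamma>s small \<open>\<delta> > 0\<close> by (intro H) linarith
        qed (use 3 in simp)
        then obtain \<xi> where "\<gamma> s + \<epsilon> * \<eta> s < \<xi>" "\<xi> < \<gamma> s"
          "H (\<gamma> s) - H (\<gamma> s + \<epsilon> * \<eta> s) = (\<gamma> s - (\<gamma> s + \<epsilon> * \<eta> s)) * h \<xi>"
          by blast
        then show ?thesis by (intro exI[of _ \<xi>]) auto
      qed
    qed
    then obtain \<xi> where \<xi>: "\<bar>\<xi> - \<gamma> s\<bar> \<le> \<bar>\<epsilon> * \<eta> s\<bar>"
      "H (\<gamma> s + \<epsilon> * \<eta> s) - H (\<gamma> s) = \<epsilon> * \<eta> s * h \<xi>" by blast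
    have "dist (h \<xi>) (h (\<gamma> s)) < \<rho> / M"
      using \<xi>(1) small \<gamma>s \<open>\<delta> > 0\<close> by (intro \<kappa>) (auto simp: dist_real_def)
    then have "\<bar>\<eta> s\<bar> * \<bar>h \<xi> - h (\<gamma> s)\<bar> \<le> M * (\<rho> / M)"
      using M[OF s] \<open>M > 0\<close> by (intro mult_mono) (auto simp: dist_real_def)
    then have "\<eta> s * (h \<xi> - h (\<gamma> s)) \<le> \<rho>"
      using \<open>M > 0\<close> by (simp flip: abs_mult)
    then have "\<epsilon> * (\<eta> s * h \<xi>) \<le> \<epsilon> * (h (\<gamma> s) * \<eta> s + \<rho>)"
      using \<epsilon> by (intro mult_left_mono) (auto simp: algebra_simps)
    moreover have "0 < \<gamma> s + \<epsilon> * \<eta> s"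
      using small \<gamma>s \<open>\<delta> > 0\<close> by linarith
    ultimately show ?thesis
      using \<xi>(2) by (simp add: mult.assoc)
  qed
  ultimately show ?thesis by blast
qed

section \<open>Convex Lagrangians\<close>

text \<open>Uniform convexity enters as a supporting parabola at every point. Added for two points
  in both orders, it gives strong monotonicity of \<open>L'\<close>; taken alone, it bounds the
  excess of \<open>L\<close> over its tangent from below by a squared difference of
  velocities.\<close>

locale strongly_convex =
  fixes L L' :: "real \<Rightarrow> real" and \<theta> :: real
  assumes \<theta>_pos: "0 < \<theta>"
    and L_deriv: "(L has_real_derivative L' u) (at u)"
    and L'_cont: "continuous_on UNIV L'"
    and L_above_tangent: "L v + L' v * (u - v) + \<theta> * (u - v)\<^sup>2 \<le> L u"
begin

text \<open>The velocity as a function of the momentum; it is the derivative of the Legendre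
  transform of \<open>L\<close>.\<close>

definition \<Lambda> :: "real \<Rightarrow> real" where "\<Lambda> = inv L'"

lemma L_cont: "continuous_on UNIV L"
  using L_deriv by (intro continuous_at_imp_continuous_on) (auto intro: DERIV_isCont)

lemma L_convex:
  assumes "0 \<le> e" "e \<le> 1"
  shows "L ((1 - e) * a + e * b) \<le> (1 - e) * L a + e * L b"
proof -
  let ?m = "(1 - e) * a + e * b"
  have "L ?m + L' ?m * (u - ?m) \<le> L u" for u
    using L_above_tangent[of ?m u] \<theta>_pos by (smt (verit) mult_nonneg_nonneg zero_le_power2)
  then have "(1 - e) * (L ?m + L' ?m * (a - ?m)) + e * (L ?m + L' ?m * (b - ?m)) \<le> (1 - e) * L a + e * L b"
    using assms by (intro add_mono mult_left_mono) auto
  then show ?thesis by (simp add: algebra_simps)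
qed

lemma L'_strongly_mono: "2 * \<theta> * (u - v)\<^sup>2 \<le> (L' u - L' v) * (u - v)"
  using L_above_tangent[of v u] L_above_tangent[of u v]
  by (simp add: algebra_simps power2_eq_square)

lemma L'_diff_ge: "v \<le> u \<Longrightarrow> 2 * \<theta> * (u - v) \<le> L' u - L' v"
proof (cases "u = v")
  case False
  assume "v \<le> u"
  with False have "u - v > 0" by simp
  then show ?thesis
    using L'_strongly_mono[of u v] by (simp add: power2_eq_square mult.assoc[symmetric])
qed simp

lemma bij_L': "bij L'"
proof (rule bijI)
  show "inj L'"
  proof (rule injI)
    fix u v assume "L' u = L' v"
    then have "2 * \<theta> * (u - v)\<^sup>2 \<le> 0" using L'_strongly_mono[of u v] by simp
    then have "(u - v)\<^sup>2 \<le> 0" using \<theta>_pos by (simp add: mult_le_0_iff)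
    then show "u = v" by simp
  qed
  show "surj L'"
    unfolding surj_def
  proof
    fix w
    \<comment> \<open>By strong monotonicity \<open>L'\<close> changes by at least
      \<open>2 * \<theta> * b\<close> between 0 and \<open>b\<close>, and between \<open>- b\<close>
      and 0, which is enough to reach \<open>w\<close> from either side.\<close>
    define b where "b = \<bar>w - L' 0\<bar> / (2 * \<theta>)"
    have b: "0 \<le> b" "2 * \<theta> * b = \<bar>w - L' 0\<bar>" using \<theta>_pos by (simp_all add: b_def)
    have "w \<le> L' b" using L'_diff_ge[of 0 b] b by simp
    moreover have "L' (- b) \<le> w" using L'_diff_ge[of "- b" 0] b by simp
    ultimately show "\<exists>u. w = L' u"
      using IVT'[of L' "- b" w b] b continuous_on_subset[OF L'_cont] by fastforce
  qed
qed

lemma L'_\<Lambda> [simp]: "L' (\<Lambda> w) = w"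
  using bij_L' by (simp add: \<Lambda>_def surj_f_inv_f bij_is_surj)

lemma \<Lambda>_L' [simp]: "\<Lambda> (L' u) = u"
  using bij_L' by (simp add: \<Lambda>_def bij_is_inj)

lemma \<Lambda>_lipschitz: "\<bar>\<Lambda> w - \<Lambda> v\<bar> \<le> \<bar>w - v\<bar> / (2 * \<theta>)"
proof (cases "\<Lambda> v \<le> \<Lambda> w")
  case True
  then show ?thesis
    using L'_diff_ge[of "\<Lambda> v" "\<Lambda> w"] \<theta>_pos by (simp add: field_simps)
next
  case False
  then show ?thesis
    using L'_diff_ge[of "\<Lambda> w" "\<Lambda> v"] \<theta>_pos by (simp add: field_simps)
qed

lemma \<Lambda>_mono: "w \<le> v \<Longrightarrow> \<Lambda> w \<le> \<Lambda> v"
proof (rule ccontr)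
  assume "w \<le> v" and not: "\<not> \<Lambda> w \<le> \<Lambda> v"
  then have "2 * \<theta> * (\<Lambda> w - \<Lambda> v) \<le> 0" using L'_diff_ge[of "\<Lambda> v" "\<Lambda> w"] by simp
  moreover have "2 * \<theta> * (\<Lambda> w - \<Lambda> v) > 0" using not \<theta>_pos by simp
  ultimately show False by simp
qed

lemma continuous_on_\<Lambda>: "continuous_on UNIV \<Lambda>"
proof (rule lipschitz_on_continuous_on)
  show "(1 / (2 * \<theta>))-lipschitz_on UNIV \<Lambda>"
    using \<Lambda>_lipschitz \<theta>_pos by (intro lipschitz_onI) (auto simp: dist_real_def)
qed

text \<open>The function is the Legendre transform of \<open>L\<close>. The tangent inequalities at
  \<open>\<Lambda> v\<close> and \<open>\<Lambda> w\<close> squeeze its difference quotient between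
  \<open>\<Lambda> w\<close> and \<open>\<Lambda> v\<close>, so continuity of \<Lambda> gives the
  derivative. The energy can thus be differentiated in time by differentiating the momentum
  alone.\<close>

lemma legendre_has_derivative:
  "((\<lambda>w. w * \<Lambda> w - L (\<Lambda> w)) has_real_derivative \<Lambda> w) (at w)"
proof -
  let ?K = "\<lambda>w. w * \<Lambda> w - L (\<Lambda> w)"
  have ge: "(v - w) * \<Lambda> w \<le> ?K v - ?K w" for v w
  proof -
    have "L (\<Lambda> v) + v * (\<Lambda> w - \<Lambda> v) \<le> L (\<Lambda> v) + L' (\<Lambda> v) * (\<Lambda> w - \<Lambda> v) + \<theta> * (\<Lambda> w - \<Lambda> v)\<^sup>2"
      using \<theta>_pos by simp
    also have "\<dots> \<le> L (\<Lambda> w)" by (rule L_above_tangent)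
    finally show ?thesis by (simp add: algebra_simps)
  qed
  have quot: "\<bar>(?K v - ?K w) / (v - w) - \<Lambda> w\<bar> \<le> \<bar>\<Lambda> v - \<Lambda> w\<bar>" if "v \<noteq> w" for v
  proof -
    have "(v - w) * \<Lambda> w \<le> ?K v - ?K w" "?K v - ?K w \<le> (v - w) * \<Lambda> v"
      using ge[of v w] ge[of w v] by (auto simp: algebra_simps)
    then have "\<bar>?K v - ?K w - (v - w) * \<Lambda> w\<bar> \<le> \<bar>(v - w) * (\<Lambda> v - \<Lambda> w)\<bar>"
      by (simp add: right_diff_distrib)
    moreover have "(?K v - ?K w) / (v - w) - \<Lambda> w = (?K v - ?K w - (v - w) * \<Lambda> w) / (v - w)"
      using that by (simp add: diff_divide_distrib)
    ultimately show ?thesis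
      using that by (simp add: abs_mult pos_divide_le_eq mult.commute)
  qed
  have "isCont \<Lambda> w"
    using continuous_on_\<Lambda> by (simp add: continuous_on_eq_continuous_at)
  then have "((\<lambda>v. \<Lambda> v - \<Lambda> w) \<longlongrightarrow> 0) (at w)"
    by (simp add: isCont_def LIM_zero)
  then have lim: "((\<lambda>v. \<bar>\<Lambda> v - \<Lambda> w\<bar>) \<longlongrightarrow> 0) (at w)"
    by (rule tendsto_rabs_zero)
  have "eventually (\<lambda>v. norm ((?K v - ?K w) / (v - w) - \<Lambda> w) \<le> \<bar>\<Lambda> v - \<Lambda> w\<bar>) (at w)"
    unfolding real_norm_def by (rule eventually_mono[OF eventually_neq_at_within]) (rule quot)
  then have "((\<lambda>v. (?K v - ?K w) / (v - w) - \<Lambda> w) \<longlongrightarrow> 0) (at w)"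
    using lim by (rule Lim_null_comparison)
  then show ?thesis
    by (simp add: has_field_derivative_iff LIM_zero_iff)
qed

text \<open>In the application \<open>c\<close> is the initial momentum and the integral the
  displacement. \<open>L' (d / T)\<close> is the momentum of uniform motion; shifting it by a bound
  of \<open>\<Phi>\<close> up or down makes the displacement at least or at most \<open>d\<close>.
  It depends continuously on \<open>c\<close>, since \<Lambda> is Lipschitz.\<close>

lemma shooting:
  fixes T :: real
  assumes \<Phi>: "continuous_on {0..T} \<Phi>" and "0 < T"
  shows "\<exists>c. integral {0..T} (\<lambda>t. \<Lambda> (c + \<Phi> t)) = d"
proof -
  have cont: "continuous_on {0..T} (\<lambda>t. \<Lambda> (c + \<Phi> t))" for c
    by (intro continuous_on_compose2[OF continuous_on_\<Lambda>] continuous_intros \<Phi>) auto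
  have int: "(\<lambda>t. \<Lambda> (c + \<Phi> t)) integrable_on {0..T}" for c
    by (rule integrable_continuous_real[OF cont])
  let ?F = "\<lambda>c. integral {0..T} (\<lambda>t. \<Lambda> (c + \<Phi> t))"
  obtain m where m: "\<And>t. t \<in> {0..T} \<Longrightarrow> \<bar>\<Phi> t\<bar> \<le> m"
    using continuous_on_Icc_bounded[OF \<Phi>] by blast
  have "m \<ge> 0" using m[of 0] \<open>0 < T\<close> by simp
  let ?w = "L' (d / T)"
  have const: "integral {0..T} (\<lambda>t. \<Lambda> ?w) = d"
    using \<open>0 < T\<close> by simp
  have hi: "integral {0..T} (\<lambda>t. \<Lambda> ?w) \<le> ?F (?w + m)"
  proof (rule integral_le)
    show "\<Lambda> ?w \<le> \<Lambda> (?w + m + \<Phi> t)" if "t \<in> {0..T}" for t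
      using m[OF that] by (intro \<Lambda>_mono) auto
  qed (use int in auto)
  have lo: "?F (?w - m) \<le> integral {0..T} (\<lambda>t. \<Lambda> ?w)"
  proof (rule integral_le)
    show "\<Lambda> (?w - m + \<Phi> t) \<le> \<Lambda> ?w" if "t \<in> {0..T}" for t
      using m[OF that] by (intro \<Lambda>_mono) auto
  qed (use int in auto)
  have "(T / (2 * \<theta>))-lipschitz_on UNIV ?F"
  proof (rule lipschitz_onI)
    fix c c' :: real
    have "?F c - ?F c' = integral {0..T} (\<lambda>t. \<Lambda> (c + \<Phi> t) - \<Lambda> (c' + \<Phi> t))"
      using int by (simp add: Henstock_Kurzweil_Integration.integral_diff)
    also have "norm \<dots> \<le> (\<bar>c - c'\<bar> / (2 * \<theta>)) * (T - 0)"
    proof (rule integral_bound)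
      show "norm (\<Lambda> (c + \<Phi> t) - \<Lambda> (c' + \<Phi> t)) \<le> \<bar>c - c'\<bar> / (2 * \<theta>)" for t
        using \<Lambda>_lipschitz[of "c + \<Phi> t" "c' + \<Phi> t"] by simp
    qed (use \<open>0 < T\<close> cont in \<open>auto intro!: continuous_intros\<close>)
    finally show "dist (?F c) (?F c') \<le> T / (2 * \<theta>) * dist c c'"
      by (simp add: dist_real_def mult.commute)
  qed (use \<open>0 < T\<close> \<theta>_pos in simp)
  then have "continuous_on UNIV ?F"
    by (rule lipschitz_on_continuous_on)
  then have "continuous_on {?w - m..?w + m} ?F"
    by (rule continuous_on_subset) simp
  then show ?thesis
    using IVT'[of ?F "?w - m" d "?w + m"] lo[unfolded const] hi[unfolded const] \<open>m \<ge> 0\<close> by auto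
qed

end

text \<open>The convexity inequality is divided by the weight \<open>l\<close> of \<open>u\<close>,
  and \<open>l\<close> tends to 0 from the right; the quadratic term survives as
  \<open>\<theta> * (u - v)\<^sup>2\<close>.\<close>

lemma uniformly_convex_imp_strongly_convex:
  assumes C1: "C1_deriv_on L L' UNIV" and uc: "uniformly_convex L"
  obtains \<theta> where "strongly_convex L L' \<theta>"
proof -
  obtain \<theta> where "\<theta> > 0" and uc': "\<And>u v l. l \<in> {0..1} \<Longrightarrow>
      L (l * u + (1 - l) * v) \<le> l * L u + (1 - l) * L v - \<theta> * l * (1 - l) * (u - v)\<^sup>2"
    using uc unfolding uniformly_convex_def by blast
  have deriv: "(L has_real_derivative L' u) (at u)" for u
    using C1 by (simp add: C1_deriv_on_def)
  have "L v + L' v * (u - v) + \<theta> * (u - v)\<^sup>2 \<le> L u" for u v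
  proof -
    let ?\<phi> = "\<lambda>l. L (v + l * (u - v))"
    have "(?\<phi> has_real_derivative L' (v + 0 * (u - v)) * (u - v)) (at 0)"
      by (rule DERIV_chain2[OF deriv]) (auto intro!: derivative_eq_intros)
    then have lim: "((\<lambda>l. (?\<phi> l - L v) / l) \<longlongrightarrow> L' v * (u - v)) (at_right 0)"
      unfolding has_field_derivative_iff by (auto intro: filterlim_at_split[THEN iffD1, THEN conjunct2])
    have lim2: "((\<lambda>l. L u - L v - \<theta> * (1 - l) * (u - v)\<^sup>2) \<longlongrightarrow> L u - L v - \<theta> * (1 - 0) * (u - v)\<^sup>2) (at_right 0)"
      by (intro tendsto_intros)
    have "eventually (\<lambda>l. (?\<phi> l - L v) / l \<le> L u - L v - \<theta> * (1 - l) * (u - v)\<^sup>2) (at_right 0)"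
    proof (rule eventually_at_rightI[of 0 1])
      fix l :: real assume l: "l \<in> {0<..<1}"
      have "?\<phi> l = L (l * u + (1 - l) * v)" by (simp add: algebra_simps)
      also have "\<dots> \<le> l * L u + (1 - l) * L v - \<theta> * l * (1 - l) * (u - v)\<^sup>2"
        using l by (intro uc') auto
      finally have "?\<phi> l - L v \<le> (L u - L v - \<theta> * (1 - l) * (u - v)\<^sup>2) * l"
        by (simp add: algebra_simps)
      then show "(?\<phi> l - L v) / l \<le> L u - L v - \<theta> * (1 - l) * (u - v)\<^sup>2"
        using l by (simp add: pos_divide_le_eq)
    qed simp
    from tendsto_le[OF _ lim2 lim this] show ?thesis by simp
  qed
  with \<open>\<theta> > 0\<close> deriv C1 have "strongly_convex L L' \<theta>"
    by unfold_locales (auto simp: C1_deriv_on_def)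
  then show thesis by (rule that)
qed

section \<open>Configurations\<close>

lemma convex_combination_pos:
  fixes a b r :: real
  assumes "0 < a" "0 < b" "0 \<le> r" "r \<le> 1"
  shows "0 < (1 - r) * a + r * b"
proof (cases "r = 0")
  case False
  with assms have "0 < r * b" "0 \<le> (1 - r) * a" by simp_all
  then show ?thesis by linarith
qed (use assms in simp)

text \<open>Neighbours are taken on a genuine cycle of indices. The unit shift in
  \<open>pred_pos\<close> becomes a separate constant in \<open>gap_eq\<close> and drops out of
  differences and time derivatives of gaps.\<close>

definition cyclic_pred :: "nat \<Rightarrow> nat \<Rightarrow> nat" where
  "cyclic_pred N i = (if i = 1 then N else i - 1)"

definition cyclic_succ :: "nat \<Rightarrow> nat \<Rightarrow> nat" where
  "cyclic_succ N i = (if i = N then 1 else Suc i)"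

lemma cyclic_pred_mem: "i \<in> {1..N} \<Longrightarrow> cyclic_pred N i \<in> {1..N}"
  by (auto simp: cyclic_pred_def)

lemma cyclic_succ_mem: "i \<in> {1..N} \<Longrightarrow> cyclic_succ N i \<in> {1..N}"
  by (auto simp: cyclic_succ_def)

lemma cyclic_pred_succ: "i \<in> {1..N} \<Longrightarrow> cyclic_pred N (cyclic_succ N i) = i"
  by (auto simp: cyclic_pred_def cyclic_succ_def)

lemma bij_betw_cyclic_succ: "bij_betw (cyclic_succ N) {1..N} {1..N}"
  by (rule bij_betw_byWitness[where f' = "cyclic_pred N"])
    (auto simp: cyclic_pred_def cyclic_succ_def)

text \<open>A shift of the index around the cycle leaves no boundary terms. This turns sums over
  gaps into sums over particles and, with \<open>b\<close> constantly 1, shows that internal forces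
  cancel.\<close>

lemma sum_cyclic_by_parts:
  fixes a b :: "nat \<Rightarrow> real"
  shows "(\<Sum>i=1..N. a i * (b i - b (cyclic_pred N i))) = (\<Sum>i=1..N. (a i - a (cyclic_succ N i)) * b i)"
proof -
  have "(\<Sum>i=1..N. a i * b (cyclic_pred N i)) = (\<Sum>i=1..N. a (cyclic_succ N i) * b (cyclic_pred N (cyclic_succ N i)))"
    by (rule sum.reindex_bij_betw[OF bij_betw_cyclic_succ, symmetric])
  also have "\<dots> = (\<Sum>i=1..N. a (cyclic_succ N i) * b i)"
    by (intro sum.cong) (auto simp: cyclic_pred_succ)
  finally show ?thesis
    by (simp add: right_diff_distrib left_diff_distrib sum_subtractf)
qed

lemma gap_eq: "gap N p i = p i - p (cyclic_pred N i) + (if i = 1 then 1 else 0)"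
  by (simp add: gap_def pred_pos_def cyclic_pred_def)

lemma gap_diff:
  "gap N p i - gap N q i = (p i - q i) - (p (cyclic_pred N i) - q (cyclic_pred N i))"
  by (simp add: gap_eq)

lemma gap_convex_combination:
  "gap N (\<lambda>i. (1 - e) * p i + e * q i) i = gap N p i + e * (gap N q i - gap N p i)"
  by (simp add: gap_eq algebra_simps)

lemma gap_cong:
  "\<lbrakk>\<And>j. j \<in> {1..N} \<Longrightarrow> p j = q j; i \<in> {1..N}\<rbrakk> \<Longrightarrow> gap N p i = gap N q i"
  using cyclic_pred_mem[of i N] by (simp add: gap_eq)

lemma config_spaceI:
  assumes "N \<ge> 1" and "\<And>i. i \<in> {1..N} \<Longrightarrow> 0 \<le> gap N p i"
  shows "p \<in> config_space N"
  unfolding config_space_def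
proof (intro CollectI conjI allI impI)
  fix i assume "1 \<le> i \<and> i < N"
  then show "p i \<le> p (Suc i)"
    using assms(2)[of "Suc i"] by (auto simp: gap_def pred_pos_def)
next
  show "p N \<le> p 1 + 1"
    using assms(2)[of 1] assms(1) by (auto simp: gap_def pred_pos_def)
qed

lemma continuous_on_gap:
  assumes "\<And>j. j \<in> {1..N} \<Longrightarrow> continuous_on S (\<lambda>s. y s j)" "i \<in> {1..N}"
  shows "continuous_on S (\<lambda>s. gap N (y s) i)"
  unfolding gap_eq using assms cyclic_pred_mem[OF assms(2)] by (intro continuous_intros) auto

lemma velocity_eqI:
  assumes "((\<lambda>s. y s i) has_real_derivative v) (at t within {0..T})" "t \<in> {0..T}" "0 < T"
  shows "velocity T y i t = v"
  unfolding velocity_def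
  using assms by (intro vector_derivative_within_closed_interval)
    (auto simp: has_real_derivative_iff_has_vector_derivative)

lemma has_derivative_velocity:
  assumes "(\<lambda>s. y s i) differentiable (at t within {0..T})"
  shows "((\<lambda>s. y s i) has_real_derivative velocity T y i t) (at t within {0..T})"
  using assms unfolding velocity_def has_real_derivative_iff_has_vector_derivative
  by (simp add: vector_derivative_works)

section \<open>Minimizers\<close>

locale particle_minimizer = strongly_convex L L' \<theta> for L L' \<theta> +
  fixes G G' :: "real \<Rightarrow> real" and V :: "real \<Rightarrow> real \<Rightarrow> real" and c T :: real and N :: nat
    and p q :: "nat \<Rightarrow> real" and x :: "real \<Rightarrow> nat \<Rightarrow> real"
  assumes G_deriv: "0 < r \<Longrightarrow> (G has_real_derivative G' r) (at r)"
    and G'_cont: "continuous_on {0<..} G'"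
    and L_bdd: "bdd_below (range L)"
    and N_pos: "1 \<le> N" and T_pos: "0 < T"
    and V_const: "t \<in> {0..T} \<Longrightarrow> V y t = c"
    and sol: "is_solution L G V N T p q x"
    and gap_pos: "\<lbrakk>t \<in> {0..T}; i \<in> {1..N}\<rbrakk> \<Longrightarrow> 0 < gap N (x t) i"
begin

section \<open>The interaction energy as a function of the gap\<close>

definition H :: "real \<Rightarrow> real" where "H y = G ((1 / real N) / y)"

definition h :: "real \<Rightarrow> real" where "h y = - G' ((1 / real N) / y) * ((1 / real N) / y\<^sup>2)"

lemma H_deriv: "0 < y \<Longrightarrow> (H has_real_derivative h y) (at y)"
proof -
  assume "0 < y"
  then have "0 < (1 / real N) / y" using N_pos by simp
  moreover have "((\<lambda>y. (1 / real N) / y) has_real_derivative - ((1 / real N) / y\<^sup>2)) (at y)"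
    using \<open>0 < y\<close> N_pos by (auto intro!: derivative_eq_intros simp: power2_eq_square)
  ultimately show ?thesis
    unfolding H_def h_def using DERIV_chain2[OF G_deriv] by fastforce
qed

lemma h_cont: "continuous_on {0<..} h"
  unfolding h_def using N_pos
  by (intro continuous_intros continuous_on_compose2[OF G'_cont]) auto

lemma H_cont: "continuous_on {0<..} H"
  using H_deriv by (intro continuous_at_imp_continuous_on) (auto intro: DERIV_isCont)

lemma admissible: "admissible_path N T p q x"
  using sol by (simp add: is_solution_def)

lemma abs_continuous_x: "i \<in> {1..N} \<Longrightarrow> abs_continuous_on 0 T (\<lambda>s. x s i)"
  using admissible by (simp add: admissible_path_def)

lemma continuous_gap_x: "i \<in> {1..N} \<Longrightarrow> continuous_on {0..T} (\<lambda>s. gap N (x s) i)"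
  using abs_continuous_x by (intro continuous_on_gap abs_continuous_on_imp_continuous_on)

lemma continuous_on_gap_compose:
  assumes "continuous_on {0<..} k" "i \<in> {1..N}"
  shows "continuous_on {0..T} (\<lambda>s. k (gap N (x s) i))"
  using assms gap_pos by (intro continuous_on_compose2[OF assms(1) continuous_gap_x]) auto

section \<open>The action of paths without collisions\<close>

lemma action_integrand:
  assumes "s \<in> {0..T}" "0 < gap N (y s) i"
  shows "ereal (L (velocity T y i s)) + G_term G N (y s) i - ereal (V (y s i) s) =
    ereal (L (velocity T y i s) + H (gap N (y s) i) - c)"
  using assms by (simp add: G_term_def local_density_def H_def V_const)

text \<open>Competitors are controlled through an integrable majorant \<open>b\<close> of their
  integrand, valid off a null set; this is all that a comparison with the minimizer requires of
  them.\<close>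

lemma action_le_integral:
  assumes gap: "\<And>s i. \<lbrakk>s \<in> {0..T}; i \<in> {1..N}\<rbrakk> \<Longrightarrow> 0 < gap N (y s) i" and S: "negligible S"
    and le: "\<And>s i. \<lbrakk>s \<in> {0..T} - S; i \<in> {1..N}\<rbrakk> \<Longrightarrow> L (velocity T y i s) + H (gap N (y s) i) - c \<le> b i s"
    and int: "\<And>i. i \<in> {1..N} \<Longrightarrow> b i absolutely_integrable_on {0..T}"
  shows "action L G V N T y \<le> ereal (1 / real N * (\<Sum>i=1..N. integral {0..T} (b i)))"
proof -
  have "(\<Sum>i=1..N. ext_integral {0..T}
        (\<lambda>s. ereal (L (velocity T y i s)) + G_term G N (y s) i - ereal (V (y s i) s)))
      \<le> (\<Sum>i=1..N. ereal (integral {0..T} (b i)))"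
  proof (rule sum_mono)
    fix i assume i: "i \<in> {1..N}"
    have "ext_integral {0..T} (\<lambda>s. ereal (L (velocity T y i s)) + G_term G N (y s) i - ereal (V (y s i) s))
        \<le> ext_integral {0..T} (\<lambda>s. ereal (b i s))"
    proof (rule ext_integral_mono_ae[OF S])
      fix s assume "s \<in> {0..T} - S"
      then show "ereal (L (velocity T y i s)) + G_term G N (y s) i - ereal (V (y s i) s) \<le> ereal (b i s)"
        using le gap i by (subst action_integrand) auto
    qed
    then show "ext_integral {0..T} (\<lambda>s. ereal (L (velocity T y i s)) + G_term G N (y s) i - ereal (V (y s i) s))
        \<le> ereal (integral {0..T} (b i))"
      using ext_integral_absolutely_integrable[OF int[OF i]] by simp
  qed
  also have "\<dots> = ereal (\<Sum>i=1..N. integral {0..T} (b i))"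
    by (rule sum_ereal)
  finally have "action L G V N T y \<le> ereal (1 / real N) * ereal (\<Sum>i=1..N. integral {0..T} (b i))"
    unfolding action_def by (intro ereal_mult_left_mono) auto
  then show ?thesis by simp
qed

text \<open>The affine path from \<open>p\<close> to \<open>q\<close> is a competitor with constant
  velocities. Its gaps are convex combinations of the positive gaps at the two end times, so its
  interaction energy is continuous in time.\<close>

lemma action_x_finite: "action L G V N T x < \<infinity>"
proof -
  define y where "y s i = (1 - s / T) * p i + s / T * q i" for s i
  have ends: "p j = x 0 j" "q j = x T j" if "j \<in> {1..N}" for j
    using admissible that by (auto simp: admissible_path_def)
  have gp: "0 < gap N p i" "0 < gap N q i" if "i \<in> {1..N}" for i
    using gap_pos[of 0 i] gap_pos[of T i] gap_cong[of N p "x 0" i] gap_cong[of N q "x T" i] ends that T_pos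
    by auto
  have gapy: "0 < gap N (y s) i" if "s \<in> {0..T}" "i \<in> {1..N}" for s i
  proof -
    have "0 \<le> s / T" "s / T \<le> 1" using that T_pos by auto
    have "gap N (y s) i = gap N p i + s / T * (gap N q i - gap N p i)"
      unfolding y_def by (rule gap_convex_combination)
    also have "\<dots> = (1 - s / T) * gap N p i + s / T * gap N q i"
      by (simp add: algebra_simps)
    also have "\<dots> > 0"
      using gp[OF that(2)] \<open>0 \<le> s / T\<close> \<open>s / T \<le> 1\<close> by (intro convex_combination_pos)
    finally show ?thesis .
  qed
  have der: "((\<lambda>s. y s i) has_real_derivative (q i - p i) / T) (at t within A)" for t i A
    unfolding y_def using T_pos by (auto intro!: derivative_eq_intros simp: field_simps)
  have conty: "continuous_on {0..T} (\<lambda>s. y s i)" for i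
    unfolding y_def using T_pos by (intro continuous_intros) auto
  have "admissible_path N T p q y"
    unfolding admissible_path_def
  proof (intro conjI ballI)
    show "abs_continuous_on 0 T (\<lambda>s. y s i)" for i
      using der by (intro has_derivative_imp_abs_continuous_on[where f' = "\<lambda>_. (q i - p i) / T"]) auto
    show "y t \<in> config_space N" if "t \<in> {0..T}" for t
      using gapy[OF that] N_pos by (intro config_spaceI) (auto intro: less_imp_le)
  qed (use T_pos in \<open>auto simp: y_def\<close>)
  then have "action L G V N T x \<le> action L G V N T y"
    using sol by (simp add: is_solution_def)
  also have "\<dots> \<le> ereal (1 / real N * (\<Sum>i=1..N. integral {0..T} (\<lambda>s. L ((q i - p i) / T) + H (gap N (y s) i) - c)))"
  proof (rule action_le_integral[where S = "{}"])
    fix i assume i: "i \<in> {1..N}"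
    have "continuous_on {0..T} (\<lambda>s. H (gap N (y s) i))"
      using gapy i by (intro continuous_on_compose2[OF H_cont continuous_on_gap] conty) auto
    then show "(\<lambda>s. L ((q i - p i) / T) + H (gap N (y s) i) - c) absolutely_integrable_on {0..T}"
      by (intro absolutely_integrable_continuous_real continuous_intros)
  next
    fix s i assume "s \<in> {0..T} - {}" "i \<in> {1..N}"
    then have "velocity T y i s = (q i - p i) / T"
      using der T_pos by (intro velocity_eqI) auto
    then show "L (velocity T y i s) + H (gap N (y s) i) - c \<le> L ((q i - p i) / T) + H (gap N (y s) i) - c"
      by simp
  qed (use gapy in auto)
  also have "\<dots> < \<infinity>" by simp
  finally show ?thesis .
qed

lemma x_differentiable_ae:
  "\<exists>S. negligible S \<and> (\<forall>s\<in>{0..T} - S. \<forall>i\<in>{1..N}.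
    ((\<lambda>s. x s i) has_real_derivative velocity T x i s) (at s within {0..T}))"
proof -
  have "\<forall>i\<in>{1..N}. \<exists>S. negligible S \<and> (\<forall>t\<in>{0..T} - S. (\<lambda>s. x s i) differentiable (at t))"
  proof
    fix i assume "i \<in> {1..N}"
    from abs_continuous_x[OF this]
    show "\<exists>S. negligible S \<and> (\<forall>t\<in>{0..T} - S. (\<lambda>s. x s i) differentiable (at t))"
      by (rule abs_continuous_on_differentiable_ae) blast
  qed
  from bchoice[OF this] obtain S where S: "\<And>i. i \<in> {1..N} \<Longrightarrow> negligible (S i)"
    "\<And>i t. \<lbrakk>i \<in> {1..N}; t \<in> {0..T} - S i\<rbrakk> \<Longrightarrow> (\<lambda>s. x s i) differentiable (at t)" by blast
  show ?thesis
  proof (intro exI[of _ "\<Union>(S ` {1..N})"] conjI ballI)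
    show "negligible (\<Union>(S ` {1..N}))"
      using S(1) by (intro negligible_Union) auto
    fix s i assume *: "s \<in> {0..T} - \<Union>(S ` {1..N})" "i \<in> {1..N}"
    then have "(\<lambda>s. x s i) differentiable (at s)"
      by (intro S(2)) auto
    then show "((\<lambda>s. x s i) has_real_derivative velocity T x i s) (at s within {0..T})"
      by (rule has_derivative_velocity[OF differentiable_at_withinI])
  qed
qed

text \<open>Finiteness of the action passes to each summand once its integrand is measurable and
  bounded below. The velocity is measurable as an integrable derivative, \<open>L\<close> is bounded
  below, and the interaction term is continuous in time.\<close>

lemma integrand_x_integrable:
  assumes i: "i \<in> {1..N}"
  shows "(\<lambda>s. L (velocity T x i s) + H (gap N (x s) i) - c) absolutely_integrable_on {0..T}"
proof -
  obtain S where S: "negligible S" "\<And>s i. \<lbrakk>s \<in> {0..T} - S; i \<in> {1..N}\<rbrakk> \<Longrightarrow>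
    ((\<lambda>s. x s i) has_real_derivative velocity T x i s) (at s within {0..T})"
    using x_differentiable_ae by blast
  have "((velocity T x i) has_integral (x T i - x 0 i)) {0..T}"
    using T_pos S i by (intro abs_continuous_on_has_integral[OF _ abs_continuous_x]) auto
  then have "velocity T x i \<in> borel_measurable (lebesgue_on {0..T})"
    using has_integral_implies_lebesgue_measurable_cbox[of "velocity T x i" _ 0 T] by simp
  then have "(\<lambda>s. L (velocity T x i s)) \<in> borel_measurable (lebesgue_on {0..T})"
    by (rule measurable_compose[OF _ borel_measurable_continuous_onI[OF L_cont]])
  moreover have contH: "continuous_on {0..T} (\<lambda>s. H (gap N (x s) i))"
    using i by (rule continuous_on_gap_compose[OF H_cont])
  moreover from this have "(\<lambda>s. H (gap N (x s) i)) \<in> borel_measurable (lebesgue_on {0..T})"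
    by (intro continuous_imp_measurable_on_sets_lebesgue) auto
  ultimately have meas: "(\<lambda>s. L (velocity T x i s) + H (gap N (x s) i) - c) \<in> borel_measurable (lebesgue_on {0..T})"
    by (intro borel_measurable_diff borel_measurable_add) auto
  obtain M where M: "\<And>s. s \<in> {0..T} \<Longrightarrow> \<bar>H (gap N (x s) i)\<bar> \<le> M"
    using continuous_on_Icc_bounded[OF contH] by blast
  obtain m where m: "\<And>u. m \<le> L u"
    using L_bdd by (auto simp: bdd_below_def)
  have bound: "m - M - c \<le> L (velocity T x i s) + H (gap N (x s) i) - c" if "s \<in> {0..T}" for s
    using M[OF that] m[of "velocity T x i s"] by linarith
  have eq: "ereal (L (velocity T x i s)) + G_term G N (x s) i - ereal (V (x s i) s) =
      ereal (L (velocity T x i s) + H (gap N (x s) i) - c)" if "s \<in> {0..T}" for s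
    using that gap_pos i by (intro action_integrand) auto
  have fin: "ext_integral {0..T} (\<lambda>s. ereal (L (velocity T x i s)) + G_term G N (x s) i - ereal (V (x s i) s)) \<noteq> \<infinity>"
  proof
    assume "ext_integral {0..T} (\<lambda>s. ereal (L (velocity T x i s)) + G_term G N (x s) i - ereal (V (x s i) s)) = \<infinity>"
    \<comment> \<open>A finite sum of extended reals is \<infinity> as soon as one term is, whatever
      the others are.\<close>
    then have "(\<Sum>i=1..N. ext_integral {0..T}
        (\<lambda>s. ereal (L (velocity T x i s)) + G_term G N (x s) i - ereal (V (x s i) s))) = \<infinity>"
      using i by (subst sum_Pinfty) auto
    then have "action L G V N T x = \<infinity>"
      using N_pos by (simp add: action_def)
    then show False using action_x_finite by simp
  qed
  show ?thesis
    by (rule ext_integral_finite_imp_integrable[OF _ meas bound eq fin]) simp_all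
qed

lemma action_x:
  "action L G V N T x =
    ereal (1 / real N * (\<Sum>i=1..N. integral {0..T} (\<lambda>s. L (velocity T x i s) + H (gap N (x s) i) - c)))"
proof -
  have "(\<Sum>i=1..N. ext_integral {0..T}
        (\<lambda>s. ereal (L (velocity T x i s)) + G_term G N (x s) i - ereal (V (x s i) s)))
      = (\<Sum>i=1..N. ereal (integral {0..T} (\<lambda>s. L (velocity T x i s) + H (gap N (x s) i) - c)))"
    by (intro sum.cong refl ext_integral_absolutely_integrable integrand_x_integrable action_integrand)
      (use gap_pos in auto)
  then show ?thesis
    by (simp add: action_def sum_ereal)
qed

lemma L_velocity_integrable:
  assumes i: "i \<in> {1..N}"
  shows "(\<lambda>s. L (velocity T x i s)) absolutely_integrable_on {0..T}"
proof -
  have "continuous_on {0..T} (\<lambda>s. H (gap N (x s) i) - c)"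
    using i by (intro continuous_intros continuous_on_gap_compose[OF H_cont])
  then have "(\<lambda>s. H (gap N (x s) i) - c) absolutely_integrable_on {0..T}"
    by (rule absolutely_integrable_continuous_real)
  from set_integral_diff(1)[OF integrand_x_integrable[OF i] this] show ?thesis
    by (simp add: algebra_simps)
qed

text \<open>The competitor \<open>(1 - \<epsilon>) * x + \<epsilon> * z\<close> is close to
  \<open>x\<close>, so it has positive gaps even if \<open>z\<close> has none. Its action exceeds
  that of \<open>x\<close> by at most \<open>\<epsilon>\<close> times a quantity free of
  \<open>\<epsilon>\<close>, which must therefore be nonnegative; one small
  \<open>\<epsilon>\<close> for each error \<open>\<rho>\<close> is enough.\<close>

lemma first_variation:
  fixes z :: "real \<Rightarrow> nat \<Rightarrow> real" and v :: "nat \<Rightarrow> real \<Rightarrow> real"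
  assumes z_deriv: "\<And>i t. \<lbrakk>i \<in> {1..N}; t \<in> {0..T}\<rbrakk> \<Longrightarrow>
        ((\<lambda>s. z s i) has_real_derivative v i t) (at t within {0..T})"
    and v_cont: "\<And>i. i \<in> {1..N} \<Longrightarrow> continuous_on {0..T} (v i)"
    and z_ends: "\<And>i. i \<in> {1..N} \<Longrightarrow> z 0 i = x 0 i" "\<And>i. i \<in> {1..N} \<Longrightarrow> z T i = x T i"
  shows "(\<Sum>i=1..N. integral {0..T} (\<lambda>s. L (velocity T x i s))) \<le>
    (\<Sum>i=1..N. integral {0..T} (\<lambda>s. L (v i s) + h (gap N (x s) i) * (gap N (z s) i - gap N (x s) i)))"
    (is "?lhs \<le> ?rhs")
proof (rule field_le_epsilon)
  fix e :: real assume "0 < e"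
  \<comment> \<open>Summed over \<open>N\<close> particles and integrated over
    \<open>{0..T}\<close>, this error amounts to exactly \<open>e\<close>.\<close>
  define \<rho> where "\<rho> = e / (real N * T)"
  have "0 < \<rho>" using \<open>0 < e\<close> N_pos T_pos by (simp add: \<rho>_def)
  let ?u = "velocity T x"
  let ?\<gamma> = "\<lambda>i s. gap N (x s) i" and ?\<eta> = "\<lambda>i s. gap N (z s) i - gap N (x s) i"
  have acz: "abs_continuous_on 0 T (\<lambda>s. z s i)" if "i \<in> {1..N}" for i
    using z_deriv[OF that] v_cont[OF that] by (rule has_derivative_imp_abs_continuous_on)
  have \<eta>_cont: "continuous_on {0..T} (?\<eta> i)" if "i \<in> {1..N}" for i
    using that acz by (intro continuous_intros continuous_gap_x continuous_on_gap abs_continuous_on_imp_continuous_on)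
  have "\<forall>i\<in>{1..N}. \<exists>\<epsilon>0>0. \<forall>\<epsilon>\<in>{0<..\<epsilon>0}. \<forall>s\<in>{0..T}. 0 < ?\<gamma> i s + \<epsilon> * ?\<eta> i s \<and>
      H (?\<gamma> i s + \<epsilon> * ?\<eta> i s) - H (?\<gamma> i s) \<le> \<epsilon> * (h (?\<gamma> i s) * ?\<eta> i s + \<rho>)"
  proof
    fix i assume i: "i \<in> {1..N}"
    show "\<exists>\<epsilon>0>0. \<forall>\<epsilon>\<in>{0<..\<epsilon>0}. \<forall>s\<in>{0..T}. 0 < ?\<gamma> i s + \<epsilon> * ?\<eta> i s \<and>
        H (?\<gamma> i s + \<epsilon> * ?\<eta> i s) - H (?\<gamma> i s) \<le> \<epsilon> * (h (?\<gamma> i s) * ?\<eta> i s + \<rho>)"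
      using i gap_pos T_pos
      by (intro uniform_increment_le[OF continuous_gap_x \<eta>_cont _ _ H_deriv h_cont \<open>0 < \<rho>\<close>]) auto
  qed
  from bchoice[OF this] obtain \<epsilon>0 where \<epsilon>0: "\<And>i. i \<in> {1..N} \<Longrightarrow> 0 < \<epsilon>0 i"
    "\<And>i \<epsilon> s. \<lbrakk>i \<in> {1..N}; 0 < \<epsilon>; \<epsilon> \<le> \<epsilon>0 i; s \<in> {0..T}\<rbrakk> \<Longrightarrow> 0 < ?\<gamma> i s + \<epsilon> * ?\<eta> i s \<and>
      H (?\<gamma> i s + \<epsilon> * ?\<eta> i s) - H (?\<gamma> i s) \<le> \<epsilon> * (h (?\<gamma> i s) * ?\<eta> i s + \<rho>)"
    by (metis greaterThanAtMost_iff)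
  \<comment> \<open>One \<open>\<epsilon>\<close> serves all particles; the inserted 1 keeps the
    weights nonnegative, as \<open>L_convex\<close> requires.\<close>
  define \<epsilon> where "\<epsilon> = Min (insert 1 (\<epsilon>0 ` {1..N}))"
  have \<epsilon>: "0 < \<epsilon>" "\<epsilon> \<le> 1" "\<And>i. i \<in> {1..N} \<Longrightarrow> \<epsilon> \<le> \<epsilon>0 i"
    unfolding \<epsilon>_def using \<epsilon>0(1) by (auto intro: Min_le simp del: Min_insert)
  define y where "y s i = (1 - \<epsilon>) * x s i + \<epsilon> * z s i" for s i
  have gapy: "gap N (y s) i = ?\<gamma> i s + \<epsilon> * ?\<eta> i s" for s i
    unfolding y_def by (rule gap_convex_combination)
  have gapy_pos: "0 < gap N (y s) i" if "s \<in> {0..T}" "i \<in> {1..N}" for s i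
    unfolding gapy using \<epsilon>0(2)[of i \<epsilon> s] \<epsilon> that by blast
  obtain S where S: "negligible S" "\<And>s i. \<lbrakk>s \<in> {0..T} - S; i \<in> {1..N}\<rbrakk> \<Longrightarrow>
    ((\<lambda>s. x s i) has_real_derivative ?u i s) (at s within {0..T})"
    using x_differentiable_ae by blast
  \<comment> \<open>\<open>\<epsilon> * ?d i s\<close> will dominate the change of the integrand
    from \<open>x\<close> to \<open>y\<close>: the kinetic part by convexity, the interaction by its
    first order expansion with error \<open>\<rho>\<close>.\<close>
  let ?d = "\<lambda>i s. L (v i s) + h (?\<gamma> i s) * ?\<eta> i s - L (?u i s) + \<rho>"
  let ?I = "\<lambda>i s. L (?u i s) + H (?\<gamma> i s) - c"
  have cont_rhs: "continuous_on {0..T} (\<lambda>s. L (v i s) + h (?\<gamma> i s) * ?\<eta> i s)" if i: "i \<in> {1..N}" for i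
  proof -
    from continuous_on_compose2[OF L_cont v_cont[OF i]] have "continuous_on {0..T} (\<lambda>s. L (v i s))"
      by simp
    then show ?thesis
      using continuous_on_gap_compose[OF h_cont i] \<eta>_cont[OF i] by (intro continuous_on_add continuous_on_mult)
  qed
  have int_d: "?d i absolutely_integrable_on {0..T}" if i: "i \<in> {1..N}" for i
  proof -
    have "(\<lambda>s. (L (v i s) + h (?\<gamma> i s) * ?\<eta> i s) + \<rho>) absolutely_integrable_on {0..T}"
      by (intro absolutely_integrable_continuous_real continuous_on_add cont_rhs i continuous_on_const)
    from set_integral_diff(1)[OF this L_velocity_integrable[OF i]] show ?thesis
      by (simp add: algebra_simps)
  qed
  have int_b: "(\<lambda>s. ?I i s + \<epsilon> * ?d i s) absolutely_integrable_on {0..T}" if i: "i \<in> {1..N}" for i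
    using i by (intro set_integral_add(1) integrand_x_integrable set_integrable_mult_right impI int_d)
  have "admissible_path N T p q y"
    unfolding admissible_path_def
  proof (intro conjI ballI)
    fix i assume i: "i \<in> {1..N}"
    show "abs_continuous_on 0 T (\<lambda>s. y s i)"
      unfolding y_def using i
      by (intro abs_continuous_on_add abs_continuous_on_mult abs_continuous_on_const abs_continuous_x acz)
    show "y 0 i = p i" "y T i = q i"
      using admissible i z_ends[OF i] by (auto simp: y_def admissible_path_def algebra_simps)
  next
    fix t assume "t \<in> {0..T}"
    then show "y t \<in> config_space N"
      using gapy_pos N_pos by (intro config_spaceI) (auto intro: less_imp_le)
  qed
  then have "action L G V N T x \<le> action L G V N T y"
    using sol by (simp add: is_solution_def)
  also have "\<dots> \<le> ereal (1 / real N * (\<Sum>i=1..N. integral {0..T} (\<lambda>s. ?I i s + \<epsilon> * ?d i s)))"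
  proof (rule action_le_integral[OF gapy_pos S(1) _ int_b])
    fix s i assume s: "s \<in> {0..T} - S" and i: "i \<in> {1..N}"
    have "((\<lambda>s. y s i) has_real_derivative (1 - \<epsilon>) * ?u i s + \<epsilon> * v i s) (at s within {0..T})"
      unfolding y_def using S(2)[OF s i] z_deriv[OF i, of s] s by (auto intro!: derivative_eq_intros)
    then have vel: "velocity T y i s = (1 - \<epsilon>) * ?u i s + \<epsilon> * v i s"
      using s T_pos by (intro velocity_eqI) auto
    have "L (velocity T y i s) \<le> (1 - \<epsilon>) * L (?u i s) + \<epsilon> * L (v i s)"
      unfolding vel using \<epsilon> by (intro L_convex) auto
    moreover have "H (gap N (y s) i) \<le> H (?\<gamma> i s) + \<epsilon> * (h (?\<gamma> i s) * ?\<eta> i s + \<rho>)"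
      unfolding gapy using \<epsilon>0(2)[of i \<epsilon> s] \<epsilon> s i by auto
    ultimately show "L (velocity T y i s) + H (gap N (y s) i) - c \<le> ?I i s + \<epsilon> * ?d i s"
      by (simp add: algebra_simps)
  qed
  \<comment> \<open>By \<open>action_x\<close> the action of \<open>x\<close> is a real number, so
    its integrals can be cancelled from both sides below.\<close>
  finally have "1 / real N * (\<Sum>i=1..N. integral {0..T} (?I i)) \<le>
      1 / real N * (\<Sum>i=1..N. integral {0..T} (\<lambda>s. ?I i s + \<epsilon> * ?d i s))"
    unfolding action_x by simp
  then have "(\<Sum>i=1..N. integral {0..T} (?I i)) \<le> (\<Sum>i=1..N. integral {0..T} (\<lambda>s. ?I i s + \<epsilon> * ?d i s))"
    using N_pos by (simp add: divide_le_cancel)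
  also have "\<dots> = (\<Sum>i=1..N. integral {0..T} (?I i) + \<epsilon> * integral {0..T} (?d i))"
  proof (rule sum.cong[OF refl])
    fix i assume i: "i \<in> {1..N}"
    have "?I i integrable_on {0..T}" "?d i integrable_on {0..T}"
      by (rule set_lebesgue_integral_eq_integral(1)[OF integrand_x_integrable[OF i]],
          rule set_lebesgue_integral_eq_integral(1)[OF int_d[OF i]])
    moreover from this(2) have "(\<lambda>s. \<epsilon> * ?d i s) integrable_on {0..T}"
      by (rule integrable_on_mult_right)
    ultimately show "integral {0..T} (\<lambda>s. ?I i s + \<epsilon> * ?d i s) = integral {0..T} (?I i) + \<epsilon> * integral {0..T} (?d i)"
      by (subst Henstock_Kurzweil_Integration.integral_add) (simp_all only: integral_mult_right)
  qed
  also have "\<dots> = (\<Sum>i=1..N. integral {0..T} (?I i)) + \<epsilon> * (\<Sum>i=1..N. integral {0..T} (?d i))"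
    by (simp add: sum.distrib sum_distrib_left)
  finally have "0 \<le> \<epsilon> * (\<Sum>i=1..N. integral {0..T} (?d i))" by simp
  then have "0 \<le> (\<Sum>i=1..N. integral {0..T} (?d i))"
    using \<open>0 < \<epsilon>\<close> by (simp add: zero_le_mult_iff)
  also have "\<dots> = (\<Sum>i=1..N. integral {0..T} (\<lambda>s. L (v i s) + h (?\<gamma> i s) * ?\<eta> i s)
      - integral {0..T} (\<lambda>s. L (?u i s)) + \<rho> * T)"
  proof (rule sum.cong[OF refl])
    fix i assume i: "i \<in> {1..N}"
    have 1: "((\<lambda>s. L (v i s) + h (?\<gamma> i s) * ?\<eta> i s) has_integral
        integral {0..T} (\<lambda>s. L (v i s) + h (?\<gamma> i s) * ?\<eta> i s)) {0..T}"
      by (intro integrable_integral integrable_continuous_real cont_rhs i)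
    have 2: "((\<lambda>s. L (?u i s)) has_integral integral {0..T} (\<lambda>s. L (?u i s))) {0..T}"
      by (intro integrable_integral set_lebesgue_integral_eq_integral(1)[OF L_velocity_integrable[OF i]])
    have 3: "((\<lambda>s. \<rho>) has_integral \<rho> * T) {0..T}"
      using has_integral_const_real[of \<rho> 0 T] T_pos by (simp add: mult.commute)
    show "integral {0..T} (?d i) = integral {0..T} (\<lambda>s. L (v i s) + h (?\<gamma> i s) * ?\<eta> i s)
      - integral {0..T} (\<lambda>s. L (?u i s)) + \<rho> * T"
      by (rule integral_unique) (intro has_integral_add has_integral_diff 1 2 3)
  qed
  also have "\<dots> = ?rhs - ?lhs + real N * (\<rho> * T)"
    by (simp add: sum.distrib sum_subtractf)
  also have "real N * (\<rho> * T) = e"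
    using N_pos T_pos by (simp add: \<rho>_def)
  finally show "?lhs \<le> ?rhs + e" by simp
qed

text \<open>Position \<open>i\<close> enters its own gap with a plus sign and the gap of its
  successor with a minus sign. By the Euler-Lagrange equation this is the rate of change of the
  momentum.\<close>

definition force :: "nat \<Rightarrow> real \<Rightarrow> real" where
  "force i t = h (gap N (x t) i) - h (gap N (x t) (cyclic_succ N i))"

lemma continuous_force: "i \<in> {1..N} \<Longrightarrow> continuous_on {0..T} (force i)"
  unfolding force_def using cyclic_succ_mem[of i N]
  by (intro continuous_on_diff continuous_on_gap_compose[OF h_cont]) auto

text \<open>The force is frozen along the minimizer, so the problem for \<open>z\<close> is not coupled to \<open>z\<close> itself.\<close>

lemma boundary_value_problem:
  assumes i: "i \<in> {1..N}"
  shows "\<exists>w z. z 0 = x 0 i \<and> z T = x T i \<and>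
    (\<forall>t\<in>{0..T}. (w has_real_derivative force i t) (at t within {0..T}) \<and>
       (z has_real_derivative \<Lambda> (w t)) (at t within {0..T}))"
proof -
  define \<Phi> where "\<Phi> t = integral {0..t} (force i)" for t
  have \<Phi>_deriv: "(\<Phi> has_real_derivative force i t) (at t within {0..T})" if "t \<in> {0..T}" for t
    unfolding \<Phi>_def using continuous_force[OF i] that by (rule integral_has_real_derivative)
  then have \<Phi>_cont: "continuous_on {0..T} \<Phi>"
    by (rule DERIV_continuous_on)
  \<comment> \<open>\<open>\<Phi>\<close> vanishes at time 0, so \<open>k\<close> is the initial
    momentum; it is fixed by matching the total displacement of particle \<open>i\<close>.\<close>
  obtain k where k: "integral {0..T} (\<lambda>t. \<Lambda> (k + \<Phi> t)) = x T i - x 0 i"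
    using shooting[OF \<Phi>_cont T_pos] by blast
  define w where "w t = k + \<Phi> t" for t
  define z where "z t = x 0 i + integral {0..t} (\<lambda>t. \<Lambda> (w t))" for t
  have w_deriv: "(w has_real_derivative force i t) (at t within {0..T})" if "t \<in> {0..T}" for t
    unfolding w_def using \<Phi>_deriv[OF that] by (auto intro!: derivative_eq_intros)
  have "continuous_on {0..T} (\<lambda>t. \<Lambda> (w t))"
    using DERIV_continuous_on[OF w_deriv] by (intro continuous_on_compose2[OF continuous_on_\<Lambda>]) auto
  then have z_deriv: "(z has_real_derivative \<Lambda> (w t)) (at t within {0..T})" if "t \<in> {0..T}" for t
    unfolding z_def using integral_has_real_derivative[OF _ that, of "\<lambda>t. \<Lambda> (w t)"]
    by (auto intro!: derivative_eq_intros)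
  have "z 0 = x 0 i" "z T = x T i"
    using k by (simp_all add: z_def w_def)
  with w_deriv z_deriv show ?thesis by blast
qed

theorem euler_lagrange:
  "\<exists>w. \<forall>i\<in>{1..N}. \<forall>t\<in>{0..T}. (w i has_real_derivative force i t) (at t within {0..T}) \<and>
     ((\<lambda>s. x s i) has_real_derivative \<Lambda> (w i t)) (at t within {0..T})"
proof -
  have "\<forall>i\<in>{1..N}. \<exists>wz. snd wz 0 = x 0 i \<and> snd wz T = x T i \<and>
    (\<forall>t\<in>{0..T}. (fst wz has_real_derivative force i t) (at t within {0..T}) \<and>
       (snd wz has_real_derivative \<Lambda> (fst wz t)) (at t within {0..T}))"
    using boundary_value_problem by simp
  from bchoice[OF this] obtain wz where wz: "\<And>i. i \<in> {1..N} \<Longrightarrow> snd (wz i) 0 = x 0 i \<and> snd (wz i) T = x T i \<and>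
    (\<forall>t\<in>{0..T}. (fst (wz i) has_real_derivative force i t) (at t within {0..T}) \<and>
       (snd (wz i) has_real_derivative \<Lambda> (fst (wz i) t)) (at t within {0..T}))"
    by blast
  define w where "w i = fst (wz i)" for i
  define z where "z t i = snd (wz i) t" for t i
  have w_deriv: "(w i has_real_derivative force i t) (at t within {0..T})"
    and z_deriv: "((\<lambda>s. z s i) has_real_derivative \<Lambda> (w i t)) (at t within {0..T})"
    if "i \<in> {1..N}" "t \<in> {0..T}" for i t
    using wz[OF that(1)] that(2) by (auto simp: w_def z_def)
  have z_ends: "z 0 i = x 0 i" "z T i = x T i" if "i \<in> {1..N}" for i
    using wz[OF that] by (auto simp: z_def)
  let ?u = "velocity T x" and ?v = "\<lambda>i s. \<Lambda> (w i s)"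
  have w_cont: "continuous_on {0..T} (w i)" if "i \<in> {1..N}" for i
    using w_deriv[OF that] by (rule DERIV_continuous_on)
  have v_cont: "continuous_on {0..T} (?v i)" if "i \<in> {1..N}" for i
    using w_cont[OF that] by (intro continuous_on_compose2[OF continuous_on_\<Lambda>]) auto
  have acz: "abs_continuous_on 0 T (\<lambda>s. z s i)" if "i \<in> {1..N}" for i
    using z_deriv[OF that] v_cont[OF that] by (rule has_derivative_imp_abs_continuous_on)
  have acw: "abs_continuous_on 0 T (w i)" if "i \<in> {1..N}" for i
    using w_deriv[OF that] continuous_force[OF that] by (rule has_derivative_imp_abs_continuous_on)
  obtain S where S: "negligible S" "\<And>s i. \<lbrakk>s \<in> {0..T} - S; i \<in> {1..N}\<rbrakk> \<Longrightarrow>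
    ((\<lambda>s. x s i) has_real_derivative ?u i s) (at s within {0..T})"
    using x_differentiable_ae by blast
  \<comment> \<open>Integration by parts: \<open>?P\<close> is absolutely continuous and vanishes at
    both end times, so its derivative has integral zero.\<close>
  let ?P = "\<lambda>s. \<Sum>i=1..N. w i s * (x s i - z s i)"
  let ?P' = "\<lambda>s. \<Sum>i=1..N. force i s * (x s i - z s i) + w i s * (?u i s - ?v i s)"
  have "(?P' has_integral (?P T - ?P 0)) {0..T}"
  proof (rule abs_continuous_on_has_integral[OF _ _ S(1)])
    show "abs_continuous_on 0 T ?P"
      by (intro abs_continuous_on_sum abs_continuous_on_mult abs_continuous_on_diff acw abs_continuous_x acz)
    show "(?P has_real_derivative ?P' s) (at s within {0..T})" if s: "s \<in> {0..T} - S" for s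
    proof (rule DERIV_sum)
      fix i assume i: "i \<in> {1..N}"
      then show "((\<lambda>s. w i s * (x s i - z s i)) has_real_derivative
          force i s * (x s i - z s i) + w i s * (?u i s - ?v i s)) (at s within {0..T})"
        using DERIV_mult[OF w_deriv[of i s] DERIV_diff[OF S(2)[OF s i] z_deriv[of i s]]] s
        by (simp add: add.commute mult.commute)
    qed
  qed (use T_pos in simp)
  moreover have "?P T = 0" "?P 0 = 0"
    using z_ends by simp_all
  ultimately have P': "(?P' has_integral 0) {0..T}" by simp
  \<comment> \<open>These are the two sides of \<open>first_variation\<close> as integrands. In
    \<open>?B\<close> the sum over gaps has become a sum over particles, so that its force term
    matches the one in \<open>?P'\<close>.\<close>
  let ?A = "\<lambda>s. \<Sum>i=1..N. L (?u i s)" and ?B = "\<lambda>s. \<Sum>i=1..N. L (?v i s) - force i s * (x s i - z s i)"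
  have intA: "(?A has_integral (\<Sum>i=1..N. integral {0..T} (\<lambda>s. L (?u i s)))) {0..T}"
    by (intro has_integral_sum integrable_integral set_lebesgue_integral_eq_integral(1)[OF L_velocity_integrable]) auto
  have intB: "(?B has_integral (\<Sum>i=1..N. integral {0..T}
      (\<lambda>s. L (?v i s) + h (gap N (x s) i) * (gap N (z s) i - gap N (x s) i)))) {0..T}"
  proof -
    have "((\<lambda>s. \<Sum>i=1..N. L (?v i s) + h (gap N (x s) i) * (gap N (z s) i - gap N (x s) i)) has_integral
      (\<Sum>i=1..N. integral {0..T} (\<lambda>s. L (?v i s) + h (gap N (x s) i) * (gap N (z s) i - gap N (x s) i)))) {0..T}"
    proof (intro has_integral_sum integrable_integral integrable_continuous_real continuous_on_add continuous_on_mult)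
      fix i assume i: "i \<in> {1..N}"
      from continuous_on_compose2[OF L_cont v_cont[OF i]] show "continuous_on {0..T} (\<lambda>s. L (?v i s))"
        by simp
      show "continuous_on {0..T} (\<lambda>s. h (gap N (x s) i))"
        by (rule continuous_on_gap_compose[OF h_cont i])
      show "continuous_on {0..T} (\<lambda>s. gap N (z s) i - gap N (x s) i)"
        using acz i by (intro continuous_intros continuous_gap_x continuous_on_gap abs_continuous_on_imp_continuous_on)
    qed simp
    moreover have "(\<Sum>i=1..N. L (?v i s) + h (gap N (x s) i) * (gap N (z s) i - gap N (x s) i)) = ?B s" for s
    proof -
      have "(\<Sum>i=1..N. h (gap N (x s) i) * (gap N (z s) i - gap N (x s) i)) = (\<Sum>i=1..N. force i s * (z s i - x s i))"
        unfolding gap_diff force_def by (rule sum_cyclic_by_parts[where b = "\<lambda>i. z s i - x s i"])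
      also have "\<dots> = (\<Sum>i=1..N. - (force i s * (x s i - z s i)))"
        by (intro sum.cong) (simp_all add: algebra_simps)
      finally show ?thesis by (simp add: sum.distrib sum_subtractf sum_negf)
    qed
    ultimately show ?thesis by simp
  qed
  \<comment> \<open>The force terms cancel. As \<open>L'\<close> of \<open>?v i s\<close> is
    \<open>w i s\<close>, what remains is the excess of \<open>L\<close> over its tangents:
    pointwise nonnegative, yet with nonpositive integral.\<close>
  let ?D = "\<lambda>s. ?A s - ?B s - ?P' s"
  have D: "?D s = (\<Sum>i=1..N. L (?u i s) - L (?v i s) - w i s * (?u i s - ?v i s))" for s
    by (simp add: sum.distrib sum_subtractf)
  have D_ge: "\<theta> * (?u i s - ?v i s)\<^sup>2 \<le> L (?u i s) - L (?v i s) - w i s * (?u i s - ?v i s)" for i s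
    using L_above_tangent[of "?v i s" "?u i s"] by simp
  have D_nonneg: "0 \<le> L (?u i s) - L (?v i s) - w i s * (?u i s - ?v i s)" for i s
    using D_ge[of i s] \<theta>_pos by (meson less_imp_le mult_nonneg_nonneg order_trans zero_le_power2)
  have "negligible {s \<in> {0..T}. ?D s \<noteq> 0}"
  proof (rule nonpos_integral_imp_ae_zero[OF has_integral_diff[OF has_integral_diff[OF intA intB] P'] _ negligible_empty])
    show "0 \<le> ?D s" for s
      unfolding D by (intro sum_nonneg D_nonneg)
    show "(\<Sum>i=1..N. integral {0..T} (\<lambda>s. L (?u i s))) - (\<Sum>i=1..N. integral {0..T}
      (\<lambda>s. L (?v i s) + h (gap N (x s) i) * (gap N (z s) i - gap N (x s) i))) - 0 \<le> 0"
      using first_variation[of z ?v] z_deriv v_cont z_ends by simp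
  qed
  then have neg: "negligible (S \<union> {s \<in> {0..T}. ?D s \<noteq> 0})"
    using S(1) by (intro negligible_Un)
  have "x t i = z t i" if i: "i \<in> {1..N}" and t: "t \<in> {0..T}" for i t
  proof -
    \<comment> \<open>Equal velocities almost everywhere give equal paths, because the difference is
      absolutely continuous and vanishes at time 0.\<close>
    have "((\<lambda>_. 0) has_integral ((x t i - z t i) - (x 0 i - z 0 i))) {0..t}"
    proof (rule abs_continuous_on_has_integral[OF _ _ neg])
      have "abs_continuous_on 0 T (\<lambda>s. x s i - z s i)"
        using i by (intro abs_continuous_on_diff abs_continuous_x acz)
      then show "abs_continuous_on 0 t (\<lambda>s. x s i - z s i)"
        by (rule abs_continuous_on_subinterval) (use t in auto)
      fix s assume s: "s \<in> {0..t} - (S \<union> {s \<in> {0..T}. ?D s \<noteq> 0})"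
      then have "s \<in> {0..T} - S" "?D s = 0" using t by auto
      then have "L (?u i s) - L (?v i s) - w i s * (?u i s - ?v i s) = 0"
        unfolding D using sum_nonneg_0[of "{1..N}" "\<lambda>i. L (?u i s) - L (?v i s) - w i s * (?u i s - ?v i s)" i] D_nonneg i
        by auto
      then have "\<theta> * (?u i s - ?v i s)\<^sup>2 \<le> 0"
        using D_ge[of i s] by simp
      then have "?u i s = ?v i s"
        using \<theta>_pos by (simp add: mult_le_0_iff)
      then have "((\<lambda>s. x s i - z s i) has_real_derivative 0) (at s within {0..T})"
        using DERIV_diff[OF S(2)[OF \<open>s \<in> {0..T} - S\<close> i] z_deriv[OF i, of s]] \<open>s \<in> {0..T} - S\<close> by simp
      then show "((\<lambda>s. x s i - z s i) has_real_derivative 0) (at s within {0..t})"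
        by (rule DERIV_subset) (use t in auto)
    qed (use t in simp)
    then have "(x t i - z t i) - (x 0 i - z 0 i) = 0"
      using has_integral_unique[OF has_integral_0] by metis
    then show ?thesis using z_ends(1)[OF i] by simp
  qed
  \<comment> \<open>Being equal to \<open>z\<close> throughout, \<open>x\<close> inherits its
    derivative at every time, including the end points and the points of \<open>S\<close>.\<close>
  then have "((\<lambda>s. x s i) has_real_derivative ?v i t) (at t within {0..T})"
    if "i \<in> {1..N}" "t \<in> {0..T}" for i t
    using has_field_derivative_transform_within[OF z_deriv[OF that] zero_less_one that(2), of "\<lambda>s. x s i"] that by simp
  with w_deriv show ?thesis by blast
qed

text \<open>This cancellation turns the weighted sums of the conservation laws into plain averages
  over the particles, of the momentum and of the energy.\<close>

lemma local_density_gap: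
  "\<lbrakk>t \<in> {0..T}; i \<in> {1..N}\<rbrakk> \<Longrightarrow> local_density N (x t) i * (x t i - pred_pos N (x t) i) = 1 / real N"
  using gap_pos[of t i] by (simp add: local_density_def gap_def)

theorem differentiable_and_conservation:
  "(\<forall>i\<in>{1..N}. \<forall>t\<in>{0..T}. (\<lambda>s. x s i) differentiable (at t within {0..T})) \<and>
    (\<forall>E\<in>{\<lambda>u R. L' u * R, \<lambda>u R. (L' u * u - L u - G R) * R}. \<forall>t\<in>{0..T}.
       ((\<lambda>s. \<Sum>i=1..N. E (velocity T x i s) (local_density N (x s) i)
                          * (x s i - pred_pos N (x s) i))
          has_real_derivative 0) (at t within {0..T}))"
proof -
  obtain w where w_deriv: "\<And>i t. \<lbrakk>i \<in> {1..N}; t \<in> {0..T}\<rbrakk> \<Longrightarrow> (w i has_real_derivative force i t) (at t within {0..T})"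
    and x_deriv: "\<And>i t. \<lbrakk>i \<in> {1..N}; t \<in> {0..T}\<rbrakk> \<Longrightarrow>
       ((\<lambda>s. x s i) has_real_derivative \<Lambda> (w i t)) (at t within {0..T})"
    using euler_lagrange by blast
  have vel: "velocity T x i t = \<Lambda> (w i t)" if "i \<in> {1..N}" "t \<in> {0..T}" for i t
    using x_deriv[OF that] that(2) T_pos by (rule velocity_eqI)
  have momentum: "((\<lambda>s. \<Sum>i=1..N. L' (velocity T x i s) * local_density N (x s) i * (x s i - pred_pos N (x s) i))
      has_real_derivative 0) (at t within {0..T})" if t: "t \<in> {0..T}" for t
  proof -
    \<comment> \<open>Summation by parts against the constant 1, whose cyclic differences
      vanish.\<close>
    have "(\<Sum>i=1..N. force i t) = 0"
      using sum_cyclic_by_parts[where N = N and a = "\<lambda>i. h (gap N (x t) i)" and b = "\<lambda>_. 1"]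
      by (simp add: force_def)
    then have "(\<Sum>i=1..N. force i t * (1 / real N)) = 0"
      by (simp flip: sum_divide_distrib)
    moreover have "((\<lambda>s. \<Sum>i=1..N. w i s * (1 / real N)) has_real_derivative
        (\<Sum>i=1..N. force i t * (1 / real N))) (at t within {0..T})"
      by (intro DERIV_sum DERIV_cmult_right w_deriv t)
    ultimately have "((\<lambda>s. \<Sum>i=1..N. w i s * (1 / real N)) has_real_derivative 0) (at t within {0..T})"
      by simp
    then show ?thesis
    proof (rule has_field_derivative_transform_within[OF _ zero_less_one t])
      fix s assume s: "s \<in> {0..T}"
      show "(\<Sum>i=1..N. w i s * (1 / real N)) =
          (\<Sum>i=1..N. L' (velocity T x i s) * local_density N (x s) i * (x s i - pred_pos N (x s) i))"
      proof (rule sum.cong[OF refl])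
        fix i assume i: "i \<in> {1..N}"
        show "w i s * (1 / real N) =
            L' (velocity T x i s) * local_density N (x s) i * (x s i - pred_pos N (x s) i)"
          by (simp only: mult.assoc local_density_gap[OF s i] vel[OF i s] L'_\<Lambda>)
      qed
    qed
  qed
  have energy: "((\<lambda>s. \<Sum>i=1..N. (L' (velocity T x i s) * velocity T x i s - L (velocity T x i s)
        - G (local_density N (x s) i)) * local_density N (x s) i * (x s i - pred_pos N (x s) i))
      has_real_derivative 0) (at t within {0..T})" if t: "t \<in> {0..T}" for t
  proof -
    \<comment> \<open>The kinetic part of the energy as a function of the momentum; its rate of
      change in time is force times velocity.\<close>
    let ?K = "\<lambda>w. w * \<Lambda> w - L (\<Lambda> w)"
    let ?gap' = "\<lambda>i. \<Lambda> (w i t) - \<Lambda> (w (cyclic_pred N i) t)"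
    \<comment> \<open>The power of the forces equals the rate of change of the interaction energy;
      this balance keeps the difference of the two parts constant.\<close>
    have "(\<Sum>i=1..N. h (gap N (x t) i) * ?gap' i) = (\<Sum>i=1..N. force i t * \<Lambda> (w i t))"
      unfolding force_def by (rule sum_cyclic_by_parts[where b = "\<lambda>i. \<Lambda> (w i t)"])
    then have "(\<Sum>i=1..N. (force i t * \<Lambda> (w i t) - h (gap N (x t) i) * ?gap' i) * (1 / real N)) = 0"
      by (simp add: sum_subtractf flip: sum_divide_distrib)
    moreover have "((\<lambda>s. \<Sum>i=1..N. (?K (w i s) - H (gap N (x s) i)) * (1 / real N)) has_real_derivative
        (\<Sum>i=1..N. (force i t * \<Lambda> (w i t) - h (gap N (x t) i) * ?gap' i) * (1 / real N))) (at t within {0..T})"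
    proof (intro DERIV_sum DERIV_cmult_right DERIV_diff)
      fix i assume i: "i \<in> {1..N}"
      show "((\<lambda>s. ?K (w i s)) has_real_derivative force i t * \<Lambda> (w i t)) (at t within {0..T})"
        using DERIV_chain2[OF legendre_has_derivative w_deriv[OF i t]] by (simp add: mult.commute)
      have "((\<lambda>s. gap N (x s) i) has_real_derivative ?gap' i) (at t within {0..T})"
        unfolding gap_eq using x_deriv[OF i t] x_deriv[OF cyclic_pred_mem[OF i] t]
        by (auto intro!: derivative_eq_intros)
      then show "((\<lambda>s. H (gap N (x s) i)) has_real_derivative h (gap N (x t) i) * ?gap' i) (at t within {0..T})"
        by (rule DERIV_chain2[where f = H and g = "\<lambda>s. gap N (x s) i" and x = t, OF H_deriv[OF gap_pos[OF t i]]])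
    qed
    ultimately have "((\<lambda>s. \<Sum>i=1..N. (?K (w i s) - H (gap N (x s) i)) * (1 / real N)) has_real_derivative 0) (at t within {0..T})"
      by simp
    then show ?thesis
    proof (rule has_field_derivative_transform_within[OF _ zero_less_one t])
      fix s assume s: "s \<in> {0..T}"
      show "(\<Sum>i=1..N. (?K (w i s) - H (gap N (x s) i)) * (1 / real N)) =
          (\<Sum>i=1..N. (L' (velocity T x i s) * velocity T x i s - L (velocity T x i s)
            - G (local_density N (x s) i)) * local_density N (x s) i * (x s i - pred_pos N (x s) i))"
      proof (rule sum.cong[OF refl])
        fix i assume i: "i \<in> {1..N}"
        have "H (gap N (x s) i) = G (local_density N (x s) i)"
          by (simp add: H_def local_density_def)
        then show "(?K (w i s) - H (gap N (x s) i)) * (1 / real N) =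
          (L' (velocity T x i s) * velocity T x i s - L (velocity T x i s)
            - G (local_density N (x s) i)) * local_density N (x s) i * (x s i - pred_pos N (x s) i)"
          by (simp only: mult.assoc local_density_gap[OF s i] vel[OF i s] L'_\<Lambda>)
      qed
    qed
  qed
  have "(\<lambda>s. x s i) differentiable (at t within {0..T})" if "i \<in> {1..N}" "t \<in> {0..T}" for i t
    using x_deriv[OF that] by (auto simp: real_differentiable_def)
  with momentum energy show ?thesis by simp
qed

end

text \<open>Differentiability is asserted together with the conservation laws because only then is
  \<open>velocity\<close> the actual derivative of the path. At the end times all derivatives are
  one-sided.\<close>

theorem mainTheorem4:
  fixes g g' G L L' :: "real \<Rightarrow> real"
    and V :: "real \<Rightarrow> real \<Rightarrow> real"
    and N :: nat and T :: real
    and p q :: "nat \<Rightarrow> real"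
    and x :: "real \<Rightarrow> nat \<Rightarrow> real"
  assumes g_C1: "C1_deriv_on g g' {0..}"
    and g_mono: "mono_on {0..} g"
    and g_int: "\<exists>\<delta>>0. set_integrable lborel {0<..<\<delta>} (\<lambda>r. r * g' r)"
    and G_C1: "C1_deriv_on G (\<lambda>r. 1 / r\<^sup>2 * (LBINT s:{0..r}. s * g' s)) {0<..}"
    and G_convex: "convex_on {0<..} G"
    and L_C1: "C1_deriv_on L L' UNIV"
    and L_C2: "\<exists>L''. C1_deriv_on L' L'' UNIV"
    and L_bdd: "bdd_below (range L)"
    and L_uconvex: "uniformly_convex L"
    and N_pos: "N \<ge> 1"
    and T_pos: "T > 0"
    and V_const: "\<exists>c. \<forall>y. \<forall>t\<in>{0..T}. V y t = c"
    and p_config: "p \<in> config_space N"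
    and q_config: "q \<in> config_space N"
    and sol: "is_solution L G V N T p q x"
    and no_collision: "\<forall>t\<in>{0..T}. \<forall>i\<in>{1..N}. pred_pos N (x t) i < x t i"
  shows "(\<forall>i\<in>{1..N}. \<forall>t\<in>{0..T}. (\<lambda>s. x s i) differentiable (at t within {0..T})) \<and>
    (\<forall>E\<in>{\<lambda>u R. L' u * R, \<lambda>u R. (L' u * u - L u - G R) * R}. \<forall>t\<in>{0..T}.
       ((\<lambda>s. \<Sum>i=1..N. E (velocity T x i s) (local_density N (x s) i)
                          * (x s i - pred_pos N (x s) i))
          has_real_derivative 0) (at t within {0..T}))"
proof -
  obtain \<theta> where convex: "strongly_convex L L' \<theta>"
    using uniformly_convex_imp_strongly_convex[OF L_C1 L_uconvex] .
  obtain c where c: "\<And>y t. t \<in> {0..T} \<Longrightarrow> V y t = c"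
    using V_const by blast
  have gap: "0 < gap N (x t) i" if "t \<in> {0..T}" "i \<in> {1..N}" for t i
    using no_collision that by (simp add: gap_def)
  let ?G' = "\<lambda>r. 1 / r\<^sup>2 * (LBINT s:{0..r}. s * g' s)"
  have G: "(G has_real_derivative ?G' r) (at r)" if "0 < r" for r
    using G_C1 that at_within_open[of r "{0<..}"] by (force simp: C1_deriv_on_def)
  have G': "continuous_on {0<..} ?G'"
    using G_C1 by (simp add: C1_deriv_on_def)
  have "particle_minimizer L L' \<theta> G ?G' V c T N p q x"
    by (rule particle_minimizer.intro[OF convex particle_minimizer_axioms.intro])
      (fact G G' L_bdd N_pos T_pos c sol gap)+
  then show ?thesis
    by (rule particle_minimizer.differentiable_and_conservation)
qed

end
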